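(* Let $0<\delta<1$, $\rho>0$, $0<p\le 1-\frac1{2^{1+\delta}}$, and let $\{x_i^t\}_{t\ge0}$ ($i\in V$) be generated by the DRGFMD algorithm (described in the context, with $X$ compact) with stepsizes $\alpha_0=1$ and $\alpha_t=\frac{\rho}{(t+1)^\delta}$ for $t\ge1$. For $l\in V$ let $$\widetilde x_l^T=\frac{\sum_{t=1}^T x_l^t/\alpha_t}{\sum_{t=1}^T1/\alpha_t}.$$ Put $$C_{\delta,1}=\frac{(\delta+1)d_\phi^2}{p\rho},\qquad C_{\delta,2}=\Big[\frac{(n+4)^2\widehat L^2}{2\sigma_\phi}+\frac{\widetilde C(\rho+1-\delta)}{\rho(1-\delta)}\Big]\cdot\frac{\rho(\delta+1)}{p},$$ $$\widetilde C=\frac{2N(n+4)^2\Gamma\widehat L^2}{\sigma_\phi(1-\gamma)}+\frac{4(n+4)^2\widehat L^2}{\sigma_\phi},\qquad C_\delta=\max\{C_{\delta,1},C_{\delta,2}\}.$$ Then for every $l\in V$, every optimal point $x^\star$ and every $T\ge1$: $$\mathbb E[f(\widetilde x_l^T)]-f(x^\star)\le\sqrt n\,\widehat L\cdot\frac1N\sum_{i=1}^N\mu_i+\frac{2C_\delta}{T^{\delta}}\quad\text{if }\delta\in(0,\tfrac12);$$ $$\mathbb E[f(\widetilde x_l^T)]-f(x^\star)\le\sqrt n\,\widehat L\cdot\frac1N\sum_{i=1}^N\mu_i+\frac{2C_\delta}{\sqrt T}\quad\text{if }\delta=\tfrac12;$$ $$\mathbb E[f(\widetilde x_l^T)]-f(x^\star)\le\sqrt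 n\,\widehat L\cdot\frac1N\sum_{i=1}^N\mu_i+\frac{2C_\delta}{T^{1-\delta}}\quad\text{if }\delta\in(\tfrac12,1).$$
   Context: Network. There are $N$ agents $V=\{1,\dots,N\}$. At each time $t=0,1,2,\dots$ communication is described by a directed graph $G_t=(V,E^t,P^t)$ with communication matrix $P^t\in\mathbb R^{N\times N}$. Network assumption: each $P^t$ is doubly stochastic; there is a positive integer $B$ such that $(V,\bigcup_{s=0}^{B-1}E^{t+s})$ is strongly connected for every $t$; there is $0<\zeta<1$ with $[P^t]_{ii}\ge\zeta$ for all $i,t$ and $[P^t]_{ij}\ge\zeta$ whenever $(j,i)\in E^t$. Set $\Gamma=(1-\frac{\zeta}{4N^2})^{-2}$ and $\gamma=(1-\frac{\zeta}{4N^2})^{1/B}$. Problem. $X\subset\mathbb R^n$ is a nonempty compact convex set; each $f_i:\mathbb R^n\to\mathbb R$ is convex (not necessarily smooth) and $L_i$-Lipschitz on $X$ with respect to the Euclidean norm $\|\cdot\|$; $\widehat L=\max_i L_i$; $f=\frac1N\sum_{i=1}^N f_i$; an optimal point $x^\star$ is a minimizer of $f$ over $X$. Bregman divergence. $\phi$ is a real function defined on an open set containing $X$, three times continuously differentiable and $\sigma_\phi$-strongly convex with $\sigma_\phi>0$, i.e. $\phi(\theta x+(1-\theta)y)\le\theta\phi(x)+(1-\theta)\phi(y)-\frac{\sigma_\phi\theta(1-\theta)}2\|x-y\|^2$ for $x,y\in X$, $\theta\in[0,1]$; with $H=\nabla^2\phi$, the matrices $H(y)$ and $H(y)+\nabla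 H(y)(y-x)$ are positive semidefinite for all $x,y\in X$ (here $\nabla H(y)(v)$ is the directional derivative of $H$ at $y$ in direction $v$). $D_\phi(x,y)=\phi(x)-\phi(y)-\langle\nabla\phi(y),x-y\rangle$. The constant $d_\phi$ satisfies $\sup_{x,y\in X}D_\phi(x,y)\le d_\phi^2$. DRGFMD algorithm. Smoothing parameters $\mu_i>0$ and stepsizes $\alpha_t$ are given. $\xi_i^t$ ($i\in V$, $t\ge0$) are independent standard Gaussian vectors in $\mathbb R^n$. Starting from $x_i^0=0\in X$ for all $i$, for $t\ge 0$: $$y_i^t=\sum_{j=1}^N[P^t]_{ij}x_j^t,\qquad x_i^{t+1}=\arg\min_{x\in X}\Big\{\alpha_t\Big\langle \frac{f_i(y_i^t+\mu_i\xi_i^t)-f_i(y_i^t)}{\mu_i}\xi_i^t,\,x\Big\rangle+D_\phi(x,y_i^t)\Big\}.$$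
   Formalization: Each f_i is required to be L_i-Lipschitz on all of R^n instead of only on X; with the Lipschitz bound only on X the claim is false, because the algorithm evaluates f_i at points outside X. *)

theory Defs
  imports "HOL-Probability.Probability" "Graph_Theory.Digraph_Component"
begin

section \<open>Time-varying communication network\<close>

definition doubly_stochastic :: "real^'v^'v \<Rightarrow> bool" where
  "doubly_stochastic A \<longleftrightarrow>
     (\<forall>i j. 0 \<le> A $ i $ j) \<and> (\<forall>i. (\<Sum>j\<in>UNIV. A $ i $ j) = 1) \<and> (\<forall>j. (\<Sum>i\<in>UNIV. A $ i $ j) = 1)"

text \<open>The agents are the elements of the finite type \<open>'v\<close>. A pair \<open>(j, i) \<in> E t\<close> is an arc
  from \<open>j\<close> to \<open>i\<close> at time \<open>t\<close>; its weight is \<open>P t $ i $ j\<close>, receiver first.\<close>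

definition network ::
    "(nat \<Rightarrow> ('v::finite \<times> 'v) set) \<Rightarrow> (nat \<Rightarrow> real^'v^'v) \<Rightarrow> nat \<Rightarrow> real \<Rightarrow> bool" where
  "network E P B \<zeta> \<longleftrightarrow>
     (\<forall>t. doubly_stochastic (P t)) \<and>
     0 < B \<and>
     (\<forall>t. strongly_connected (with_proj \<lparr>pverts = UNIV, parcs = (\<Union>s\<in>{0..B - 1}. E (t + s))\<rparr>)) \<and>
     0 < \<zeta> \<and> \<zeta> < 1 \<and>
     (\<forall>t i. \<zeta> \<le> P t $ i $ i) \<and>
     (\<forall>t i j. (j, i) \<in> E t \<longrightarrow> \<zeta> \<le> P t $ i $ j)"

definition mix_const :: "nat \<Rightarrow> real \<Rightarrow> real" where
  "mix_const N \<zeta> = (1 - \<zeta> / (4 * real N ^ 2)) powr (-2)"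

definition mix_rate :: "nat \<Rightarrow> real \<Rightarrow> nat \<Rightarrow> real" where
  "mix_rate N \<zeta> B = (1 - \<zeta> / (4 * real N ^ 2)) powr (1 / real B)"


section \<open>Bregman divergence\<close>

definition gradient :: "(real^'n \<Rightarrow> real) \<Rightarrow> real^'n \<Rightarrow> real^'n" where
  "gradient \<phi> y = (THE D. GDERIV \<phi> y :> D)"

definition hessian :: "(real^'n \<Rightarrow> real) \<Rightarrow> real^'n \<Rightarrow> real^'n^'n" where
  "hessian \<phi> y = jacobian (gradient \<phi>) (at y)"

definition hessian_deriv :: "(real^'n \<Rightarrow> real) \<Rightarrow> real^'n \<Rightarrow> real^'n \<Rightarrow> real^'n^'n" where
  "hessian_deriv \<phi> y v = frechet_derivative (hessian \<phi>) (at y) v"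

definition C3_on :: "(real^'n) set \<Rightarrow> (real^'n \<Rightarrow> real) \<Rightarrow> bool" where
  "C3_on U \<phi> \<longleftrightarrow> open U \<and>
     (\<forall>y\<in>U. \<phi> differentiable (at y)) \<and>
     (\<forall>y\<in>U. gradient \<phi> differentiable (at y)) \<and>
     (\<forall>y\<in>U. hessian \<phi> differentiable (at y)) \<and>
     (\<forall>v. continuous_on U (\<lambda>y. hessian_deriv \<phi> y v))"

definition psd :: "real^'n^'n \<Rightarrow> bool" where
  "psd A \<longleftrightarrow> transpose A = A \<and> (\<forall>v. 0 \<le> v \<bullet> (A *v v))"

definition strongly_convex_on :: "(real^'n) set \<Rightarrow> real \<Rightarrow> (real^'n \<Rightarrow> real) \<Rightarrow> bool" where
  "strongly_convex_on X \<sigma> \<phi> \<longleftrightarrow>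
     (\<forall>x\<in>X. \<forall>y\<in>X. \<forall>\<theta>\<in>{0..1}.
        \<phi> (\<theta> *\<^sub>R x + (1 - \<theta>) *\<^sub>R y)
          \<le> \<theta> * \<phi> x + (1 - \<theta>) * \<phi> y - \<sigma> * \<theta> * (1 - \<theta>) / 2 * norm (x - y) ^ 2)"

definition bregman :: "(real^'n \<Rightarrow> real) \<Rightarrow> real^'n \<Rightarrow> real^'n \<Rightarrow> real" where
  "bregman \<phi> x y = \<phi> x - \<phi> y - gradient \<phi> y \<bullet> (x - y)"

definition bregman_generator ::
    "(real^'n) set \<Rightarrow> (real^'n) set \<Rightarrow> real \<Rightarrow> (real^'n \<Rightarrow> real) \<Rightarrow> bool" where
  "bregman_generator X U \<sigma> \<phi> \<longleftrightarrow>
     X \<subseteq> U \<and> C3_on U \<phi> \<and> 0 < \<sigma> \<and> strongly_convex_on X \<sigma> \<phi> \<and>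
     (\<forall>x\<in>X. \<forall>y\<in>X. psd (hessian \<phi> y) \<and> psd (hessian \<phi> y + hessian_deriv \<phi> y (y - x)))"


section \<open>The gradient-free mirror descent iteration\<close>

text \<open>The randomized difference quotient at \<open>y \<in> X\<close> queries \<open>g\<close> at \<open>y + \<mu> z\<close>, which in general lies
  outside the constraint set \<open>X\<close>. The Lipschitz bounds on the objectives therefore have to hold on
  the whole space. With bounds on \<open>X\<close> only, the error bound is false: take one agent,
  \<open>X = [-1, 1]\<close>, \<open>\<mu> = 1\<close>, quadratic \<open>\<phi>\<close> and \<open>g x = max (- \<epsilon> x) (- \<epsilon> + K (x - 1))\<close>, which is
  \<open>\<epsilon>\<close>-Lipschitz on \<open>X\<close>; for large \<open>K\<close> the iterates drift to \<open>-1\<close>, with gap \<open>2 \<epsilon>\<close>, while the bound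
  tends to \<open>\<epsilon>\<close>.\<close>

definition gf_oracle :: "(real^'n \<Rightarrow> real) \<Rightarrow> real \<Rightarrow> real^'n \<Rightarrow> real^'n \<Rightarrow> real^'n" where
  "gf_oracle g \<mu> y z = ((g (y + \<mu> *\<^sub>R z) - g y) / \<mu>) *\<^sub>R z"

definition consensus :: "real^'v^'v \<Rightarrow> ('v::finite \<Rightarrow> real^'n) \<Rightarrow> 'v \<Rightarrow> real^'n" where
  "consensus A x i = (\<Sum>j\<in>UNIV. (A $ i $ j) *\<^sub>R x j)"

text \<open>A sample path: \<open>z t i\<close> is the Gaussian direction and \<open>x t i\<close> the iterate of agent \<open>i\<close> at
  time \<open>t\<close>. Since \<open>X\<close> is compact and convex and \<open>\<phi>\<close> is strongly convex, the minimizer in each step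
  exists and is unique.\<close>

definition drgfmd ::
    "(real^'n) set \<Rightarrow> (real^'n \<Rightarrow> real) \<Rightarrow> ('v::finite \<Rightarrow> real^'n \<Rightarrow> real) \<Rightarrow> (nat \<Rightarrow> real^'v^'v) \<Rightarrow>
     ('v \<Rightarrow> real) \<Rightarrow> (nat \<Rightarrow> real) \<Rightarrow> (nat \<Rightarrow> 'v \<Rightarrow> real^'n) \<Rightarrow> (nat \<Rightarrow> 'v \<Rightarrow> real^'n) \<Rightarrow> bool" where
  "drgfmd X \<phi> f P \<mu> \<alpha> z x \<longleftrightarrow>
     (\<forall>i. x 0 i = 0) \<and>
     (\<forall>t i. let y = consensus (P t) (x t) i in
        is_arg_min (\<lambda>u. \<alpha> t * (gf_oracle (f i) (\<mu> i) y (z t i) \<bullet> u) + bregman \<phi> u y)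
                   (\<lambda>u. u \<in> X) (x (Suc t) i))"

definition std_gaussian_density :: "real^'n \<Rightarrow> real" where
  "std_gaussian_density z = (\<Prod>k\<in>UNIV. std_normal_density (z $ k))"

definition stepsize :: "real \<Rightarrow> real \<Rightarrow> nat \<Rightarrow> real" where
  "stepsize \<rho> \<delta> t = (if t = 0 then 1 else \<rho> / (real t + 1) powr \<delta>)"

definition weighted_avg :: "(nat \<Rightarrow> real) \<Rightarrow> (nat \<Rightarrow> real^'n) \<Rightarrow> nat \<Rightarrow> real^'n" where
  "weighted_avg \<alpha> x T = (1 / (\<Sum>t=1..T. 1 / \<alpha> t)) *\<^sub>R (\<Sum>t=1..T. (1 / \<alpha> t) *\<^sub>R x t)"

definition mean_objective :: "('v::finite \<Rightarrow> real^'n \<Rightarrow> real) \<Rightarrow> real^'n \<Rightarrow> real" where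
  "mean_objective f x = 1 / real CARD('v) * (\<Sum>i\<in>UNIV. f i x)"


section \<open>Constants\<close>

text \<open>Here \<open>N\<close> is the number of agents, \<open>n\<close> the dimension, \<open>Lh\<close> the largest Lipschitz constant.\<close>

definition C_tilde :: "nat \<Rightarrow> nat \<Rightarrow> real \<Rightarrow> real \<Rightarrow> real \<Rightarrow> nat \<Rightarrow> real" where
  "C_tilde N n Lh \<sigma> \<zeta> B =
     2 * real N * (real n + 4)^2 * mix_const N \<zeta> * Lh^2 / (\<sigma> * (1 - mix_rate N \<zeta> B))
       + 4 * (real n + 4)^2 * Lh^2 / \<sigma>"

definition C_delta1 :: "real \<Rightarrow> real \<Rightarrow> real \<Rightarrow> real \<Rightarrow> real" where
  "C_delta1 d \<delta> \<rho> p = (\<delta> + 1) * d^2 / (p * \<rho>)"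

definition C_delta2 ::
    "nat \<Rightarrow> nat \<Rightarrow> real \<Rightarrow> real \<Rightarrow> real \<Rightarrow> nat \<Rightarrow> real \<Rightarrow> real \<Rightarrow> real \<Rightarrow> real" where
  "C_delta2 N n Lh \<sigma> \<zeta> B \<delta> \<rho> p =
     ((real n + 4)^2 * Lh^2 / (2 * \<sigma>)
       + C_tilde N n Lh \<sigma> \<zeta> B * (\<rho> + 1 - \<delta>) / (\<rho> * (1 - \<delta>))) * (\<rho> * (\<delta> + 1) / p)"

definition C_delta ::
    "nat \<Rightarrow> nat \<Rightarrow> real \<Rightarrow> real \<Rightarrow> real \<Rightarrow> nat \<Rightarrow> real \<Rightarrow> real \<Rightarrow> real \<Rightarrow> real \<Rightarrow> real" where
  "C_delta N n Lh \<sigma> \<zeta> B d \<delta> \<rho> p =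
     max (C_delta1 d \<delta> \<rho> p) (C_delta2 N n Lh \<sigma> \<zeta> B \<delta> \<rho> p)"

end

theory Submission
  imports Defs
begin

text \<open>
  Fix an optimal point \<open>u\<close>. The proof follows the total divergence \<open>potential u t\<close>, the sum over
  the agents of the expected divergence of \<open>u\<close> from their iterates, through one round. Averaging
  with a doubly stochastic matrix does not increase it, because the condition on the Hessian of \<open>\<phi>\<close> makes the
  divergence convex in its second argument (\<open>convex_on_bregman_second\<close>). The mirror step lowers it
  by \<open>\<alpha> t\<close> times the inner product of the gradient estimate with \<open>y - u\<close>, where \<open>y\<close> is the averaged
  point, up to a second-order term in \<open>\<alpha> t\<close> (\<open>mirror_step_progress\<close>). The estimate is
  built from Gaussian noise that is independent of \<open>y\<close>, and its conditional mean is a subgradient at \<open>y\<close> of the Gaussian smoothing of \<open>f i\<close>, which exceeds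
  \<open>f i\<close> by at most \<open>\<mu> i * Lh * sqrt n\<close> (\<open>gf_oracle_expectation\<close>). Together this bounds the expected gap
  at the averaged points \<open>y\<close> (\<open>expected_progress\<close>).

  The theorem evaluates all objectives at the iterates of one agent \<open>l\<close>. By the Lipschitz property
  this costs a multiple of the disagreement, the Euclidean distance of the iterates from consensus.
  The disagreement is fed by the displacements of the mirror steps, of mean size
  at most \<open>\<alpha> t * n * Lh / \<sigma>\<close>, and shrinks by a fixed factor over every \<open>B\<close> rounds (\<open>disagreement_block\<close>).
  For that contraction, order the values that the agents hold in one coordinate and look at a gap between
  two consecutive values. Strong connectivity forces an arc of weight at least \<open>\<zeta>\<close> across the gap,
  and a convex function that is curved exactly on the gap must then drop in total
  (\<open>gap_potential_drop\<close>). Entries of the mixing matrices off the arcs may be positive, so mass can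
  leak across the gap before that arc appears; but leaking itself lowers the total, so either the
  drop has already happened or the two sides are still well separated when the arc appears. Summed over
  all gaps, the functions give the squared distance from the smallest value, and the drop of its total
  is the drop of the variance, since the mean is preserved.

  The resulting factor \<open>1 - \<zeta> / (16 N\<^sup>2)\<close> is weaker than the \<open>1 - \<zeta> / (4 N\<^sup>2)\<close> built into \<open>mix_rate\<close>.
  The constants absorb the loss: the bound on the mean displacement is proportional to \<open>n\<close>, whereas \<open>C_tilde\<close>
  contains \<open>(n + 4)\<^sup>2 \<ge> 4 n\<close> (\<open>C_tilde_ge\<close>).

  Finally the gap at time \<open>t\<close> is weighted with \<open>1 / \<alpha> t\<close> and summed. Summation by parts turns the
  divergences into \<open>d\<^sup>2 / (\<alpha> T)\<^sup>2\<close>, the second-order terms contribute a constant each, and the disagreements are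
  bounded with \<open>1 / \<alpha> t \<le> 1 / \<alpha> T\<close>. Division by the sum of the weights, of order \<open>T\<close> to the power
  \<open>1 + \<delta>\<close>, leaves \<open>T\<close> to the powers \<open>\<delta> - 1\<close> and \<open>- \<delta>\<close>; the larger one is the rate.
\<close>

section \<open>Contraction of the disagreement under mixing\<close>

text \<open>This is twice the integral over \<open>c\<close> in \<open>{b..a}\<close> of the positive part of \<open>x - c\<close>: convex, zero
  below \<open>b\<close>, quadratic on \<open>{b..a}\<close> and affine above \<open>a\<close>. Over adjacent intervals these functions add
  up to a square, which is what ties them to the variance.\<close>

definition gap_potential :: "real \<Rightarrow> real \<Rightarrow> real \<Rightarrow> real" where
  "gap_potential b a x = (max 0 (x - b))\<^sup>2 - (max 0 (x - a))\<^sup>2"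

text \<open>For \<open>b \<le> a\<close> the function is the maximum of the affine functions on the left-hand side. Convexity is
  used through this representation only.\<close>

lemma gap_potential_ge_tangent:
  assumes "0 \<le> \<theta>" "\<theta> \<le> a - b"
  shows "2 * \<theta> * (x - b) - \<theta>\<^sup>2 \<le> gap_potential b a x"
proof -
  consider "x \<le> b" | "b \<le> x" "x \<le> a" | "a \<le> x" by linarith
  then show ?thesis
  proof cases
    case 1
    then have "\<theta> * (x - b) \<le> 0" using assms by (simp add: mult_nonneg_nonpos)
    moreover have "gap_potential b a x = 0" using 1 assms by (simp add: gap_potential_def max_def)
    ultimately show ?thesis using zero_le_power2[of \<theta>] by linarith
  next
    case 2
    have "0 \<le> (x - b - \<theta>)\<^sup>2" by simp
    moreover have "gap_potential b a x = (x - b)\<^sup>2" using 2 by (auto simp: gap_potential_def max_def)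
    ultimately show ?thesis by (simp add: power2_eq_square algebra_simps)
  next
    case 3
    have "0 \<le> (a - b - \<theta>) * (2 * (x - b) - (a - b) - \<theta>)"
      using assms 3 by (intro mult_nonneg_nonneg) auto
    moreover have "gap_potential b a x = (x - b)\<^sup>2 - (x - a)\<^sup>2"
      using 3 assms by (auto simp: gap_potential_def max_def)
    ultimately show ?thesis by (simp add: power2_eq_square algebra_simps)
  qed
qed

lemma gap_potential_tangent:
  assumes "b \<le> a"
  obtains \<theta> where "0 \<le> \<theta>" "\<theta> \<le> a - b" "gap_potential b a x = 2 * \<theta> * (x - b) - \<theta>\<^sup>2"
proof -
  consider "x \<le> b" | "b \<le> x" "x \<le> a" | "a \<le> x" by linarith
  then show ?thesis
  proof cases
    case 1 then show ?thesis using assms by (intro that[of 0]) (auto simp: gap_potential_def max_def)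
  next
    case 2 then show ?thesis
      by (intro that[of "x - b"]) (auto simp: gap_potential_def max_def power2_eq_square algebra_simps)
  next
    case 3 then show ?thesis using assms
      by (intro that[of "a - b"]) (auto simp: gap_potential_def max_def power2_eq_square algebra_simps)
  qed
qed

lemma gap_potential_jensen:
  assumes "finite I" "b \<le> a" "\<And>j. j \<in> I \<Longrightarrow> 0 \<le> w j" "sum w I = 1"
  shows "gap_potential b a (\<Sum>j\<in>I. w j * u j) \<le> (\<Sum>j\<in>I. w j * gap_potential b a (u j))"
proof -
  obtain \<theta> where \<theta>: "0 \<le> \<theta>" "\<theta> \<le> a - b"
    and eq: "gap_potential b a (\<Sum>j\<in>I. w j * u j) = 2 * \<theta> * ((\<Sum>j\<in>I. w j * u j) - b) - \<theta>\<^sup>2"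
    using gap_potential_tangent[OF \<open>b \<le> a\<close>] by blast
  have "2 * \<theta> * ((\<Sum>j\<in>I. w j * u j) - b) - \<theta>\<^sup>2
      = (\<Sum>j\<in>I. 2 * \<theta> * (w j * u j)) - (2 * \<theta> * b + \<theta>\<^sup>2) * sum w I"
    using assms(4) by (simp add: sum_distrib_left right_diff_distrib)
  also have "\<dots> = (\<Sum>j\<in>I. w j * (2 * \<theta> * (u j - b) - \<theta>\<^sup>2))"
    unfolding sum_distrib_left sum_subtractf[symmetric] by (intro sum.cong) (simp_all add: algebra_simps)
  also have "\<dots> \<le> (\<Sum>j\<in>I. w j * gap_potential b a (u j))"
    using assms(3) by (intro sum_mono mult_left_mono gap_potential_ge_tangent \<theta>) auto
  finally show ?thesis using eq by simp
qed

lemma gap_potential_split: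
  "gap_potential b a x = gap_potential b m x + gap_potential m c x + gap_potential c a x"
  by (simp add: gap_potential_def)

text \<open>A reflection changes the function by an affine one only, so Jensen gaps are preserved. This turns
  statements about the upper side of a gap into statements about the lower side.\<close>

lemma gap_potential_reflect:
  "gap_potential (- a) (- b) (- x) = gap_potential b a x - (a - b) * (2 * x - a - b)"
  by (cases "x \<le> a"; cases "x \<le> b")
     (auto simp: gap_potential_def max_def power2_eq_square algebra_simps)

text \<open>One receiver on the upper side, on the interval from \<open>c - l\<close> to \<open>c\<close>. Here \<open>p\<close> is the weight of its
  own side, \<open>v\<close> the weighted excess of that side above \<open>c\<close>, and \<open>r\<close> the weighted deficit below
  \<open>c\<close> of the other side; the new value is \<open>c - r + v\<close> and the right-hand side is the Jensen gap. If the
  new value stays above \<open>c - l\<close>, the gap grows linearly with the leak \<open>r\<close>; otherwise it is at least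
  \<open>p * l\<^sup>2\<close>.\<close>

lemma leak_arith:
  fixes \<zeta> p v r l c :: real
  assumes "0 < \<zeta>" "\<zeta> \<le> p" "p \<le> 1" "0 \<le> v" "(1 - p) * (2 * l) \<le> r" "0 < l"
  shows "min (\<zeta> * l\<^sup>2) (r * l / 2) \<le> l * (2 * v + p * l) - gap_potential (c - l) c (c - r + v)"
proof -
  have r0: "0 \<le> r" using assms by (smt (verit) mult_nonneg_nonneg)
  have k: "(1 - p) * l\<^sup>2 \<le> r * l / 2"
    using mult_right_mono[OF assms(5), of "l / 2"] assms(6) by (simp add: power2_eq_square algebra_simps)
  consider "v \<ge> r" | "v < r" "r - v \<le> l" | "l < r - v" by linarith
  then show ?thesis
  proof cases
    case 1
    have "gap_potential (c - l) c (c - r + v) = (v - r + l)\<^sup>2 - (v - r)\<^sup>2"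
      using 1 assms(6) by (auto simp: gap_potential_def max_def algebra_simps)
    then have "l * (2 * v + p * l) - gap_potential (c - l) c (c - r + v) = 2 * l * r - (1 - p) * l\<^sup>2"
      by (simp add: power2_eq_square algebra_simps)
    moreover have "0 \<le> r * l" using r0 assms by simp
    ultimately show ?thesis using k
      by (intro min.coboundedI2) (auto simp: algebra_simps)
  next
    case 2
    have "gap_potential (c - l) c (c - r + v) = (l - (r - v))\<^sup>2"
      using 2 assms(6) by (auto simp: gap_potential_def max_def algebra_simps)
    then have "l * (2 * v + p * l) - gap_potential (c - l) c (c - r + v)
        = 2 * l * r - (1 - p) * l\<^sup>2 - (r - v)\<^sup>2"
      by (simp add: power2_eq_square algebra_simps)
    moreover have "(r - v)\<^sup>2 \<le> r * l"
      using 2 assms unfolding power2_eq_square by (intro mult_mono) auto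
    ultimately show ?thesis using k by (intro min.coboundedI2) (auto simp: algebra_simps)
  next
    case 3
    have "gap_potential (c - l) c (c - r + v) = 0"
      using 3 assms(6) by (auto simp: gap_potential_def max_def algebra_simps)
    moreover have "\<zeta> * l\<^sup>2 \<le> p * l\<^sup>2" using assms by (intro mult_right_mono) auto
    moreover have "0 \<le> l * v" using assms by simp
    ultimately show ?thesis by (intro min.coboundedI1) (auto simp: power2_eq_square algebra_simps)
  qed
qed

text \<open>Nothing of the lower side lies above the midpoint of the gap. Hence only the part of the potential
  between the midpoint and \<open>a - s\<close> matters, and there it vanishes on the lower side and is affine
  on the upper one, which reduces the claim to real arithmetic. The parts on both sides of this interval
  contribute nonnegative Jensen gaps.\<close>

lemma jensen_gap_ge_leak:
  fixes w u :: "'v::finite \<Rightarrow> real"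
  assumes w: "\<And>j. 0 \<le> w j" "sum w UNIV = 1" and "0 < \<zeta>" "i \<in> S" "\<zeta> \<le> w i"
    and "b < a" "0 \<le> s" "s \<le> (a - b) / 4"
    and S: "\<And>j. j \<in> S \<Longrightarrow> a - s \<le> u j" "\<And>j. j \<notin> S \<Longrightarrow> u j \<le> b + s"
  defines "r \<equiv> (\<Sum>j\<in>-S. w j * (a - s - u j))" and "l \<equiv> (a - b) / 2 - s"
  shows "min (\<zeta> * l\<^sup>2) (r * l / 2)
           \<le> (\<Sum>j\<in>UNIV. w j * gap_potential b a (u j)) - gap_potential b a (\<Sum>j\<in>UNIV. w j * u j)"
    and "a - s - r \<le> (\<Sum>j\<in>UNIV. w j * u j)"
proof -
  let ?J = "(\<Sum>j\<in>UNIV. w j * gap_potential b a (u j)) - gap_potential b a (\<Sum>j\<in>UNIV. w j * u j)"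
  define c where "c = a - s"
  define m where "m = c - l"
  define q where "q = sum w S"
  define v where "v = (\<Sum>j\<in>S. w j * (u j - c))"
  have l0: "0 < l" using assms by (simp add: l_def)
  have mc: "m = (a + b) / 2" by (simp add: m_def c_def l_def field_simps)
  have split: "sum g UNIV = sum g S + sum g (-S)" for g :: "'v \<Rightarrow> real"
    by (metis Compl_partition finite_class.finite Compl_disjoint sum.union_disjoint finite)
  have qC: "sum w (-S) = 1 - q" using split[of w] w(2) by (simp add: q_def)
  have mean: "(\<Sum>j\<in>UNIV. w j * u j) = c - r + v"
  proof -
    have "v - r = (\<Sum>j\<in>S. w j * (u j - c)) + (\<Sum>j\<in>-S. w j * (u j - c))"
      unfolding v_def r_def c_def diff_conv_add_uminus[of "sum _ S"] sum_negf[symmetric]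
      by (intro arg_cong2[where f="(+)"] sum.cong) (simp_all add: algebra_simps)
    also have "\<dots> = (\<Sum>j\<in>UNIV. w j * (u j - c))" by (simp only: split)
    also have "\<dots> = (\<Sum>j\<in>UNIV. w j * u j) - c"
      using w(2) by (simp add: right_diff_distrib sum_subtractf sum_distrib_right[symmetric])
    finally show ?thesis by simp
  qed
  have v0: "0 \<le> v" unfolding v_def using w S by (intro sum_nonneg) (auto simp: c_def)
  show "a - s - r \<le> (\<Sum>j\<in>UNIV. w j * u j)" using mean v0 by (simp add: c_def)
  have q: "\<zeta> \<le> q" unfolding q_def using member_le_sum[of i S w] assms by auto
  have q1: "q \<le> 1" using qC w sum_nonneg[of "-S" w] by auto
  have "(1 - q) * (2 * l) = (\<Sum>j\<in>-S. w j * (2 * l))" by (simp add: qC[symmetric] sum_distrib_right)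
  also have "\<dots> \<le> r" unfolding r_def
  proof (intro sum_mono mult_left_mono)
    fix j assume "j \<in> - S"
    then show "2 * l \<le> a - s - u j" using S(2)[of j] by (auto simp: l_def field_simps)
  qed (use w in auto)
  finally have rl: "(1 - q) * (2 * l) \<le> r" .
  have "(\<Sum>j\<in>UNIV. w j * gap_potential m c (u j))
      = (\<Sum>j\<in>S. w j * (l * (2 * (u j - c) + l))) + (\<Sum>j\<in>-S. 0)"
  proof (unfold split, intro arg_cong2[where f="(+)"] sum.cong refl)
    fix j assume "j \<in> S"
    then have "gap_potential m c (u j) = (u j - m)\<^sup>2 - (u j - c)\<^sup>2"
      using S(1)[of j] l0 by (auto simp: gap_potential_def max_def c_def m_def)
    then have "gap_potential m c (u j) = l * (2 * (u j - c) + l)"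
      by (simp add: m_def power2_eq_square algebra_simps)
    then show "w j * gap_potential m c (u j) = w j * (l * (2 * (u j - c) + l))" by simp
  next
    fix j assume "j \<in> - S"
    then have "u j \<le> b + s" using S(2) by simp
    then have "u j \<le> m" using \<open>b < a\<close> \<open>s \<le> (a - b) / 4\<close> by (simp add: mc field_simps)
    then show "w j * gap_potential m c (u j) = 0"
      using l0 by (auto simp: gap_potential_def max_def m_def)
  qed
  also have "\<dots> = l * (2 * v + q * l)"
    by (simp add: v_def q_def sum_distrib_left sum_distrib_right sum.distrib[symmetric] algebra_simps)
  finally have mid: "(\<Sum>j\<in>UNIV. w j * gap_potential m c (u j)) = l * (2 * v + q * l)" .
  have "min (\<zeta> * l\<^sup>2) (r * l / 2)
      \<le> (\<Sum>j\<in>UNIV. w j * gap_potential m c (u j)) - gap_potential m c (\<Sum>j\<in>UNIV. w j * u j)"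
    using leak_arith[OF \<open>0 < \<zeta>\<close> q q1 v0 rl l0, of c, folded m_def] by (simp only: mid mean)
  moreover have "gap_potential b m (\<Sum>j\<in>UNIV. w j * u j) \<le> (\<Sum>j\<in>UNIV. w j * gap_potential b m (u j))"
    using w \<open>b < a\<close> by (intro gap_potential_jensen) (auto simp: mc)
  moreover have "gap_potential c a (\<Sum>j\<in>UNIV. w j * u j) \<le> (\<Sum>j\<in>UNIV. w j * gap_potential c a (u j))"
    using w assms by (intro gap_potential_jensen) (auto simp: c_def)
  moreover have "(\<Sum>j\<in>UNIV. w j * gap_potential b a (u j)) = (\<Sum>j\<in>UNIV. w j * gap_potential b m (u j))
      + (\<Sum>j\<in>UNIV. w j * gap_potential m c (u j)) + (\<Sum>j\<in>UNIV. w j * gap_potential c a (u j))"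
    by (simp add: gap_potential_split[of b a _ m c] sum.distrib algebra_simps)
  ultimately show "min (\<zeta> * l\<^sup>2) (r * l / 2)
           \<le> ?J"
    by (simp add: gap_potential_split[of b a _ m c])
qed

lemma jensen_gap_ge_leak_below:
  fixes w u :: "'v::finite \<Rightarrow> real"
  assumes w: "\<And>j. 0 \<le> w j" "sum w UNIV = 1" and "0 < \<zeta>" "i \<notin> S" "\<zeta> \<le> w i"
    and "b < a" "0 \<le> s" "s \<le> (a - b) / 4"
    and S: "\<And>j. j \<in> S \<Longrightarrow> a - s \<le> u j" "\<And>j. j \<notin> S \<Longrightarrow> u j \<le> b + s"
  defines "r \<equiv> (\<Sum>j\<in>S. w j * (u j - b - s))" and "l \<equiv> (a - b) / 2 - s"
  shows "min (\<zeta> * l\<^sup>2) (r * l / 2)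
           \<le> (\<Sum>j\<in>UNIV. w j * gap_potential b a (u j)) - gap_potential b a (\<Sum>j\<in>UNIV. w j * u j)"
    and "(\<Sum>j\<in>UNIV. w j * u j) \<le> b + s + r"
proof -
  let ?J = "(\<Sum>j\<in>UNIV. w j * gap_potential b a (u j)) - gap_potential b a (\<Sum>j\<in>UNIV. w j * u j)"
  note refl = jensen_gap_ge_leak[of w \<zeta> i "- S" "- a" "- b" s "\<lambda>j. - u j"]
  have r: "(\<Sum>j\<in>- (- S). w j * (- b - s - - u j)) = r" by (simp add: r_def algebra_simps)
  have l: "(- b - - a) / 2 - s = l" by (simp add: l_def)
  have neg: "(\<Sum>j\<in>UNIV. w j * - u j) = - (\<Sum>j\<in>UNIV. w j * u j)" by (simp add: sum_negf)
  have "(\<Sum>j\<in>UNIV. w j * gap_potential (- a) (- b) (- u j)) - gap_potential (- a) (- b) (- (\<Sum>j\<in>UNIV. w j * u j))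
    = ?J
      - (a - b) * ((\<Sum>j\<in>UNIV. w j * (2 * u j - a - b)) - (2 * (\<Sum>j\<in>UNIV. w j * u j) - a - b))"
  proof -
    have "(\<Sum>j\<in>UNIV. w j * gap_potential (- a) (- b) (- u j))
        = (\<Sum>j\<in>UNIV. w j * gap_potential b a (u j)) - (a - b) * (\<Sum>j\<in>UNIV. w j * (2 * u j - a - b))"
      unfolding gap_potential_reflect sum_distrib_left sum_subtractf[symmetric]
      by (intro sum.cong) (simp_all add: algebra_simps)
    then show ?thesis by (simp add: gap_potential_reflect algebra_simps)
  qed
  also have "(\<Sum>j\<in>UNIV. w j * (2 * u j - a - b)) = 2 * (\<Sum>j\<in>UNIV. w j * u j) - (a + b) * sum w UNIV"
    by (simp add: sum_distrib_left sum_subtractf[symmetric] algebra_simps)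
  finally have J: "(\<Sum>j\<in>UNIV. w j * gap_potential (- a) (- b) (- u j)) - gap_potential (- a) (- b) (- (\<Sum>j\<in>UNIV. w j * u j))
    = ?J"
    by (simp add: w(2))
  have prem: "0 \<le> w j" "sum w UNIV = 1" "0 < \<zeta>" "i \<in> - S" "\<zeta> \<le> w i" "- a < - b" "0 \<le> s"
    "s \<le> (- b - - a) / 4" "j \<in> - S \<Longrightarrow> - b - s \<le> - u j" "j \<notin> - S \<Longrightarrow> - u j \<le> - a + s" for j
    subgoal using w by simp
    using w assms(3-8) S(1)[of j] S(2)[of j] by auto
  show "min (\<zeta> * l\<^sup>2) (r * l / 2)
           \<le> ?J"
    using refl(1)[OF prem] unfolding neg r l J .
  have "- b - s - r \<le> - (\<Sum>j\<in>UNIV. w j * u j)"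
    using refl(2)[OF prem] unfolding neg r .
  then show "(\<Sum>j\<in>UNIV. w j * u j) \<le> b + s + r" by simp
qed

fun mixing_run :: "(nat \<Rightarrow> real^'v^'v) \<Rightarrow> nat \<Rightarrow> ('v::finite \<Rightarrow> 'a::real_vector) \<Rightarrow> 'v \<Rightarrow> 'a" where
  "mixing_run A 0 u = u"
| "mixing_run A (Suc k) u = (\<lambda>i. \<Sum>j\<in>UNIV. A k $ i $ j *\<^sub>R mixing_run A k u j)"

lemma sum_doubly_stochastic:
  fixes g :: "'v::finite \<Rightarrow> 'a::real_vector"
  assumes "doubly_stochastic A"
  shows "(\<Sum>i\<in>UNIV. \<Sum>j\<in>UNIV. A $ i $ j *\<^sub>R g j) = (\<Sum>j\<in>UNIV. g j)"
proof -
  have "(\<Sum>i\<in>UNIV. \<Sum>j\<in>UNIV. A $ i $ j *\<^sub>R g j) = (\<Sum>j\<in>UNIV. (\<Sum>i\<in>UNIV. A $ i $ j) *\<^sub>R g j)"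
    by (subst sum.swap) (simp add: scaleR_sum_left)
  then show ?thesis using assms by (simp add: doubly_stochastic_def)
qed

text \<open>Suppose the total drop stays below \<open>\<zeta> * (a - b)\<^sup>2 / 32\<close>. As each leak is paid for by a Jensen gap, the
  cumulated drop bounds how far the two sides have moved towards each other: by less than a
  quarter of the gap each. The arc that crosses the gap at time \<open>k0\<close> then meets values at least half
  a gap apart, and it alone causes a larger drop.\<close>

lemma gap_potential_drop:
  fixes u :: "'v::finite \<Rightarrow> real"
  assumes A: "\<And>k. doubly_stochastic (A k)" and diag: "\<And>k i. \<zeta> \<le> A k $ i $ i"
    and \<zeta>: "0 < \<zeta>" "\<zeta> < 1" and "b < a"
    and S: "\<And>i. i \<in> S \<Longrightarrow> a \<le> u i" "\<And>i. i \<notin> S \<Longrightarrow> u i \<le> b"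
    and cross: "k0 < B" "i0 \<in> S" "j0 \<notin> S" "\<zeta> \<le> A k0 $ i0 $ j0"
  shows "\<zeta> * (a - b)\<^sup>2 / 32
    \<le> (\<Sum>i\<in>UNIV. gap_potential b a (u i)) - (\<Sum>i\<in>UNIV. gap_potential b a (mixing_run A B u i))"
proof (rule ccontr)
  assume small: "\<not> ?thesis"
  define g where "g = a - b"
  define v where "v k = mixing_run A k u" for k
  define F where "F k = (\<Sum>i\<in>UNIV. gap_potential b a (v k i))" for k
  define J where "J k i = (\<Sum>j\<in>UNIV. A k $ i $ j * gap_potential b a (v k j)) - gap_potential b a (v (Suc k) i)" for k i
  have g0: "0 < g" using \<open>b < a\<close> by (simp add: g_def)
  have v_Suc: "v (Suc k) i = (\<Sum>j\<in>UNIV. A k $ i $ j * v k j)" for k i by (simp add: v_def)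
  have row: "sum (($) (A k $ i)) UNIV = 1" "\<And>j. 0 \<le> A k $ i $ j" for k i
    using A[of k] by (auto simp: doubly_stochastic_def)
  have J0: "0 \<le> J k i" for k i
    using gap_potential_jensen[of UNIV b a "\<lambda>j. A k $ i $ j" "v k"] row[of k i] \<open>b < a\<close>
    by (simp add: J_def v_Suc)
  have F_Suc: "F k - F (Suc k) = (\<Sum>i\<in>UNIV. J k i)" for k
    using sum_doubly_stochastic[OF A[of k], of "\<lambda>j. gap_potential b a (v k j)"]
    by (simp add: F_def J_def sum_subtractf)
  have J_le: "J k i \<le> F k - F (Suc k)" for k i
    unfolding F_Suc using J0 by (intro member_le_sum) auto
  have F_step: "F (Suc k) \<le> F k" for k using J_le[of k undefined] J0[of k undefined] by linarith
  then have F_anti: "F k' \<le> F k" if "k \<le> k'" for k k'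
    using lift_Suc_antimono_le[of F k k'] that by blast
  \<comment> \<open>By \<open>leak\<close> below, a receiver moves into the gap by at most \<open>8 / g\<close> times its Jensen gap; \<open>s k\<close>
    bounds the total of these movements.\<close>
  define s where "s k = 8 * (F 0 - F k) / g" for k
  have small': "F 0 - F B < \<zeta> * g\<^sup>2 / 32" using small by (simp add: F_def v_def g_def not_le)
  have small_k: "F 0 - F k < \<zeta> * g\<^sup>2 / 32" if "k \<le> B" for k using F_anti[OF that] small' by linarith
  have s0: "0 \<le> s k" for k using F_anti[of 0 k] g0 by (simp add: s_def)
  have s_le: "s k \<le> g / 4" if "k \<le> B" for k
  proof -
    have "s k \<le> 8 * (\<zeta> * g\<^sup>2 / 32) / g"
      unfolding s_def using small_k[OF that] g0 by (intro divide_right_mono) auto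
    also have "\<dots> = \<zeta> * g / 4" using g0 by (simp add: power2_eq_square)
    also have "\<dots> \<le> g / 4" using \<zeta> g0 by simp
    finally show ?thesis .
  qed
  have leak: "r \<le> 8 * J k i / g \<and> r < \<zeta> * g / 2" if "min (\<zeta> * (g / 2 - s k)\<^sup>2) (r * (g / 2 - s k) / 2) \<le> J k i" "k < B" "0 \<le> r"
    for r k i
  proof -
    have l: "g / 4 \<le> g / 2 - s k" using s_le[of k] that by simp
    have Jk: "J k i < \<zeta> * g\<^sup>2 / 32"
      using J_le[of k i] F_anti[of 0 k] small_k[of "Suc k"] that by linarith
    have "(g / 4)\<^sup>2 \<le> (g / 2 - s k)\<^sup>2" using l g0 by (intro power_mono) auto
    then have "\<zeta> * (g / 4)\<^sup>2 \<le> \<zeta> * (g / 2 - s k)\<^sup>2" using \<zeta> by (intro mult_left_mono) auto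
    moreover have "J k i < \<zeta> * (g / 4)\<^sup>2"
    proof -
      have "0 < \<zeta> * g\<^sup>2" using \<zeta> g0 by simp
      then show ?thesis using Jk by (simp add: power_divide)
    qed
    ultimately have "r * (g / 2 - s k) / 2 \<le> J k i" using that(1) by linarith
    moreover have "r * (g / 4) / 2 \<le> r * (g / 2 - s k) / 2" using l that by (intro divide_right_mono mult_left_mono) auto
    ultimately have *: "r * g \<le> 8 * J k i" by linarith
    moreover have "0 < \<zeta> * g\<^sup>2" using \<zeta> g0 by simp
    ultimately have "r * g < \<zeta> * g\<^sup>2 / 2" using Jk by linarith
    then have "r * g < \<zeta> * g / 2 * g" by (simp add: power2_eq_square)
    then have "r < \<zeta> * g / 2" using g0 by simp
    moreover have "r \<le> 8 * J k i / g" using * g0 by (simp add: pos_le_divide_eq)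
    ultimately show ?thesis by simp
  qed
  have s_Suc: "s k + 8 * J k i / g \<le> s (Suc k)" for k i
    unfolding s_def add_divide_distrib[symmetric] using J_le[of k i] g0 by (intro divide_right_mono) auto
  \<comment> \<open>The invariant: up to the cumulated leak, the two sides of the gap stay separated.\<close>
  have sep: "k \<le> B \<Longrightarrow> (\<forall>i\<in>S. a - s k \<le> v k i) \<and> (\<forall>i\<in>-S. v k i \<le> b + s k)" for k
  proof (induction k)
    case 0 then show ?case using S by (auto simp: v_def s_def)
  next
    case (Suc k)
    then have IH: "\<And>i. i \<in> S \<Longrightarrow> a - s k \<le> v k i" "\<And>i. i \<notin> S \<Longrightarrow> v k i \<le> b + s k" by auto
    have sk: "s k \<le> (a - b) / 4" using s_le[of k] Suc.prems by (simp add: g_def)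
    show ?case
    proof (intro conjI ballI)
      fix i assume i: "i \<in> S"
      note jg = jensen_gap_ge_leak[of "\<lambda>j. A k $ i $ j" _ _ _ _ _ _ "v k", OF row(2,1) \<zeta>(1) i diag \<open>b < a\<close> s0[of k] sk IH]
      have "0 \<le> (\<Sum>j\<in>- S. A k $ i $ j * (a - s k - v k j))"
        using row IH sk \<open>b < a\<close> by (intro sum_nonneg mult_nonneg_nonneg) (auto simp: field_simps, smt (verit))
      from leak[OF _ _ this, of k i] jg(1) Suc.prems
      have "(\<Sum>j\<in>- S. A k $ i $ j * (a - s k - v k j)) \<le> 8 * J k i / g" by (simp add: J_def v_Suc g_def)
      then show "a - s (Suc k) \<le> v (Suc k) i" using jg(2) s_Suc[of k i] by (simp add: v_Suc)
    next
      fix i assume "i \<in> - S"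
      then have i: "i \<notin> S" by simp
      note jg = jensen_gap_ge_leak_below[of "\<lambda>j. A k $ i $ j" _ _ _ _ _ _ "v k", OF row(2,1) \<zeta>(1) i diag \<open>b < a\<close> s0[of k] sk IH]
      have "0 \<le> (\<Sum>j\<in>S. A k $ i $ j * (v k j - b - s k))"
        using row IH sk \<open>b < a\<close> by (intro sum_nonneg mult_nonneg_nonneg) (auto simp: field_simps, smt (verit))
      from leak[OF _ _ this, of k i] jg(1) Suc.prems
      have "(\<Sum>j\<in>S. A k $ i $ j * (v k j - b - s k)) \<le> 8 * J k i / g" by (simp add: J_def v_Suc g_def)
      then show "v (Suc k) i \<le> b + s (Suc k)" using jg(2) s_Suc[of k i] by (simp add: v_Suc)
    qed
  qed
  have k0: "k0 \<le> B" using cross by simp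
  have IH: "\<And>i. i \<in> S \<Longrightarrow> a - s k0 \<le> v k0 i" "\<And>i. i \<notin> S \<Longrightarrow> v k0 i \<le> b + s k0" using sep[OF k0] by auto
  have sk: "s k0 \<le> (a - b) / 4" using s_le[OF k0] by (simp add: g_def)
  note jg = jensen_gap_ge_leak[of "\<lambda>j. A k0 $ i0 $ j" _ _ _ _ _ _ "v k0", OF row(2,1) \<zeta>(1) cross(2) diag \<open>b < a\<close> s0[of k0] sk IH]
  have nn: "0 \<le> A k0 $ i0 $ j * (a - s k0 - v k0 j)" if "j \<notin> S" for j
    using row IH(2)[OF that] sk \<open>b < a\<close> by (intro mult_nonneg_nonneg) (auto simp: field_simps)
  then have "0 \<le> (\<Sum>j\<in>- S. A k0 $ i0 $ j * (a - s k0 - v k0 j))" by (intro sum_nonneg) auto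
  from leak[OF _ _ this, of k0 i0] jg(1) cross(1)
  have "(\<Sum>j\<in>- S. A k0 $ i0 $ j * (a - s k0 - v k0 j)) < \<zeta> * g / 2" by (simp add: J_def v_Suc g_def)
  moreover have "A k0 $ i0 $ j0 * (a - s k0 - v k0 j0) \<le> (\<Sum>j\<in>- S. A k0 $ i0 $ j * (a - s k0 - v k0 j))"
    using nn cross by (intro member_le_sum) auto
  moreover have "\<zeta> * (g / 2) \<le> A k0 $ i0 $ j0 * (a - s k0 - v k0 j0)"
    using cross(4) IH(2)[OF cross(3)] sk g0 \<zeta> by (intro mult_mono) (auto simp: g_def field_simps)
  ultimately show False by simp
qed


text \<open>A path from \<open>j0\<close> to \<open>i0\<close> in the union graph has to enter \<open>S\<close>.\<close>

lemma network_crosses_cut: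
  fixes E :: "nat \<Rightarrow> ('v::finite \<times> 'v) set"
  assumes net: "network E P B \<zeta>" and S: "i0 \<in> S" "j0 \<notin> S"
  shows "\<exists>k<B. \<exists>i\<in>S. \<exists>j. j \<notin> S \<and> \<zeta> \<le> P (t + k) $ i $ j"
proof -
  define R where "R = (\<Union>s\<in>{0..B - 1}. E (t + s))"
  have "strongly_connected (with_proj \<lparr>pverts = UNIV, parcs = R\<rparr>)"
    using net by (simp add: network_def R_def)
  then have "(j0, i0) \<in> rtrancl_on UNIV R"
    by (simp add: strongly_connected_def reachable_def)
  then have "i0 \<notin> S \<or> (\<exists>i\<in>S. \<exists>j. j \<notin> S \<and> (j, i) \<in> R)"
    using S(2) by (induction rule: rtrancl_on_induct) auto
  then obtain i j where ij: "i \<in> S" "j \<notin> S" "(j, i) \<in> R" using S(1) by blast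
  then obtain k where "k \<le> B - 1" "(j, i) \<in> E (t + k)" by (auto simp: R_def)
  moreover have "0 < B" using net by (simp add: network_def)
  ultimately have "k < B" "\<zeta> \<le> P (t + k) $ i $ j" using net by (auto simp: network_def)
  then show ?thesis using ij by blast
qed

lemma mixing_run_bounds:
  fixes u :: "'v::finite \<Rightarrow> real"
  assumes "\<And>k. doubly_stochastic (A k)" "\<And>i. u i \<in> {lo..hi}"
  shows "mixing_run A k u i \<in> {lo..hi}"
proof (induction k arbitrary: i)
  case 0 then show ?case using assms by simp
next
  case (Suc k)
  have w: "sum (($) (A k $ i)) UNIV = 1" "\<And>j. 0 \<le> A k $ i $ j"
    using assms(1)[of k] by (auto simp: doubly_stochastic_def)
  have "(\<Sum>j\<in>UNIV. A k $ i $ j *\<^sub>R mixing_run A k u j) \<in> {lo..hi}"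
    using w Suc by (intro convex_sum) auto
  then show ?case by simp
qed

lemma sum_mixing_run:
  assumes "\<And>k. doubly_stochastic (A k)"
  shows "(\<Sum>i\<in>UNIV. mixing_run A k u i) = (\<Sum>i\<in>UNIV. u i)"
  by (induction k) (simp_all add: sum_doubly_stochastic[OF assms])

definition agent_mean :: "('v::finite \<Rightarrow> 'a::real_vector) \<Rightarrow> 'a" where
  "agent_mean x = (1 / real CARD('v)) *\<^sub>R (\<Sum>i\<in>UNIV. x i)"

definition sq_disagreement :: "('v::finite \<Rightarrow> 'a::real_normed_vector) \<Rightarrow> real" where
  "sq_disagreement x = (\<Sum>i\<in>UNIV. (norm (x i - agent_mean x))\<^sup>2)"

lemma sq_disagreement_shift:
  fixes u :: "'v::finite \<Rightarrow> real"
  shows "sq_disagreement u = (\<Sum>i\<in>UNIV. (u i - c)\<^sup>2) - real CARD('v) * (agent_mean u - c)\<^sup>2"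
proof -
  define m where "m = agent_mean u"
  have s: "(\<Sum>i\<in>UNIV. u i) = real CARD('v) * m" by (simp add: m_def agent_mean_def)
  have "(\<Sum>i\<in>UNIV. (u i - m)\<^sup>2) = (\<Sum>i\<in>UNIV. (u i - c)\<^sup>2 - 2 * (m - c) * u i + (m\<^sup>2 - c\<^sup>2))"
    by (intro sum.cong) (simp_all add: power2_eq_square algebra_simps)
  also have "\<dots> = (\<Sum>i\<in>UNIV. (u i - c)\<^sup>2) - 2 * (m - c) * (\<Sum>i\<in>UNIV. u i) + real CARD('v) * (m\<^sup>2 - c\<^sup>2)"
    by (simp add: sum.distrib sum_subtractf sum_distrib_left)
  also have "\<dots> = (\<Sum>i\<in>UNIV. (u i - c)\<^sup>2) - real CARD('v) * (m - c)\<^sup>2"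
    unfolding s by (simp add: power2_eq_square algebra_simps)
  finally show ?thesis by (simp add: sq_disagreement_def m_def)
qed

lemma sum_gap_potential_telescope:
  "(\<Sum>k<n. gap_potential (c k) (c (Suc k)) x) = (max 0 (x - c 0))\<^sup>2 - (max 0 (x - c n))\<^sup>2"
  unfolding gap_potential_def by (rule sum_lessThan_telescope')

text \<open>The variance is at most a quarter of the squared range times the number of agents, and the
  Cauchy-Schwarz inequality bounds the squared range by the number of gaps times their squares.\<close>

lemma sq_disagreement_le_gaps:
  fixes u :: "'v::finite \<Rightarrow> real" and c :: "nat \<Rightarrow> real"
  assumes "n \<le> CARD('v)" "\<And>i. u i \<in> {c 0..c n}"
  shows "sq_disagreement u \<le> (real CARD('v))\<^sup>2 / 4 * (\<Sum>k<n. (c (Suc k) - c k)\<^sup>2)"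
proof -
  let ?N = "real CARD('v)"
  define m where "m = (c 0 + c n) / 2"
  have "sq_disagreement u \<le> (\<Sum>i\<in>UNIV. (u i - m)\<^sup>2)"
    unfolding sq_disagreement_shift[of u m] by simp
  also have "\<dots> \<le> (\<Sum>i\<in>(UNIV::'v set). ((c n - c 0) / 2)\<^sup>2)"
  proof (intro sum_mono)
    fix i
    have "\<bar>u i - m\<bar> \<le> \<bar>(c n - c 0) / 2\<bar>" using assms(2)[of i] by (auto simp: m_def field_simps abs_if)
    then show "(u i - m)\<^sup>2 \<le> ((c n - c 0) / 2)\<^sup>2" by (simp only: abs_le_square_iff)
  qed
  also have "\<dots> = ?N / 4 * (\<Sum>k<n. c (Suc k) - c k)\<^sup>2"
    by (simp add: sum_lessThan_telescope power_divide)
  also have "\<dots> \<le> ?N / 4 * (real n * (\<Sum>k<n. (c (Suc k) - c k)\<^sup>2))"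
    using Cauchy_Schwarz_ineq_sum[of "\<lambda>_. 1" "\<lambda>k. c (Suc k) - c k" "{..<n}"]
    by (intro mult_left_mono) auto
  also have "\<dots> \<le> ?N / 4 * (?N * (\<Sum>k<n. (c (Suc k) - c k)\<^sup>2))"
    using assms(1) by (intro mult_left_mono mult_right_mono sum_nonneg) auto
  finally show ?thesis by (simp add: power2_eq_square mult.assoc)
qed

lemma enumerate_range:
  fixes u :: "'v::finite \<Rightarrow> real"
  obtains c n where "n < CARD('v)" "\<And>k. k < n \<Longrightarrow> c k < c (Suc k)" "range u = c ` {..n}"
proof -
  define xs where "xs = sorted_list_of_set (range u)"
  define n where "n = length xs - 1"
  have len: "length xs = card (range u)" by (simp add: xs_def)
  have pos: "0 < card (range u)" by (simp add: card_gt_0_iff)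
  have "card (range u) \<le> CARD('v)" by (rule card_image_le) simp
  then have "n < CARD('v)" using pos len unfolding n_def by linarith
  moreover have "xs ! k < xs ! Suc k" if "k < n" for k
    using sorted_wrt_nth_less[of "(<)" xs k "Suc k"] that
    by (simp add: xs_def n_def)
  moreover have "range u = (!) xs ` {..n}"
  proof -
    have "range u = set xs" by (simp add: xs_def)
    also have "\<dots> = (!) xs ` {..<length xs}" by (auto simp: set_conv_nth)
    also have "{..<length xs} = {..n}" using pos len by (auto simp: n_def)
    finally show ?thesis .
  qed
  ultimately show ?thesis using that by blast
qed

text \<open>The potentials of the gaps between consecutive values telescope to the squared distance from the
  smallest value, and the mean is preserved; so the variance drops by at least the sum of the drops
  over the gaps.\<close>

lemma sq_disagreement_contract_real:
  fixes u :: "'v::finite \<Rightarrow> real"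
  assumes net: "network E P B \<zeta>"
  shows "sq_disagreement (mixing_run (\<lambda>k. P (t + k)) B u)
           \<le> (1 - \<zeta> / (8 * (real CARD('v))\<^sup>2)) * sq_disagreement u"
proof -
  define A where "A k = P (t + k)" for k
  let ?N = "real CARD('v)"
  have A: "\<And>k. doubly_stochastic (A k)" "\<And>k i. \<zeta> \<le> A k $ i $ i" and \<zeta>: "0 < \<zeta>" "\<zeta> < 1"
    using net by (auto simp: network_def A_def)
  obtain c n where n: "n < CARD('v)" and c: "\<And>k. k < n \<Longrightarrow> c k < c (Suc k)" and rng: "range u = c ` {..n}"
    using enumerate_range[of u] by metis
  have c_mono: "c k \<le> c k'" if "k \<le> k'" "k' \<le> n" for k k'
    using that
  proof (induction k' rule: dec_induct)
    case (step q) then show ?case using c[of q] by simp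
  qed simp
  have u_in: "u i \<in> {c 0..c n}" for i
  proof -
    obtain k where "k \<le> n" "u i = c k" using rng by blast
    then show ?thesis using c_mono by auto
  qed
  define v where "v = mixing_run A B u"
  have v_in: "v i \<in> {c 0..c n}" for i unfolding v_def using A u_in by (intro mixing_run_bounds)
  have mean: "agent_mean v = agent_mean u" by (simp add: agent_mean_def v_def sum_mixing_run[OF A(1)])
  have tele: "(\<Sum>k<n. gap_potential (c k) (c (Suc k)) x) = (x - c 0)\<^sup>2" if "x \<in> {c 0..c n}" for x
    using that by (simp add: sum_gap_potential_telescope max_def)
  have drop: "\<zeta> * (c (Suc k) - c k)\<^sup>2 / 32
      \<le> (\<Sum>i\<in>UNIV. gap_potential (c k) (c (Suc k)) (u i)) - (\<Sum>i\<in>UNIV. gap_potential (c k) (c (Suc k)) (v i))"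
    if k: "k < n" for k
  proof -
    define S where "S = {i. c (Suc k) \<le> u i}"
    have below: "u i \<le> c k" if "i \<notin> S" for i
    proof -
      obtain k' where k': "k' \<le> n" "u i = c k'" using rng by blast
      then have "k' < Suc k" using c_mono[of "Suc k" k'] that by (force simp: S_def not_less)
      then show ?thesis using c_mono[of k' k] k k' by auto
    qed
    have mem: "\<exists>i. u i = c k'" if "k' \<le> n" for k'
    proof -
      have "c k' \<in> range u" using rng that by auto
      then show ?thesis by (metis imageE)
    qed
    obtain i0 where "u i0 = c (Suc k)" using mem[of "Suc k"] k by auto
    then have i0: "i0 \<in> S" by (simp add: S_def)
    obtain j0 where "u j0 = c k" using mem[of k] k by auto
    then have j0: "j0 \<notin> S" using c[OF k] by (simp add: S_def)
    obtain k0 i j where ij: "k0 < B" "i \<in> S" "j \<notin> S" "\<zeta> \<le> A k0 $ i $ j"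
      using network_crosses_cut[OF net i0 j0, of t] unfolding A_def by blast
    then show ?thesis unfolding v_def
      by (intro gap_potential_drop[where S = S and u = u and A = A, OF A \<zeta> c[OF k] _ below ij]) (simp_all add: S_def)
  qed
  have "\<zeta> / 32 * (\<Sum>k<n. (c (Suc k) - c k)\<^sup>2)
      \<le> (\<Sum>k<n. (\<Sum>i\<in>UNIV. gap_potential (c k) (c (Suc k)) (u i)) - (\<Sum>i\<in>UNIV. gap_potential (c k) (c (Suc k)) (v i)))"
    unfolding sum_distrib_left using drop by (intro sum_mono) auto
  also have "\<dots> = (\<Sum>i\<in>UNIV. (u i - c 0)\<^sup>2) - (\<Sum>i\<in>UNIV. (v i - c 0)\<^sup>2)"
    unfolding sum_subtractf by (subst (1 2) sum.swap) (simp only: tele[OF u_in] tele[OF v_in])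
  also have "\<dots> = sq_disagreement u - sq_disagreement v"
    by (simp add: sq_disagreement_shift[of _ "c 0"] mean)
  finally have d: "\<zeta> / 32 * (\<Sum>k<n. (c (Suc k) - c k)\<^sup>2) \<le> sq_disagreement u - sq_disagreement v" .
  have "\<zeta> / (8 * ?N\<^sup>2) * sq_disagreement u \<le> \<zeta> / (8 * ?N\<^sup>2) * (?N\<^sup>2 / 4 * (\<Sum>k<n. (c (Suc k) - c k)\<^sup>2))"
    using sq_disagreement_le_gaps[of n u c] n u_in \<zeta> by (intro mult_left_mono) auto
  also have "\<dots> = \<zeta> / 32 * (\<Sum>k<n. (c (Suc k) - c k)\<^sup>2)" by (simp add: field_simps)
  finally have "\<zeta> / (8 * ?N\<^sup>2) * sq_disagreement u \<le> sq_disagreement u - sq_disagreement v" using d by linarith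
  then have "sq_disagreement v \<le> (1 - \<zeta> / (8 * ?N\<^sup>2)) * sq_disagreement u" by (simp add: left_diff_distrib)
  then show ?thesis by (simp only: v_def A_def[abs_def])
qed

lemma mixing_run_nth:
  fixes x :: "'v::finite \<Rightarrow> real^'n"
  shows "mixing_run A k x i $ q = mixing_run A k (\<lambda>j. x j $ q) i"
  by (induction k arbitrary: i) simp_all

lemma sq_disagreement_coords:
  fixes x :: "'v::finite \<Rightarrow> real^'n"
  shows "sq_disagreement x = (\<Sum>q\<in>UNIV. sq_disagreement (\<lambda>i. x i $ q))"
proof -
  have "sq_disagreement x = (\<Sum>i\<in>UNIV. \<Sum>q\<in>UNIV. (x i $ q - agent_mean (\<lambda>i. x i $ q))\<^sup>2)"
    unfolding sq_disagreement_def power2_norm_eq_inner inner_vec_def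
    by (simp add: agent_mean_def power2_eq_square)
  also have "\<dots> = (\<Sum>q\<in>UNIV. sq_disagreement (\<lambda>i. x i $ q))"
    by (subst sum.swap) (simp add: sq_disagreement_def)
  finally show ?thesis .
qed

definition disagreement :: "('v::finite \<Rightarrow> 'a::real_normed_vector) \<Rightarrow> real" where
  "disagreement x = sqrt (sq_disagreement x)"

lemma disagreement_conv_L2_set: "disagreement x = L2_set (\<lambda>i. norm (x i - agent_mean x)) UNIV"
  by (simp add: disagreement_def sq_disagreement_def L2_set_def)

text \<open>The square root of the contraction factor of the variance, which acts on each coordinate
  separately.\<close>

lemma disagreement_block:
  fixes x :: "'v::finite \<Rightarrow> real^'n"
  assumes net: "network E P B \<zeta>"
  shows "disagreement (mixing_run (\<lambda>k. P (t + k)) B x)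
           \<le> (1 - \<zeta> / (16 * (real CARD('v))\<^sup>2)) * disagreement x"
proof -
  let ?c = "\<zeta> / (16 * (real CARD('v))\<^sup>2)"
  have \<zeta>: "0 < \<zeta>" "\<zeta> < 1" using net by (auto simp: network_def)
  have N1: "1 \<le> (real CARD('v))\<^sup>2" by (simp add: Suc_leI)
  have "\<zeta> \<le> 16 * (real CARD('v))\<^sup>2" using \<zeta> N1 by linarith
  then have c: "0 \<le> ?c" "?c \<le> 1" using \<zeta> by (auto simp: divide_le_eq)
  have "sq_disagreement (mixing_run (\<lambda>k. P (t + k)) B x)
      \<le> (1 - \<zeta> / (8 * (real CARD('v))\<^sup>2)) * sq_disagreement x"
    unfolding sq_disagreement_coords mixing_run_nth sum_distrib_left
    by (intro sum_mono sq_disagreement_contract_real[OF net])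
  also have "\<zeta> / (8 * (real CARD('v))\<^sup>2) = 2 * ?c" by simp
  also have "(1 - 2 * ?c) * sq_disagreement x \<le> (1 - ?c)\<^sup>2 * sq_disagreement x"
    by (intro mult_right_mono) (simp_all add: sq_disagreement_def sum_nonneg power2_eq_square algebra_simps)
  finally have "sqrt (sq_disagreement (mixing_run (\<lambda>k. P (t + k)) B x)) \<le> sqrt ((1 - ?c)\<^sup>2 * sq_disagreement x)"
    by (rule real_sqrt_le_mono)
  then show ?thesis using c by (simp add: disagreement_def real_sqrt_mult)
qed

lemma sq_disagreement_step_le_real:
  fixes u :: "'v::finite \<Rightarrow> real"
  assumes "doubly_stochastic A"
  shows "sq_disagreement (\<lambda>i. \<Sum>j\<in>UNIV. A $ i $ j * u j) \<le> sq_disagreement u"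
proof -
  define v where "v i = (\<Sum>j\<in>UNIV. A $ i $ j * u j)" for i
  have mean: "agent_mean v = agent_mean u"
    using sum_doubly_stochastic[OF assms, of u] by (simp add: agent_mean_def v_def)
  have "(v i)\<^sup>2 \<le> (\<Sum>j\<in>UNIV. A $ i $ j * (u j)\<^sup>2)" for i
  proof -
    have sq: "convex_on UNIV (\<lambda>x::real. x\<^sup>2)" by (rule convex_power2)
    show ?thesis using convex_on_sum[OF _ _ sq, of UNIV "\<lambda>j. A $ i $ j" u] assms
      by (simp add: v_def doubly_stochastic_def)
  qed
  then have "(\<Sum>i\<in>UNIV. (v i)\<^sup>2) \<le> (\<Sum>i\<in>UNIV. \<Sum>j\<in>UNIV. A $ i $ j *\<^sub>R (u j)\<^sup>2)"
    by (intro sum_mono) simp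
  also have "\<dots> = (\<Sum>j\<in>UNIV. (u j)\<^sup>2)" by (rule sum_doubly_stochastic[OF assms])
  finally show ?thesis
    using sq_disagreement_shift[of u 0] sq_disagreement_shift[of v 0] mean by (simp add: v_def[abs_def])
qed

lemma disagreement_step_le:
  fixes x :: "'v::finite \<Rightarrow> real^'n"
  assumes "doubly_stochastic A"
  shows "disagreement (\<lambda>i. \<Sum>j\<in>UNIV. A $ i $ j *\<^sub>R x j) \<le> disagreement x"
  unfolding disagreement_def sq_disagreement_coords
  using sq_disagreement_step_le_real[OF assms]
  by (intro real_sqrt_le_mono sum_mono) simp

lemma mixing_run_add:
  "mixing_run A (m + k) x = mixing_run (\<lambda>q. A (m + q)) k (mixing_run A m x)"
  by (induction k) simp_all

lemma disagreement_run:
  fixes x :: "'v::finite \<Rightarrow> real^'n"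
  assumes net: "network E P B \<zeta>"
  shows "disagreement (mixing_run (\<lambda>k. P (t + k)) m x)
           \<le> (1 - \<zeta> / (16 * (real CARD('v))\<^sup>2)) ^ (m div B) * disagreement x"
proof -
  let ?run = "mixing_run (\<lambda>k. P (t + k))"
  let ?q = "1 - \<zeta> / (16 * (real CARD('v))\<^sup>2)"
  have ds: "\<And>k. doubly_stochastic (P k)" and \<zeta>: "0 < \<zeta>" "\<zeta> < 1"
    using net by (auto simp: network_def)
  have N1: "1 \<le> (real CARD('v))\<^sup>2" by (simp add: Suc_leI)
  have "\<zeta> \<le> 16 * (real CARD('v))\<^sup>2" using \<zeta> N1 by linarith
  then have q: "0 \<le> ?q" by (auto simp: divide_le_eq)
  have blocks: "disagreement (?run (n * B) x) \<le> ?q ^ n * disagreement x" for n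
  proof (induction n)
    case (Suc n)
    have "disagreement (?run (Suc n * B) x)
        = disagreement (mixing_run (\<lambda>k. P ((t + n * B) + k)) B (?run (n * B) x))"
      using mixing_run_add[of "\<lambda>k. P (t + k)" "n * B" B x] by (simp only: mult_Suc add.assoc add.commute[of B "n * B"])
    also have "\<dots> \<le> ?q * disagreement (?run (n * B) x)"
      by (rule disagreement_block[OF net])
    also have "\<dots> \<le> ?q * (?q ^ n * disagreement x)" by (intro mult_left_mono Suc q)
    finally show ?case by simp
  qed simp
  have rest: "disagreement (mixing_run A k x) \<le> disagreement x"
    if "\<And>k. doubly_stochastic (A k)" for A k and x :: "'v \<Rightarrow> real^'n"
    by (induction k) (auto intro: order_trans[OF disagreement_step_le[OF that]])
  have "?run m x
      = mixing_run (\<lambda>k. P (t + ((m div B) * B + k))) (m mod B) (?run ((m div B) * B) x)"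
    using mixing_run_add[of "\<lambda>k. P (t + k)" "(m div B) * B" "m mod B" x] by simp
  then have "disagreement (?run m x)
      \<le> disagreement (?run ((m div B) * B) x)"
    using rest[of "\<lambda>k. P (t + ((m div B) * B + k))", OF ds] by (simp only:)
  then show ?thesis using blocks[of "m div B"] by (rule order_trans)
qed

section \<open>The Bregman divergence and the mirror step\<close>

text \<open>The mean value theorem in direction \<open>a\<close> turns the second difference into a difference of first
  derivatives at two points within distance \<open>O(t)\<close> of \<open>y\<close>; differentiability of
  \<open>z \<mapsto> \<psi>' z a\<close> at the single point \<open>y\<close> evaluates the latter up to \<open>o(t)\<close>.\<close>

lemma second_difference_tendsto:
  fixes \<psi> :: "'a::real_normed_vector \<Rightarrow> real"
  assumes "open U" "y \<in> U" and deriv: "\<And>z. z \<in> U \<Longrightarrow> (\<psi> has_derivative \<psi>' z) (at z)"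
    and snd: "((\<lambda>z. \<psi>' z a) has_derivative Ta) (at y)"
  shows "((\<lambda>t. (\<psi> (y + t *\<^sub>R a + t *\<^sub>R b) - \<psi> (y + t *\<^sub>R a) - \<psi> (y + t *\<^sub>R b) + \<psi> y) / t\<^sup>2) \<longlongrightarrow> Ta b)
    (at_right 0)" (is "(?Q \<longlongrightarrow> _) _")
proof (rule tendstoI)
  let ?z = "\<lambda>s t. y + s *\<^sub>R a + t *\<^sub>R b"
  let ?w = "\<lambda>s. y + s *\<^sub>R a"
  fix e :: real assume "0 < e"
  define K where "K = norm a + norm b + 1"
  have K: "0 < K" "norm a \<le> K" "norm b \<le> K" by (auto simp: K_def add_nonneg_pos)
  define e' where "e' = e / (4 * K)"
  have e': "0 < e'" using K \<open>0 < e\<close> by (simp add: e'_def)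
  obtain r where r: "0 < r" "ball y r \<subseteq> U" using assms(1,2) open_contains_ball by blast
  interpret Ta: bounded_linear Ta using snd by (rule has_derivative_bounded_linear)
  obtain d where d: "0 < d" "\<And>z. norm (z - y) < d \<Longrightarrow> \<bar>\<psi>' z a - \<psi>' y a - Ta (z - y)\<bar> \<le> e' * norm (z - y)"
    using snd e' unfolding has_derivative_at_alt by (metis real_norm_def)
  \<comment> \<open>Small enough to keep all points in \<open>U\<close> and in the range of the derivative estimate.\<close>
  define t0 where "t0 = min r d / K"
  have t0: "0 < t0" using r d K by (simp add: t0_def)
  have near: "norm (s *\<^sub>R a + t *\<^sub>R b) \<le> t * K" if "0 \<le> s" "s \<le> t" for s t
  proof -
    have "norm (s *\<^sub>R a + t *\<^sub>R b) \<le> s * norm a + t * norm b"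
      using norm_triangle_ineq[of "s *\<^sub>R a" "t *\<^sub>R b"] that by simp
    also have "\<dots> \<le> t * norm a + t * norm b" using that by (intro add_right_mono mult_right_mono) auto
    also have "\<dots> \<le> t * K" using that by (simp add: K_def algebra_simps)
    finally show ?thesis .
  qed
  have near': "norm (s *\<^sub>R a) \<le> t * K" if "0 \<le> s" "s \<le> t" for s t
    using that K by (simp add: mult_mono)
  have "dist (?Q t) (Ta b) < e"
    if t: "0 < t" "t < t0" for t
  proof -
    have tK: "t * K < r" "t * K < d" using t K by (auto simp: t0_def pos_less_divide_eq)
    have inU: "?z s t \<in> U" "?w s \<in> U" if "0 \<le> s" "s \<le> t" for s
    proof -
      have "?z s t \<in> ball y r"
        using near[OF that] tK norm_minus_cancel[of "s *\<^sub>R a + t *\<^sub>R b"]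
        by (simp add: dist_norm diff_diff_eq[symmetric] del: norm_minus_cancel)
      moreover have "?w s \<in> ball y r"
        using near'[OF that] tK by (simp add: dist_norm)
      ultimately show "?z s t \<in> U" "?w s \<in> U" using r by auto
    qed
    define G where "G s = \<psi> (?z s t) - \<psi> (?w s)" for s
    define G' where "G' s = \<psi>' (?z s t) a - \<psi>' (?w s) a" for s
    have dG: "(G has_real_derivative G' s) (at s)" if "0 \<le> s" "s \<le> t" for s
    proof -
      have l: "\<psi>' z (q *\<^sub>R a) = q * \<psi>' z a" if "z \<in> U" for z q
        using linear_scale[OF has_derivative_linear[OF deriv[OF that]]] by simp
      have "((\<lambda>s. \<psi> (?z s t)) has_derivative (\<lambda>q. \<psi>' (?z s t) (q *\<^sub>R a))) (at s)"
        by (rule has_derivative_compose[of "\<lambda>s. ?z s t" "\<lambda>q. q *\<^sub>R a" s UNIV, OF _ deriv[OF inU(1)[OF that]]])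
           (auto intro!: derivative_eq_intros)
      moreover have "((\<lambda>s. \<psi> (?w s)) has_derivative (\<lambda>q. \<psi>' (?w s) (q *\<^sub>R a))) (at s)"
        by (rule has_derivative_compose[of "\<lambda>s. ?w s" "\<lambda>q. q *\<^sub>R a" s UNIV, OF _ deriv[OF inU(2)[OF that]]])
           (auto intro!: derivative_eq_intros)
      ultimately have "(G has_derivative (\<lambda>q. \<psi>' (?z s t) (q *\<^sub>R a) - \<psi>' (?w s) (q *\<^sub>R a))) (at s)"
        unfolding G_def[abs_def] by (rule has_derivative_diff)
      then show ?thesis
        using inU[OF that] by (simp add: has_field_derivative_def l G'_def right_diff_distrib[symmetric] mult_commute_abs)
    qed
    obtain s where s: "0 < s" "s < t" "G t - G 0 = (t - 0) * G' s"
      using MVT2[OF t(1) dG] by auto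
    have "\<bar>\<psi>' (?z s t) a - \<psi>' y a - Ta (s *\<^sub>R a + t *\<^sub>R b)\<bar> \<le> e' * norm (s *\<^sub>R a + t *\<^sub>R b)"
      using d(2)[of "?z s t"] near[of s t] s tK by (simp add: add.assoc)
    also have "\<dots> \<le> e' * (t * K)" using near[of s t] s e' by (intro mult_left_mono) auto
    finally have 1: "\<bar>\<psi>' (?z s t) a - \<psi>' y a - Ta (s *\<^sub>R a + t *\<^sub>R b)\<bar> \<le> e' * (t * K)" .
    have "\<bar>\<psi>' (?w s) a - \<psi>' y a - Ta (s *\<^sub>R a)\<bar> \<le> e' * norm (s *\<^sub>R a)"
      using d(2)[of "?w s"] near'[of s t] s tK by simp
    also have "\<dots> \<le> e' * (t * K)" using near'[of s t] s e' by (intro mult_left_mono) auto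
    finally have 2: "\<bar>\<psi>' (?w s) a - \<psi>' y a - Ta (s *\<^sub>R a)\<bar> \<le> e' * (t * K)" .
    have "Ta (s *\<^sub>R a + t *\<^sub>R b) - Ta (s *\<^sub>R a) = t * Ta b" by (simp add: Ta.add Ta.scaleR)
    then have "\<bar>G' s - t * Ta b\<bar> \<le> 2 * (e' * (t * K))" using 1 2 unfolding G'_def by linarith
    also have "\<dots> = t * (e / 2)" using K by (simp add: e'_def field_simps)
    finally have 3: "\<bar>G' s - t * Ta b\<bar> \<le> t * (e / 2)" .
    have "?Q t = G' s / t"
      using s(3) t by (simp add: G_def power2_eq_square field_simps)
    moreover have "G' s / t - Ta b = (G' s - t * Ta b) / t" using t by (simp add: field_simps)
    moreover have "\<bar>(G' s - t * Ta b) / t\<bar> \<le> e / 2" using 3 t by (simp add: abs_divide divide_le_eq mult.commute)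
    ultimately have "dist (?Q t) (Ta b) \<le> e / 2"
      by (simp only: dist_real_def)
    then show ?thesis using \<open>0 < e\<close> by linarith
  qed
  then show "\<forall>\<^sub>F t in at_right 0. dist (?Q t) (Ta b) < e"
    unfolding eventually_at_right_field using t0 by blast
qed

text \<open>The second difference is symmetric in the two directions.\<close>

lemma second_derivative_symmetric:
  fixes \<psi> :: "'a::real_normed_vector \<Rightarrow> real"
  assumes "open U" "y \<in> U" and "\<And>z. z \<in> U \<Longrightarrow> (\<psi> has_derivative \<psi>' z) (at z)"
    and "((\<lambda>z. \<psi>' z a) has_derivative Ta) (at y)" and "((\<lambda>z. \<psi>' z b) has_derivative Tb) (at y)"
  shows "Ta b = Tb a"
proof -
  note 1 = second_difference_tendsto[OF assms(1-4), of b]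
  note 2 = second_difference_tendsto[OF assms(1-3,5), of a]
  have "((\<lambda>t. (\<psi> (y + t *\<^sub>R a + t *\<^sub>R b) - \<psi> (y + t *\<^sub>R a) - \<psi> (y + t *\<^sub>R b) + \<psi> y) / t\<^sup>2) \<longlongrightarrow> Tb a) (at_right 0)"
    using 2 by (simp add: algebra_simps)
  from tendsto_unique[OF _ 1 this] show ?thesis by simp
qed

locale bregman_domain =
  fixes X U :: "(real^'n) set" and \<sigma> :: real and \<phi> :: "real^'n \<Rightarrow> real"
  assumes generator: "bregman_generator X U \<sigma> \<phi>"
    and compact_X: "compact X" and convex_X: "convex X" and nonempty_X: "X \<noteq> {}"
begin

lemma XU: "X \<subseteq> U" and openU: "open U" and \<sigma>_pos: "0 < \<sigma>" and strong: "strongly_convex_on X \<sigma> \<phi>"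
  using generator by (auto simp: bregman_generator_def C3_on_def)

lemma has_derivative_phi:
  assumes "y \<in> U" shows "(\<phi> has_derivative (\<lambda>h. h \<bullet> gradient \<phi> y)) (at y)"
proof -
  obtain f' where f': "(\<phi> has_derivative f') (at y)"
    using generator assms by (auto simp: bregman_generator_def C3_on_def differentiable_def)
  then have lin: "linear f'" by (rule has_derivative_linear)
  have "f' = (\<lambda>h. h \<bullet> adjoint f' 1)" by (simp add: adjoint_works[OF lin] fun_eq_iff)
  then have D: "GDERIV \<phi> y :> adjoint f' 1" using f' by (simp add: gderiv_def)
  have "GDERIV \<phi> y :> gradient \<phi> y" unfolding gradient_def
  proof (rule theI[of "\<lambda>D. GDERIV \<phi> y :> D", OF D])
    fix D' assume "GDERIV \<phi> y :> D'"
    then have "(\<lambda>h. h \<bullet> D') = (\<lambda>h. h \<bullet> adjoint f' 1)"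
      using D unfolding gderiv_def by (rule has_derivative_unique)
    then show "D' = adjoint f' 1" by (metis vector_eq_ldot)
  qed
  then show ?thesis by (simp add: gderiv_def)
qed

lemma has_derivative_gradient:
  assumes "y \<in> U" shows "(gradient \<phi> has_derivative (\<lambda>h. hessian \<phi> y *v h)) (at y)"
  using generator assms unfolding hessian_def
  by (subst jacobian_works[symmetric]) (auto simp: bregman_generator_def C3_on_def)

lemma has_derivative_hessian:
  assumes "y \<in> U" shows "(hessian \<phi> has_derivative hessian_deriv \<phi> y) (at y)"
proof -
  have "hessian \<phi> differentiable (at y)"
    using generator assms by (auto simp: bregman_generator_def C3_on_def)
  moreover have "hessian_deriv \<phi> y = frechet_derivative (hessian \<phi>) (at y)"
    by (simp add: hessian_deriv_def fun_eq_iff)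
  ultimately show ?thesis by (simp add: frechet_derivative_works)
qed

lemma continuous_on_phi: "continuous_on U \<phi>"
  by (intro continuous_at_imp_continuous_on ballI has_derivative_continuous[OF has_derivative_phi])

lemma continuous_on_gradient: "continuous_on U (gradient \<phi>)"
  by (intro continuous_at_imp_continuous_on ballI has_derivative_continuous[OF has_derivative_gradient])

lemma has_derivative_hessian_entry:
  assumes "y \<in> U"
  shows "((\<lambda>z. c \<bullet> (hessian \<phi> z *v a)) has_derivative (\<lambda>k. c \<bullet> (hessian_deriv \<phi> y k *v a))) (at y)"
proof -
  have "linear (\<lambda>A::real^'n^'n. c \<bullet> (A *v a))"
    by (intro linearI) (simp_all add: matrix_vector_mult_add_rdistrib inner_add_right scaleR_matrix_vector_assoc[symmetric])
  then have "bounded_linear (\<lambda>A::real^'n^'n. c \<bullet> (A *v a))" by (simp add: linear_conv_bounded_linear)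
  from bounded_linear.has_derivative[OF this has_derivative_hessian[OF assms]] show ?thesis .
qed

lemma hessian_symmetric:
  assumes "y \<in> U" shows "a \<bullet> (hessian \<phi> y *v b) = b \<bullet> (hessian \<phi> y *v a)"
  by (rule second_derivative_symmetric[OF openU assms has_derivative_phi])
     (auto intro!: has_derivative_inner_right has_derivative_gradient assms)

lemma hessian_deriv_symmetric:
  assumes "y \<in> U" shows "a \<bullet> (hessian_deriv \<phi> y k *v b) = b \<bullet> (hessian_deriv \<phi> y k *v a)"
proof -
  have "((\<lambda>z. b \<bullet> (hessian \<phi> z *v a)) has_derivative (\<lambda>k. a \<bullet> (hessian_deriv \<phi> y k *v b))) (at y)"
    by (rule has_derivative_transform_within_open[OF has_derivative_hessian_entry[OF assms] openU assms])
       (rule hessian_symmetric)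
  from has_derivative_unique[OF this has_derivative_hessian_entry[OF assms]] show ?thesis by (rule fun_cong)
qed

text \<open>Symmetry of the second derivative, applied to the functional \<open>z \<mapsto> c \<bullet> gradient \<phi> z\<close>.\<close>

lemma hessian_deriv_swap:
  assumes "y \<in> U" shows "c \<bullet> (hessian_deriv \<phi> y a *v b) = c \<bullet> (hessian_deriv \<phi> y b *v a)"
  by (rule second_derivative_symmetric[OF openU assms, of "\<lambda>z. c \<bullet> gradient \<phi> z" "\<lambda>z v. c \<bullet> (hessian \<phi> z *v v)"
        b "\<lambda>k. c \<bullet> (hessian_deriv \<phi> y k *v b)" a "\<lambda>k. c \<bullet> (hessian_deriv \<phi> y k *v a)"])
     (intro has_derivative_inner_right has_derivative_gradient has_derivative_hessian_entry assms; assumption)+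

lemma segment_in_X:
  assumes "y \<in> X" "x \<in> X" "0 \<le> t" "t \<le> 1" shows "y + t *\<^sub>R (x - y) \<in> X"
  using convexD_alt[OF convex_X assms(1,2), of t] assms(3,4) by (simp add: algebra_simps)

text \<open>Along a segment with direction \<open>v\<close>, the second derivative of the divergence at \<open>y\<close> is
  \<open>v \<bullet> H v + (y - x) \<bullet> (H' v) v\<close>, where \<open>H\<close> is the Hessian and \<open>H'\<close> its derivative. Third derivatives are
  symmetric, so this equals \<open>v \<bullet> (H + H' (y - x)) v\<close>, which is nonnegative by assumption.\<close>

lemma convex_on_bregman_second:
  assumes x: "x \<in> X"
  shows "convex_on X (bregman \<phi> x)"
proof (rule convex_onI)
  fix t :: real and y0 y1 assume t: "0 < t" "t < 1" and y: "y0 \<in> X" "y1 \<in> X"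
  define v where "v = y1 - y0"
  define y where "y s = y0 + s *\<^sub>R v" for s
  have yX: "y s \<in> X" if "s \<in> {0..1}" for s using segment_in_X[OF y(1,2)] that by (simp add: y_def v_def)
  have yU: "y s \<in> U" if "s \<in> {0..1}" for s using yX[OF that] XU by auto
  have dy: "(y has_derivative (\<lambda>q. q *\<^sub>R v)) (at s)" for s
    unfolding y_def[abs_def] by (auto intro!: derivative_eq_intros)
  define G1 where "G1 s = (y s - x) \<bullet> (hessian \<phi> (y s) *v v)" for s
  define G2 where "G2 s = v \<bullet> (hessian \<phi> (y s) *v v) + (y s - x) \<bullet> (hessian_deriv \<phi> (y s) v *v v)" for s
  have "convex_on {0..1} (\<lambda>s. bregman \<phi> x (y s))"
  proof (rule f''_ge0_imp_convex)
    fix s :: real assume s: "s \<in> {0..1}"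
    note c = has_derivative_compose[OF dy]
    have 1: "((\<lambda>s. \<phi> (y s)) has_derivative (\<lambda>q. (q *\<^sub>R v) \<bullet> gradient \<phi> (y s))) (at s)"
      by (rule c[OF has_derivative_phi[OF yU[OF s]]])
    have 2: "((\<lambda>s. gradient \<phi> (y s)) has_derivative (\<lambda>q. hessian \<phi> (y s) *v (q *\<^sub>R v))) (at s)"
      by (rule c[OF has_derivative_gradient[OF yU[OF s]]])
    have 3: "((\<lambda>s. hessian \<phi> (y s)) has_derivative (\<lambda>q. hessian_deriv \<phi> (y s) (q *\<^sub>R v))) (at s)"
      by (rule c[OF has_derivative_hessian[OF yU[OF s]]])
    have "((\<lambda>s. bregman \<phi> x (y s)) has_derivative
        (\<lambda>q. 0 - (q *\<^sub>R v) \<bullet> gradient \<phi> (y s) -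
          (gradient \<phi> (y s) \<bullet> (0 - q *\<^sub>R v) + (hessian \<phi> (y s) *v (q *\<^sub>R v)) \<bullet> (x - y s)))) (at s)"
      (is "(_ has_derivative ?D1) _")
      unfolding bregman_def
      by (intro has_derivative_diff has_derivative_inner has_derivative_const 1 2 dy)
    moreover have "?D1 = (*) (G1 s)"
      by (auto simp: G1_def fun_eq_iff matrix_vector_mult_scaleR inner_diff_left inner_diff_right
          inner_commute algebra_simps)
    ultimately show "((\<lambda>s. bregman \<phi> x (y s)) has_real_derivative G1 s) (at s)"
      by (simp add: has_field_derivative_def)
    have bl: "bounded_linear (\<lambda>A::real^'n^'n. A *v v)"
      unfolding linear_conv_bounded_linear[symmetric]
      by (intro linearI) (simp_all add: matrix_vector_mult_add_rdistrib scaleR_matrix_vector_assoc[symmetric])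
    have "(G1 has_derivative (\<lambda>q. (y s - x) \<bullet> (hessian_deriv \<phi> (y s) (q *\<^sub>R v) *v v) + (q *\<^sub>R v - 0) \<bullet> (hessian \<phi> (y s) *v v))) (at s)"
      (is "(_ has_derivative ?D2) _")
      unfolding G1_def[abs_def]
      by (intro has_derivative_inner has_derivative_diff dy has_derivative_const
          bounded_linear.has_derivative[OF bl 3])
    moreover have "?D2 = (*) (G2 s)"
    proof -
      have "hessian_deriv \<phi> (y s) (q *\<^sub>R v) = q *\<^sub>R hessian_deriv \<phi> (y s) v" for q
        using linear_scale[OF has_derivative_linear[OF has_derivative_hessian[OF yU[OF s]]]] .
      then show ?thesis
        by (simp add: G2_def fun_eq_iff scaleR_matrix_vector_assoc[symmetric] algebra_simps)
    qed
    ultimately show "(G1 has_real_derivative G2 s) (at s)" by (simp add: has_field_derivative_def)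
    have "(y s - x) \<bullet> (hessian_deriv \<phi> (y s) v *v v) = v \<bullet> (hessian_deriv \<phi> (y s) v *v (y s - x))"
      by (rule hessian_deriv_symmetric[OF yU[OF s]])
    also have "\<dots> = v \<bullet> (hessian_deriv \<phi> (y s) (y s - x) *v v)"
      by (rule hessian_deriv_swap[OF yU[OF s]])
    finally have "G2 s = v \<bullet> ((hessian \<phi> (y s) + hessian_deriv \<phi> (y s) (y s - x)) *v v)"
      by (simp add: G2_def matrix_vector_mult_add_rdistrib inner_add_right)
    then show "0 \<le> G2 s"
      using generator x yX[OF s] by (auto simp: bregman_generator_def psd_def)
  qed simp
  from convex_onD[OF this, of t 0 1] t
  have "bregman \<phi> x (y t) \<le> (1 - t) * bregman \<phi> x (y 0) + t * bregman \<phi> x (y 1)" by simp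
  then show "bregman \<phi> x ((1 - t) *\<^sub>R y0 + t *\<^sub>R y1) \<le> (1 - t) * bregman \<phi> x y0 + t * bregman \<phi> x y1"
    by (simp add: y_def v_def algebra_simps)
qed (rule convex_X)

lemma phi_directional:
  assumes "y \<in> U"
  shows "((\<lambda>t. (\<phi> (y + t *\<^sub>R v) - \<phi> y) / t) \<longlongrightarrow> gradient \<phi> y \<bullet> v) (at_right 0)"
proof -
  have "((\<lambda>t. y + t *\<^sub>R v) has_derivative (\<lambda>q. q *\<^sub>R v)) (at 0)"
    by (auto intro!: derivative_eq_intros)
  then have "((\<lambda>t. \<phi> (y + t *\<^sub>R v)) has_derivative (\<lambda>q. (q *\<^sub>R v) \<bullet> gradient \<phi> y)) (at 0)"
    by (rule has_derivative_compose) (simp add: has_derivative_phi[OF assms])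
  moreover have "(\<lambda>q. (q *\<^sub>R v) \<bullet> gradient \<phi> y) = (*) (gradient \<phi> y \<bullet> v)"
    by (simp add: fun_eq_iff inner_commute)
  ultimately have "((\<lambda>t. \<phi> (y + t *\<^sub>R v)) has_real_derivative (gradient \<phi> y \<bullet> v)) (at 0)"
    by (simp only: has_field_derivative_def)
  then have "((\<lambda>t. (\<phi> (y + t *\<^sub>R v) - \<phi> y) / t) \<longlongrightarrow> gradient \<phi> y \<bullet> v) (at 0)"
    by (simp add: DERIV_def)
  then show ?thesis by (rule tendsto_mono[OF at_le, rotated]) simp
qed

text \<open>Divide the strong convexity inequality between \<open>y\<close> and \<open>y + t (x - y)\<close> by \<open>t\<close> and let \<open>t\<close> tend to
  zero.\<close>

lemma bregman_ge:
  assumes x: "x \<in> X" and y: "y \<in> X"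
  shows "\<sigma> / 2 * (norm (x - y))\<^sup>2 \<le> bregman \<phi> x y"
proof -
  let ?k = "\<sigma> / 2 * (norm (x - y))\<^sup>2"
  have "((\<lambda>t. \<phi> x - \<phi> y - (1 - t) * ?k) \<longlongrightarrow> \<phi> x - \<phi> y - (1 - 0) * ?k) (at_right 0)"
    by (intro tendsto_intros)
  then have "gradient \<phi> y \<bullet> (x - y) \<le> \<phi> x - \<phi> y - (1 - 0) * ?k"
  proof (rule tendsto_le[rotated, OF _ phi_directional])
    show "\<forall>\<^sub>F t in at_right 0. (\<phi> (y + t *\<^sub>R (x - y)) - \<phi> y) / t \<le> \<phi> x - \<phi> y - (1 - t) * ?k"
      unfolding eventually_at_right_field
    proof (intro exI[of _ 1] conjI allI impI)
      fix t :: real assume t: "0 < t" "t < 1"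
      have "\<phi> (t *\<^sub>R x + (1 - t) *\<^sub>R y) \<le> t * \<phi> x + (1 - t) * \<phi> y - \<sigma> * t * (1 - t) / 2 * norm (x - y) ^ 2"
        using strong x y t by (auto simp: strongly_convex_on_def)
      then have "\<phi> (y + t *\<^sub>R (x - y)) - \<phi> y \<le> t * (\<phi> x - \<phi> y - (1 - t) * ?k)"
        by (simp add: algebra_simps)
      then show "(\<phi> (y + t *\<^sub>R (x - y)) - \<phi> y) / t \<le> \<phi> x - \<phi> y - (1 - t) * ?k"
        using t by (simp add: pos_divide_le_eq mult.commute)
    qed simp
  qed (use y XU in auto)
  then show ?thesis by (simp add: bregman_def)
qed

lemma bregman_nonneg: "x \<in> X \<Longrightarrow> y \<in> X \<Longrightarrow> 0 \<le> bregman \<phi> x y"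
  using bregman_ge[of x y] \<sigma>_pos by (smt (verit) divide_nonneg_pos mult_nonneg_nonneg zero_le_power2)

text \<open>The mirror step with gradient estimate \<open>w\<close> from \<open>y\<close> minimizes this objective for
  \<open>v = \<alpha> w - gradient \<phi> y\<close>. Collecting everything in one linear functional lets the new iterate
  depend on the past through a single Lipschitz map.\<close>

definition prox_arg :: "real^'n \<Rightarrow> real^'n \<Rightarrow> bool" where
  "prox_arg v u \<longleftrightarrow> is_arg_min (\<lambda>u. v \<bullet> u + \<phi> u) (\<lambda>u. u \<in> X) u"

lemma prox_arg_iff: "prox_arg v u \<longleftrightarrow> u \<in> X \<and> (\<forall>w\<in>X. v \<bullet> u + \<phi> u \<le> v \<bullet> w + \<phi> w)"
  by (auto simp: prox_arg_def is_arg_min_linorder)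

lemma prox_arg_variational:
  assumes u: "prox_arg v u" and w: "w \<in> X"
  shows "0 \<le> (v + gradient \<phi> u) \<bullet> (w - u)"
proof -
  have uX: "u \<in> X" using u by (simp add: prox_arg_iff)
  have "((\<lambda>t. v \<bullet> (w - u) + (\<phi> (u + t *\<^sub>R (w - u)) - \<phi> u) / t) \<longlongrightarrow> v \<bullet> (w - u) + gradient \<phi> u \<bullet> (w - u)) (at_right 0)"
    using uX XU by (intro tendsto_intros phi_directional) auto
  then have "0 \<le> v \<bullet> (w - u) + gradient \<phi> u \<bullet> (w - u)"
  proof (rule tendsto_lowerbound)
    show "\<forall>\<^sub>F t in at_right 0. 0 \<le> v \<bullet> (w - u) + (\<phi> (u + t *\<^sub>R (w - u)) - \<phi> u) / t"
      unfolding eventually_at_right_field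
    proof (intro exI[of _ 1] conjI allI impI)
      fix t :: real assume t: "0 < t" "t < 1"
      have "v \<bullet> u + \<phi> u \<le> v \<bullet> (u + t *\<^sub>R (w - u)) + \<phi> (u + t *\<^sub>R (w - u))"
        using u segment_in_X[OF uX w, of t] t by (auto simp: prox_arg_iff)
      then have "0 \<le> t * (v \<bullet> (w - u)) + (\<phi> (u + t *\<^sub>R (w - u)) - \<phi> u)" by (simp add: inner_add_right)
      then have "0 \<le> (t * (v \<bullet> (w - u)) + (\<phi> (u + t *\<^sub>R (w - u)) - \<phi> u)) / t" using t by simp
      then show "0 \<le> v \<bullet> (w - u) + (\<phi> (u + t *\<^sub>R (w - u)) - \<phi> u) / t" using t by (simp add: add_divide_distrib)
    qed simp
  qed simp
  then show ?thesis by (simp add: inner_add_left)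
qed

text \<open>Add the two variational inequalities. The gradient of \<open>\<phi>\<close> is strongly monotone, since its
  monotonicity product is the sum of the two divergences between the points.\<close>

lemma prox_arg_lipschitz:
  assumes "prox_arg v1 u1" "prox_arg v2 u2"
  shows "\<sigma> * norm (u1 - u2) \<le> norm (v1 - v2)"
proof (cases "u1 = u2")
  case False
  have X: "u1 \<in> X" "u2 \<in> X" using assms by (auto simp: prox_arg_iff)
  have "\<sigma> * (norm (u1 - u2))\<^sup>2 \<le> bregman \<phi> u1 u2 + bregman \<phi> u2 u1"
    using bregman_ge[OF X] bregman_ge[OF X(2,1)] by (simp add: norm_minus_commute)
  also have "\<dots> = (gradient \<phi> u1 - gradient \<phi> u2) \<bullet> (u1 - u2)"
    by (simp add: bregman_def inner_diff_left inner_diff_right)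
  also have "\<dots> \<le> (v1 - v2) \<bullet> (u2 - u1)"
    using prox_arg_variational[OF assms(1) X(2)] prox_arg_variational[OF assms(2) X(1)]
    by (simp add: inner_diff_left inner_diff_right inner_add_left)
  also have "\<dots> \<le> norm (v1 - v2) * norm (u1 - u2)"
    by (metis norm_cauchy_schwarz norm_minus_commute)
  finally have "\<sigma> * norm (u1 - u2) * norm (u1 - u2) \<le> norm (v1 - v2) * norm (u1 - u2)"
    by (simp add: power2_eq_square)
  then show ?thesis using False by simp
qed simp

lemma prox_arg_unique: "prox_arg v u1 \<Longrightarrow> prox_arg v u2 \<Longrightarrow> u1 = u2"
  using prox_arg_lipschitz[of v u1 v u2] \<sigma>_pos by (simp add: mult_le_0_iff)

definition prox :: "real^'n \<Rightarrow> real^'n" where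
  "prox v = (SOME u. prox_arg v u)"

lemma prox_arg_prox: "prox_arg v (prox v)"
proof -
  have "continuous_on X (\<lambda>u. v \<bullet> u + \<phi> u)"
    by (intro continuous_intros continuous_on_subset[OF continuous_on_phi XU])
  from continuous_attains_inf[OF compact_X nonempty_X this]
  have "\<exists>u. prox_arg v u" by (auto simp: prox_arg_iff)
  then show ?thesis unfolding prox_def by (rule someI_ex)
qed

lemma prox_in_X: "prox v \<in> X" using prox_arg_prox by (simp add: prox_arg_iff)

lemma prox_eqI: "prox_arg v u \<Longrightarrow> prox v = u" using prox_arg_unique prox_arg_prox by blast

lemma prox_lipschitz: "norm (prox v1 - prox v2) \<le> norm (v1 - v2) / \<sigma>"
  using prox_arg_lipschitz[OF prox_arg_prox prox_arg_prox, of v1 v2] \<sigma>_pos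
  by (simp add: pos_le_divide_eq mult.commute)

lemma continuous_on_prox: "continuous_on UNIV prox"
proof -
  have "(1 / \<sigma>)-lipschitz_on UNIV prox"
    using prox_lipschitz \<sigma>_pos by (intro lipschitz_onI) (auto simp: dist_norm)
  then show ?thesis by (rule lipschitz_on_continuous_on)
qed

lemma mirror_step_iff:
  "is_arg_min (\<lambda>u. \<alpha> * (g \<bullet> u) + bregman \<phi> u y) (\<lambda>u. u \<in> X) u
     \<longleftrightarrow> u = prox (\<alpha> *\<^sub>R g - gradient \<phi> y)"
proof -
  have "is_arg_min (\<lambda>u. \<alpha> * (g \<bullet> u) + bregman \<phi> u y) (\<lambda>u. u \<in> X) u
      \<longleftrightarrow> prox_arg (\<alpha> *\<^sub>R g - gradient \<phi> y) u"
    by (auto simp: is_arg_min_linorder prox_arg_iff bregman_def inner_diff_left inner_diff_right)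
  also have "\<dots> \<longleftrightarrow> u = prox (\<alpha> *\<^sub>R g - gradient \<phi> y)"
    using prox_eqI[of _ u] prox_arg_prox by auto
  finally show ?thesis .
qed

text \<open>With a zero gradient estimate the mirror step does not move.\<close>

lemma prox_neg_gradient: "y \<in> X \<Longrightarrow> prox (- gradient \<phi> y) = y"
  using bregman_nonneg[of _ y]
  by (intro prox_eqI) (auto simp: prox_arg_iff bregman_def inner_diff_right algebra_simps)

lemma mirror_step_displacement:
  assumes "y \<in> X" "0 \<le> \<alpha>"
  shows "norm (prox (\<alpha> *\<^sub>R g - gradient \<phi> y) - y) \<le> \<alpha> * norm g / \<sigma>"
  using prox_lipschitz[of "\<alpha> *\<^sub>R g - gradient \<phi> y" "- gradient \<phi> y"] prox_neg_gradient[OF assms(1)] assms(2)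
  by simp

text \<open>The variational inequality of the step and the three-point identity of the divergence give the
  estimate at the new point \<open>x\<close>; replacing \<open>x\<close> by \<open>y\<close> costs an inner product that the strong convexity
  term \<open>\<sigma> / 2 * (norm (x - y))\<^sup>2\<close> absorbs by completing the square.\<close>

lemma mirror_step_progress:
  fixes \<alpha> :: real and g :: "real^'n"
  assumes y: "y \<in> X" and u: "u \<in> X"
  defines "x \<equiv> prox (\<alpha> *\<^sub>R g - gradient \<phi> y)"
  shows "\<alpha> * (g \<bullet> (y - u)) \<le> bregman \<phi> u y - bregman \<phi> u x + \<alpha>\<^sup>2 * (norm g)\<^sup>2 / (2 * \<sigma>)"
proof -
  have xX: "x \<in> X" by (simp add: x_def prox_in_X)
  have "0 \<le> (\<alpha> *\<^sub>R g - gradient \<phi> y + gradient \<phi> x) \<bullet> (u - x)"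
    unfolding x_def by (rule prox_arg_variational[OF prox_arg_prox u])
  also have "\<dots> = \<alpha> * (g \<bullet> (u - x)) + (gradient \<phi> x - gradient \<phi> y) \<bullet> (u - x)"
    by (simp add: inner_add_left inner_diff_left)
  also have "(gradient \<phi> x - gradient \<phi> y) \<bullet> (u - x) = bregman \<phi> u y - bregman \<phi> u x - bregman \<phi> x y"
    by (simp add: bregman_def inner_diff_left inner_diff_right)
  finally have 1: "0 \<le> \<alpha> * (g \<bullet> (u - x)) + (bregman \<phi> u y - bregman \<phi> u x - bregman \<phi> x y)" .
  have 2: "\<alpha> * (g \<bullet> (y - x)) \<le> \<bar>\<alpha>\<bar> * norm g * norm (x - y)"
  proof -
    have "\<alpha> * (g \<bullet> (y - x)) \<le> \<bar>\<alpha>\<bar> * \<bar>g \<bullet> (y - x)\<bar>" unfolding abs_mult[symmetric] by (rule abs_ge_self)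
    also have "\<dots> \<le> \<bar>\<alpha>\<bar> * (norm g * norm (y - x))" by (intro mult_left_mono Cauchy_Schwarz_ineq2) simp
    finally show ?thesis by (simp add: norm_minus_commute mult.assoc)
  qed
  have "0 \<le> (\<bar>\<alpha>\<bar> * norm g - \<sigma> * norm (x - y))\<^sup>2 / (2 * \<sigma>)" using \<sigma>_pos by simp
  also have "\<dots> = (\<bar>\<alpha>\<bar> * norm g)\<^sup>2 / (2 * \<sigma>) - \<bar>\<alpha>\<bar> * norm g * norm (x - y) + \<sigma> / 2 * (norm (x - y))\<^sup>2"
    using \<sigma>_pos unfolding power2_diff by (simp add: field_simps power2_eq_square)
  finally have 3: "\<bar>\<alpha>\<bar> * norm g * norm (x - y) \<le> \<alpha>\<^sup>2 * (norm g)\<^sup>2 / (2 * \<sigma>) + bregman \<phi> x y"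
    using bregman_ge[OF xX y] by (simp add: power_mult_distrib)
  have 4: "\<alpha> * (g \<bullet> (y - u)) = \<alpha> * (g \<bullet> (y - x)) - \<alpha> * (g \<bullet> (u - x))"
    unfolding right_diff_distrib[symmetric] inner_diff_right by simp
  have arith: "a = b - c \<Longrightarrow> 0 \<le> c + (d1 - d2 - d3) \<Longrightarrow> b \<le> e \<Longrightarrow> e \<le> q + d3 \<Longrightarrow> a \<le> d1 - d2 + q"
    for a b c d1 d2 d3 e q :: real by linarith
  show ?thesis by (rule arith[OF 4 1 2 3])
qed

end

section \<open>Gaussian smoothing of convex functions\<close>

definition std_gaussian :: "(real^'n) measure" where
  "std_gaussian = density lborel (\<lambda>z. ennreal (std_gaussian_density z))"

lemma sets_std_gaussian [simp, measurable_cong]: "sets std_gaussian = sets borel"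
  by (simp add: std_gaussian_def)

lemma space_std_gaussian [simp]: "space std_gaussian = UNIV"
  by (simp add: std_gaussian_def)

lemma borel_measurable_nth [measurable]: "(\<lambda>z::real^'n. z $ k) \<in> borel_measurable borel"
  by (intro borel_measurable_continuous_onI continuous_intros)

lemma borel_measurable_std_gaussian_density [measurable]:
  "(std_gaussian_density :: real^'n \<Rightarrow> real) \<in> borel_measurable borel"
  unfolding std_gaussian_density_def[abs_def] by measurable

lemma std_gaussian_density_nonneg: "0 \<le> std_gaussian_density z"
  unfolding std_gaussian_density_def by (intro prod_nonneg) simp

lemma nn_integral_lborel_vec_prod:
  fixes h :: "'n::finite \<Rightarrow> real \<Rightarrow> ennreal"
  assumes [measurable]: "\<And>k. h k \<in> borel_measurable borel"
  shows "(\<integral>\<^sup>+z. (\<Prod>k\<in>UNIV. h k (z $ k)) \<partial>(lborel :: (real^'n) measure)) = (\<Prod>k\<in>UNIV. \<integral>\<^sup>+x. h k x \<partial>lborel)"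
proof -
  have B: "(Basis :: (real^'n) set) = (\<lambda>k. axis k 1) ` UNIV" by (auto simp: Basis_vec_def)
  have inj: "inj (\<lambda>k::'n. axis k (1::real))" by (auto simp: inj_def axis_eq_axis)
  have "(\<integral>\<^sup>+z. (\<Prod>b\<in>Basis. h (axis_index b) (z \<bullet> b)) \<partial>(lborel :: (real^'n) measure))
      = (\<Prod>b\<in>(Basis :: (real^'n) set). \<integral>\<^sup>+x. h (axis_index b) x \<partial>lborel)"
    by (intro nn_integral_lborel_prod) auto
  then show ?thesis
    unfolding B by (simp add: prod.reindex[OF inj] inner_axis)
qed

lemma nn_integral_std_gaussian_prod:
  fixes g :: "'n::finite \<Rightarrow> real \<Rightarrow> real"
  assumes [measurable]: "\<And>k. g k \<in> borel_measurable borel" and g0: "\<And>k x. 0 \<le> g k x"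
  shows "(\<integral>\<^sup>+z. ennreal (\<Prod>k\<in>UNIV. g k (z $ k)) \<partial>std_gaussian)
    = (\<Prod>k\<in>UNIV. \<integral>\<^sup>+x. ennreal (std_normal_density x * g k x) \<partial>lborel)"
proof -
  have "(\<integral>\<^sup>+z. ennreal (\<Prod>k\<in>UNIV. g k (z $ k)) \<partial>std_gaussian)
      = (\<integral>\<^sup>+z. ennreal (std_gaussian_density z) * ennreal (\<Prod>k\<in>UNIV. g k (z $ k)) \<partial>lborel)"
    unfolding std_gaussian_def by (subst nn_integral_density) auto
  also have "\<dots> = (\<integral>\<^sup>+z. (\<Prod>k\<in>UNIV. ennreal (std_normal_density (z $ k) * g k (z $ k))) \<partial>lborel)"
  proof (intro nn_integral_cong)
    fix z :: "real^'n"
    have "ennreal (std_gaussian_density z) * ennreal (\<Prod>k\<in>UNIV. g k (z $ k))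
        = ennreal (\<Prod>k\<in>UNIV. std_normal_density (z $ k) * g k (z $ k))"
      by (simp add: ennreal_mult[symmetric] prod_nonneg g0 prod.distrib std_gaussian_density_def)
    then show "ennreal (std_gaussian_density z) * ennreal (\<Prod>k\<in>UNIV. g k (z $ k))
        = (\<Prod>k\<in>UNIV. ennreal (std_normal_density (z $ k) * g k (z $ k)))"
      using g0 by (simp add: prod_ennreal)
  qed
  also have "\<dots> = (\<Prod>k\<in>UNIV. \<integral>\<^sup>+x. ennreal (std_normal_density x * g k x) \<partial>lborel)"
    by (intro nn_integral_lborel_vec_prod) measurable
  finally show ?thesis .
qed

lemma nn_integral_std_normal_even:
  "(\<integral>\<^sup>+x. ennreal (std_normal_density x * x ^ (2 * c)) \<partial>lborel) = ennreal (fact (2 * c) / (2 ^ c * fact c))"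
proof -
  note m = std_normal_moment_even[of c]
  have "(\<integral>\<^sup>+x. ennreal (std_normal_density x * x ^ (2 * c)) \<partial>lborel)
      = ennreal (integral\<^sup>L lborel (\<lambda>x. std_normal_density x * x ^ (2 * c)))"
    using m by (intro nn_integral_eq_integral) (auto simp: has_bochner_integral_iff)
  then show ?thesis using m by (simp add: has_bochner_integral_iff)
qed

lemma nn_integral_std_normal_0_2_4:
  "(\<integral>\<^sup>+x. ennreal (std_normal_density x) \<partial>lborel) = 1"
  "(\<integral>\<^sup>+x. ennreal (std_normal_density x * x\<^sup>2) \<partial>lborel) = 1"
  "(\<integral>\<^sup>+x. ennreal (std_normal_density x * (x\<^sup>2 * x\<^sup>2)) \<partial>lborel) = 3"
proof -
  have "x\<^sup>2 * x\<^sup>2 = x ^ 4" for x :: real by (simp add: power_add[symmetric])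
  then show "(\<integral>\<^sup>+x. ennreal (std_normal_density x) \<partial>lborel) = 1"
    "(\<integral>\<^sup>+x. ennreal (std_normal_density x * x\<^sup>2) \<partial>lborel) = 1"
    "(\<integral>\<^sup>+x. ennreal (std_normal_density x * (x\<^sup>2 * x\<^sup>2)) \<partial>lborel) = 3"
    using nn_integral_std_normal_even[of 0] nn_integral_std_normal_even[of 1] nn_integral_std_normal_even[of 2]
    by (simp_all add: fact_numeral)
qed

lemma prob_space_std_gaussian: "prob_space std_gaussian"
proof
  have "emeasure (std_gaussian :: (real^'a) measure) UNIV = (\<integral>\<^sup>+z. ennreal (\<Prod>k\<in>(UNIV :: 'a set). 1) \<partial>(std_gaussian :: (real^'a) measure))"
    by simp
  also have "\<dots> = 1"
    by (subst nn_integral_std_gaussian_prod[of "\<lambda>_ _. 1"]) (simp_all add: nn_integral_std_normal_0_2_4)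
  finally show "emeasure (std_gaussian :: (real^'a) measure) (space std_gaussian) = 1" by simp
qed

lemma measure_std_gaussian_UNIV [simp]: "measure std_gaussian UNIV = 1"
  using prob_space.prob_space[OF prob_space_std_gaussian] by simp

lemma has_bochner_integral_nth_sq:
  "has_bochner_integral std_gaussian (\<lambda>z::real^'n. (z $ k)\<^sup>2) 1"
proof (rule has_bochner_integral_nn_integral)
  have "(\<integral>\<^sup>+z. ennreal ((z $ k)\<^sup>2) \<partial>std_gaussian)
      = (\<integral>\<^sup>+z. ennreal (\<Prod>j\<in>UNIV. if j = k then (z $ j)\<^sup>2 else 1) \<partial>(std_gaussian :: (real^'n) measure))"
    by (simp add: prod.delta)
  also have "\<dots> = (\<Prod>j\<in>UNIV. \<integral>\<^sup>+x. ennreal (std_normal_density x * (if j = k then x\<^sup>2 else 1)) \<partial>lborel)"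
    by (subst nn_integral_std_gaussian_prod[of "\<lambda>j x. if j = k then x\<^sup>2 else 1"]) auto
  also have "\<dots> = 1"
    by (intro prod.neutral ballI, case_tac "x = k") (simp_all add: nn_integral_std_normal_0_2_4)
  finally show "(\<integral>\<^sup>+z. ennreal ((z $ k)\<^sup>2) \<partial>(std_gaussian :: (real^'n) measure)) = ennreal 1" by simp
qed auto

lemma has_bochner_integral_nth_sq_sq:
  "has_bochner_integral std_gaussian (\<lambda>z::real^'n. (z $ k)\<^sup>2 * (z $ l)\<^sup>2) (if k = l then 3 else 1)"
proof (rule has_bochner_integral_nn_integral)
  let ?g = "\<lambda>j x::real. (if j = k then x\<^sup>2 else 1) * (if j = l then x\<^sup>2 else 1)"
  have "(\<integral>\<^sup>+z. ennreal ((z $ k)\<^sup>2 * (z $ l)\<^sup>2) \<partial>std_gaussian)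
      = (\<integral>\<^sup>+z. ennreal (\<Prod>j\<in>UNIV. ?g j (z $ j)) \<partial>(std_gaussian :: (real^'n) measure))"
    by (simp only: prod.distrib prod.delta[OF finite] UNIV_I if_True)
  also have "\<dots> = (\<Prod>j\<in>UNIV. \<integral>\<^sup>+x. ennreal (std_normal_density x * ?g j x) \<partial>lborel)"
    by (subst nn_integral_std_gaussian_prod[of ?g]) auto
  also have "\<dots> = (\<Prod>j\<in>UNIV. if j = k then (if k = l then 3 else 1) else 1)"
  proof (intro prod.cong refl)
    fix j
    show "(\<integral>\<^sup>+x. ennreal (std_normal_density x * ?g j x) \<partial>lborel) = (if j = k then (if k = l then 3 else 1) else 1)"
      using nn_integral_std_normal_0_2_4 by (cases "j = k"; cases "j = l"; cases "k = l") simp_all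
  qed
  also have "\<dots> = (if k = l then 3 else 1)" by (simp add: prod.delta)
  finally show "(\<integral>\<^sup>+z. ennreal ((z $ k)\<^sup>2 * (z $ l)\<^sup>2) \<partial>(std_gaussian :: (real^'n) measure))
      = ennreal (if k = l then 3 else 1)" by simp
qed auto

lemma norm_sq_vec: "(norm z)\<^sup>2 = (\<Sum>k\<in>UNIV. (z $ k)\<^sup>2)" for z :: "real^'n"
  unfolding power2_norm_eq_inner inner_vec_def by (simp add: power2_eq_square)

lemma has_bochner_integral_norm_sq:
  "has_bochner_integral std_gaussian (\<lambda>z::real^'n. (norm z)\<^sup>2) (real CARD('n))"
proof -
  have "has_bochner_integral std_gaussian (\<lambda>z::real^'n. \<Sum>k\<in>UNIV. (z $ k)\<^sup>2) (\<Sum>k\<in>(UNIV::'n set). 1)"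
    by (intro has_bochner_integral_sum has_bochner_integral_nth_sq)
  then show ?thesis by (simp add: norm_sq_vec)
qed

lemma has_bochner_integral_norm_4:
  "has_bochner_integral std_gaussian (\<lambda>z::real^'n. norm z ^ 4) (real CARD('n) * (real CARD('n) + 2))"
proof -
  have "has_bochner_integral std_gaussian (\<lambda>z::real^'n. \<Sum>k\<in>UNIV. \<Sum>l\<in>UNIV. (z $ k)\<^sup>2 * (z $ l)\<^sup>2)
     (\<Sum>k\<in>(UNIV::'n set). \<Sum>l\<in>(UNIV::'n set). if k = l then 3 else 1)"
    by (intro has_bochner_integral_sum has_bochner_integral_nth_sq_sq)
  moreover have "(\<Sum>l\<in>UNIV. if k = l then 3 else 1) = real CARD('n) + 2" for k :: 'n
  proof -
    have "(\<Sum>l\<in>UNIV. if k = l then 3 else 1) = (\<Sum>l\<in>(UNIV::'n set). 1 + (if k = l then 2 else (0::real)))"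
      by (intro sum.cong) auto
    then show ?thesis by (simp add: sum.distrib)
  qed
  moreover have "(\<Sum>k\<in>UNIV. \<Sum>l\<in>UNIV. (z $ k)\<^sup>2 * (z $ l)\<^sup>2) = norm z ^ 4" for z :: "real^'n"
    by (simp add: sum_product[symmetric] norm_sq_vec[symmetric] power_add[symmetric])
  ultimately show ?thesis by simp
qed

lemma integrable_std_gaussian_growth:
  fixes f :: "real^'n \<Rightarrow> real"
  assumes [measurable]: "f \<in> borel_measurable borel" and "\<And>z. \<bar>f z\<bar> \<le> c * (1 + norm z ^ 4)"
  shows "integrable std_gaussian f"
proof (rule Bochner_Integration.integrable_bound)
  interpret prob_space "std_gaussian :: (real^'n) measure" by (rule prob_space_std_gaussian)
  show "integrable std_gaussian (\<lambda>z::real^'n. c * (1 + norm z ^ 4))"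
    using has_bochner_integral_norm_4[where ?'n = 'n] by (auto simp: has_bochner_integral_iff)
  show "AE z in std_gaussian. norm (f z) \<le> norm (c * (1 + norm z ^ 4))"
    using assms(2) by (intro AE_I2) (simp, smt (verit))
qed simp

lemma power_le_one_plus_4:
  fixes r :: real assumes "0 \<le> r" "k \<le> 4" shows "r ^ k \<le> 1 + r ^ 4"
proof (cases "r \<le> 1")
  case True then show ?thesis using assms power_le_one[of r k] zero_le_power[of r 4] by linarith
next
  case False 
  then have "r ^ k \<le> r ^ 4" using assms by (intro power_increasing) auto
  then show ?thesis by simp
qed

lemma integrable_std_gaussian_linear_growth:
  fixes g :: "real^'n \<Rightarrow> real"
  assumes [measurable]: "g \<in> borel_measurable borel" and g: "\<And>z. \<bar>g z\<bar> \<le> a + b * norm z"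
  shows "integrable std_gaussian g" "integrable std_gaussian (\<lambda>z. g z * (z \<bullet> v))"
proof -
  let ?c = "\<bar>a\<bar> + \<bar>b\<bar>"
  have gb: "\<bar>g z\<bar> \<le> \<bar>a\<bar> + \<bar>b\<bar> * norm z" for z :: "real^'n"
    using g[of z] mult_right_mono[OF abs_ge_self[of b] norm_ge_zero[of z]] abs_ge_self[of a] by linarith
  show "integrable std_gaussian g"
  proof (rule integrable_std_gaussian_growth[where c = ?c])
    fix z :: "real^'n"
    have "\<bar>a\<bar> + \<bar>b\<bar> * norm z \<le> \<bar>a\<bar> * (1 + norm z ^ 4) + \<bar>b\<bar> * (1 + norm z ^ 4)"
      using power_le_one_plus_4[of "norm z" 1] mult_left_mono[of 1 "1 + norm z ^ 4" "\<bar>a\<bar>"]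
      by (intro add_mono mult_left_mono) auto
    then show "\<bar>g z\<bar> \<le> ?c * (1 + norm z ^ 4)" using gb[of z] by (simp add: distrib_right)
  qed simp
  show "integrable std_gaussian (\<lambda>z. g z * (z \<bullet> v))"
  proof (rule integrable_std_gaussian_growth[where c = "?c * norm v"])
    fix z
    have "\<bar>g z * (z \<bullet> v)\<bar> \<le> (\<bar>a\<bar> + \<bar>b\<bar> * norm z) * (norm z * norm v)"
      unfolding abs_mult using gb Cauchy_Schwarz_ineq2[of z v] by (intro mult_mono) auto
    also have "\<dots> = (\<bar>a\<bar> * norm z ^ 1 + \<bar>b\<bar> * norm z ^ 2) * norm v"
      by (simp add: power2_eq_square algebra_simps)
    also have "\<dots> \<le> (\<bar>a\<bar> * (1 + norm z ^ 4) + \<bar>b\<bar> * (1 + norm z ^ 4)) * norm v"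
      by (intro mult_right_mono add_mono mult_left_mono power_le_one_plus_4) auto
    finally show "\<bar>g z * (z \<bullet> v)\<bar> \<le> ?c * norm v * (1 + norm z ^ 4)" by (simp add: algebra_simps)
  qed measurable
qed

lemma std_gaussian_density_shift:
  "std_gaussian_density (z - v) = std_gaussian_density z * exp (z \<bullet> v - v \<bullet> v / 2)"
proof -
  have "std_normal_density (x - y) = std_normal_density x * exp (x * y - y * y / 2)" for x y :: real
    unfolding std_normal_density_def
    by (simp add: exp_add[symmetric] power2_eq_square field_simps)
  then have "std_gaussian_density (z - v) = std_gaussian_density z * (\<Prod>k\<in>UNIV. exp (z $ k * v $ k - v $ k * v $ k / 2))"
    by (simp add: std_gaussian_density_def prod.distrib)
  also have "(\<Prod>k\<in>UNIV. exp (z $ k * v $ k - v $ k * v $ k / 2)) = exp (z \<bullet> v - v \<bullet> v / 2)"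
    by (simp add: exp_sum[symmetric] sum_subtractf inner_vec_def sum_divide_distrib)
  finally show ?thesis .
qed

text \<open>Translating the standard Gaussian by \<open>v\<close> multiplies its density by the exponential of an affine
  function.\<close>

lemma std_gaussian_shift:
  fixes h :: "real^'n \<Rightarrow> real"
  assumes [measurable]: "h \<in> borel_measurable borel"
  shows "integral\<^sup>L std_gaussian (\<lambda>z. h (z + v)) = integral\<^sup>L std_gaussian (\<lambda>z. exp (z \<bullet> v - v \<bullet> v / 2) * h z)"
    and "integrable std_gaussian (\<lambda>z. h (z + v)) \<longleftrightarrow> integrable std_gaussian (\<lambda>z. exp (z \<bullet> v - v \<bullet> v / 2) * h z)"
proof -
  let ?F = "\<lambda>w. std_gaussian_density (w - v) * h w"
  have F: "?F w = std_gaussian_density w * (exp (w \<bullet> v - v \<bullet> v / 2) * h w)" for w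
    by (simp add: std_gaussian_density_shift)
  have [measurable]: "(\<lambda>z. h (z + v)) \<in> borel_measurable borel" "(\<lambda>z. std_gaussian_density (z - v)) \<in> borel_measurable borel"
    by measurable
  have "integral\<^sup>L lborel (\<lambda>z. ?F (v + z)) = integral\<^sup>L (distr lborel borel ((+) v)) ?F"
    by (subst integral_distr) auto
  also have "\<dots> = integral\<^sup>L lborel ?F" by (simp only: lborel_distr_plus)
  finally show "integral\<^sup>L std_gaussian (\<lambda>z. h (z + v)) = integral\<^sup>L std_gaussian (\<lambda>z. exp (z \<bullet> v - v \<bullet> v / 2) * h z)"
    unfolding std_gaussian_def F by (simp add: integral_density std_gaussian_density_nonneg F[symmetric] add.commute)
  have "integrable lborel (\<lambda>z. ?F (v + z)) \<longleftrightarrow> integrable (distr lborel borel ((+) v)) ?F"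
    by (subst integrable_distr_eq) auto
  also have "\<dots> \<longleftrightarrow> integrable lborel ?F" by (simp only: lborel_distr_plus)
  finally show "integrable std_gaussian (\<lambda>z. h (z + v)) \<longleftrightarrow> integrable std_gaussian (\<lambda>z. exp (z \<bullet> v - v \<bullet> v / 2) * h z)"
    unfolding std_gaussian_def F by (simp add: integrable_density std_gaussian_density_nonneg F[symmetric] add.commute)
qed

lemma std_gaussian_reflect:
  fixes h :: "real^'n \<Rightarrow> real"
  assumes [measurable]: "h \<in> borel_measurable borel"
  shows "integral\<^sup>L std_gaussian (\<lambda>z. h (- z)) = integral\<^sup>L std_gaussian h"
proof -
  have even: "std_gaussian_density (- z) = std_gaussian_density z" for z :: "real^'n"
    by (simp add: std_gaussian_density_def std_normal_density_def)
  have refl: "(lborel :: (real^'n) measure) = distr lborel borel uminus"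
    using lborel_affine[of "-1" "0 :: real^'n"] by (simp add: density_1)
  have "integral\<^sup>L lborel (\<lambda>z. std_gaussian_density z * h z)
      = integral\<^sup>L (distr lborel borel uminus) (\<lambda>z. std_gaussian_density z * h z)"
    by (simp only: refl[symmetric])
  also have "\<dots> = integral\<^sup>L lborel (\<lambda>z. std_gaussian_density z * h (- z))"
    by (subst integral_distr) (auto simp: even)
  finally show ?thesis
    unfolding std_gaussian_def by (simp add: integral_density std_gaussian_density_nonneg)
qed

lemma std_gaussian_inner_mean: "integral\<^sup>L std_gaussian (\<lambda>z::real^'n. z \<bullet> v) = 0"
  using std_gaussian_reflect[of "\<lambda>z. z \<bullet> v"] by simp

text \<open>Here \<open>(\<integral>z. h z * (z \<bullet> v) \<partial>std_gaussian)\<close> is the directional derivative at the origin of the smoothing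
  \<open>w \<mapsto> (\<integral>z. h (z + w) \<partial>std_gaussian)\<close>, which is convex like \<open>h\<close>. For \<open>h \<ge> 0\<close> a direct estimate replaces
  differentiation under the integral: write the smoothing at \<open>s v\<close> with the shifted density and bound the exponential
  from below by its tangent. The error is of order \<open>s\<^sup>2\<close> and disappears after division by \<open>s\<close>.\<close>

lemma gaussian_gradient_ineq_nonneg:
  fixes h :: "real^'n \<Rightarrow> real"
  assumes m[measurable]: "h \<in> borel_measurable borel" and growth: "\<And>z. \<bar>h z\<bar> \<le> a + b * norm z"
    and conv: "convex_on UNIV h" and h0: "\<And>z. 0 \<le> h z" and "0 \<le> b"
  shows "(\<integral>z. h z * (z \<bullet> v) \<partial>std_gaussian) \<le> (\<integral>z. h (z + v) \<partial>std_gaussian) - (\<integral>z. h z \<partial>std_gaussian)"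
proof -
  define A where "A = (\<integral>z. h z * (z \<bullet> v) \<partial>std_gaussian)"
  define D where "D = (\<integral>z. h (z + v) \<partial>std_gaussian)"
  define H where "H = (\<integral>z. h z \<partial>std_gaussian)"
  have int: "integrable std_gaussian h" "integrable std_gaussian (\<lambda>z. h z * (z \<bullet> v))"
    by (rule integrable_std_gaussian_linear_growth[OF m growth])+
  have int_shift: "integrable std_gaussian (\<lambda>z. h (z + w))" for w
  proof (rule integrable_std_gaussian_linear_growth[where a = "a + b * norm w" and b = b])
    fix z
    have "b * norm (z + w) \<le> b * (norm z + norm w)" using \<open>0 \<le> b\<close> by (intro mult_left_mono norm_triangle_ineq)
    then show "\<bar>h (z + w)\<bar> \<le> a + b * norm w + b * norm z" using growth[of "z + w"] by (simp add: algebra_simps)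
  qed measurable
  have H0: "0 \<le> H" unfolding H_def using h0 by (intro integral_nonneg_AE) auto
  define q where "q = (v \<bullet> v) / 2 * H"
  have q0: "0 \<le> q" using H0 by (simp add: q_def)
  have key: "A - (D - H) \<le> s * q" if s: "0 < s" "s \<le> 1" for s
  proof -
    let ?w = "s *\<^sub>R v"
    have i1: "integrable std_gaussian (\<lambda>z. h z + s * (h z * (z \<bullet> v)) - s\<^sup>2 * ((v \<bullet> v) / 2) * h z)"
      using int by (intro Bochner_Integration.integrable_diff Bochner_Integration.integrable_add integrable_mult_right)
    have "H + s * A - s\<^sup>2 * ((v \<bullet> v) / 2) * H
        = (\<integral>z. h z + s * (h z * (z \<bullet> v)) - s\<^sup>2 * ((v \<bullet> v) / 2) * h z \<partial>std_gaussian)"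
      unfolding H_def A_def using int by simp
    also have "\<dots> \<le> (\<integral>z. exp (z \<bullet> ?w - ?w \<bullet> ?w / 2) * h z \<partial>std_gaussian)"
    proof (rule integral_mono[OF i1])
      show "integrable std_gaussian (\<lambda>z. exp (z \<bullet> ?w - ?w \<bullet> ?w / 2) * h z)"
        using std_gaussian_shift(2)[OF m, of ?w] int_shift by blast
      fix z
      have "(1 + (z \<bullet> ?w - ?w \<bullet> ?w / 2)) * h z \<le> exp (z \<bullet> ?w - ?w \<bullet> ?w / 2) * h z"
        using h0 by (intro mult_right_mono exp_ge_add_one_self)
      then show "h z + s * (h z * (z \<bullet> v)) - s\<^sup>2 * ((v \<bullet> v) / 2) * h z \<le> exp (z \<bullet> ?w - ?w \<bullet> ?w / 2) * h z"
        by (simp add: power2_eq_square algebra_simps)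
    qed
    also have "\<dots> = (\<integral>z. h (z + ?w) \<partial>std_gaussian)" by (rule std_gaussian_shift(1)[OF m, symmetric])
    also have "\<dots> \<le> (\<integral>z. (1 - s) * h z + s * h (z + v) \<partial>std_gaussian)"
    proof (rule integral_mono[OF int_shift])
      show "integrable std_gaussian (\<lambda>z. (1 - s) * h z + s * h (z + v))"
        using int int_shift by (intro Bochner_Integration.integrable_add integrable_mult_right)
      fix z
      have "h ((1 - s) *\<^sub>R z + s *\<^sub>R (z + v)) \<le> (1 - s) * h z + s * h (z + v)"
        using convex_onD[OF conv, of s z "z + v"] s by simp
      then show "h (z + ?w) \<le> (1 - s) * h z + s * h (z + v)" by (simp add: algebra_simps)
    qed
    also have "\<dots> = (1 - s) * H + s * D" unfolding H_def D_def using int int_shift by simp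
    finally have "s * (A - (D - H)) \<le> s * (s * q)" by (simp add: q_def power2_eq_square algebra_simps)
    then show ?thesis using s by simp
  qed
  \<comment> \<open>Let \<open>s\<close> tend to zero in \<open>key\<close>; the value of \<open>s\<close> below gives a contradiction explicitly.\<close>
  have "A \<le> D - H"
  proof (rule ccontr)
    assume neg: "\<not> A \<le> D - H"
    define e where "e = A - (D - H)"
    have e: "0 < e" using neg by (simp add: e_def)
    have "e \<le> e / (2 * (q + e)) * q" unfolding e_def[symmetric] using key[of "e / (2 * (q + e))"] e q0
      by (simp add: e_def[symmetric] divide_le_eq)
    then have "e * (2 * (q + e)) \<le> e * q" using e q0 by (simp add: field_simps)
    then have "2 * (q + e) \<le> q" using e by simp
    then show False using e q0 by simp
  qed
  then show ?thesis by (simp add: A_def D_def H_def)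
qed

lemma tendsto_integral_truncation:
  fixes X Y :: "'a \<Rightarrow> real"
  assumes [measurable]: "X \<in> borel_measurable M" "Y \<in> borel_measurable M" and int: "integrable M (\<lambda>z. X z * Y z)"
  shows "(\<lambda>K::nat. \<integral>z. max (X z) (- real K) * Y z \<partial>M) \<longlonglongrightarrow> (\<integral>z. X z * Y z \<partial>M)"
proof (rule integral_dominated_convergence)
  show "integrable M (\<lambda>z. \<bar>X z * Y z\<bar>)" using int by (rule integrable_abs)
  show "AE z in M. (\<lambda>K::nat. max (X z) (- real K) * Y z) \<longlonglongrightarrow> X z * Y z"
  proof (intro AE_I2 tendsto_eventually)
    fix z
    obtain K0 :: nat where "- X z \<le> real K0" using real_arch_simple by blast
    then show "\<forall>\<^sub>F K in sequentially. max (X z) (- real K) * Y z = X z * Y z"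
      by (intro eventually_sequentiallyI[of K0]) (auto simp: max_def)
  qed
  show "AE z in M. norm (max (X z) (- real K) * Y z) \<le> \<bar>X z * Y z\<bar>" for K
  proof (intro AE_I2)
    fix z
    have "\<bar>max (X z) (- real K)\<bar> \<le> \<bar>X z\<bar>" by (auto simp: max_def)
    then show "norm (max (X z) (- real K) * Y z) \<le> \<bar>X z * Y z\<bar>"
      by (simp add: abs_mult mult_right_mono)
  qed
qed measurable

text \<open>Both sides are invariant under adding a constant to \<open>h\<close>. So the inequality holds for every
  truncation of \<open>h\<close> from below, and dominated convergence removes the truncation.\<close>

lemma gaussian_gradient_ineq:
  fixes h :: "real^'n \<Rightarrow> real"
  assumes m[measurable]: "h \<in> borel_measurable borel" and growth: "\<And>z. \<bar>h z\<bar> \<le> a + b * norm z"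
    and conv: "convex_on UNIV h" and "0 \<le> b"
  shows "(\<integral>z. h z * (z \<bullet> v) \<partial>std_gaussian) \<le> (\<integral>z. h (z + v) \<partial>std_gaussian) - (\<integral>z. h z \<partial>std_gaussian)"
proof -
  interpret prob_space "std_gaussian :: (real^'n) measure" by (rule prob_space_std_gaussian)
  have int: "integrable std_gaussian h" "integrable std_gaussian (\<lambda>z. h z * (z \<bullet> v))"
    by (rule integrable_std_gaussian_linear_growth[OF m growth])+
  have growth_shift: "\<bar>h (z + v)\<bar> \<le> (a + b * norm v) + b * norm z" for z
  proof -
    have "b * norm (z + v) \<le> b * (norm z + norm v)" using \<open>0 \<le> b\<close> by (intro mult_left_mono norm_triangle_ineq)
    then show ?thesis using growth[of "z + v"] by (simp add: algebra_simps)
  qed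
  have ms[measurable]: "(\<lambda>z. h (z + v)) \<in> borel_measurable borel" by measurable
  have int_shift: "integrable std_gaussian (\<lambda>z. h (z + v))"
    by (rule integrable_std_gaussian_linear_growth(1)[OF ms growth_shift])
  have trunc: "(\<integral>z. max (h z) (- real K) * (z \<bullet> v) \<partial>std_gaussian)
      \<le> (\<integral>z. max (h (z + v)) (- real K) * 1 \<partial>std_gaussian) - (\<integral>z. max (h z) (- real K) * 1 \<partial>std_gaussian)"
    for K :: nat
  proof -
    let ?k = "real K"
    define g where "g z = max (h z) (- ?k) + ?k" for z
    have g_meas[measurable]: "g \<in> borel_measurable borel" unfolding g_def[abs_def] by measurable
    have gr: "\<bar>g z\<bar> \<le> (a + ?k) + b * norm z" for z using growth[of z] by (auto simp: g_def max_def)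
    have "convex_on UNIV g"
    proof (rule convex_onI)
      fix t :: real and x y :: "real^'n" assume t: "0 < t" "t < 1"
      have "h ((1 - t) *\<^sub>R x + t *\<^sub>R y) \<le> (1 - t) * h x + t * h y" using convex_onD[OF conv, of t x y] t by simp
      also have "\<dots> \<le> (1 - t) * max (h x) (- ?k) + t * max (h y) (- ?k)"
        using t by (intro add_mono mult_left_mono) auto
      finally have 1: "h ((1 - t) *\<^sub>R x + t *\<^sub>R y) \<le> (1 - t) * max (h x) (- ?k) + t * max (h y) (- ?k)" .
      have "- ?k = (1 - t) * (- ?k) + t * (- ?k)" by (simp add: algebra_simps)
      also have "\<dots> \<le> (1 - t) * max (h x) (- ?k) + t * max (h y) (- ?k)"
        using t by (intro add_mono mult_left_mono) auto
      finally have "max (h ((1 - t) *\<^sub>R x + t *\<^sub>R y)) (- ?k) \<le> (1 - t) * max (h x) (- ?k) + t * max (h y) (- ?k)"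
        using 1 by simp
      moreover have "(1 - t) * ?k + t * ?k = ?k" by (simp add: algebra_simps)
      ultimately show "g ((1 - t) *\<^sub>R x + t *\<^sub>R y) \<le> (1 - t) * g x + t * g y"
        unfolding g_def by (simp only: distrib_left)
    qed simp
    note main = gaussian_gradient_ineq_nonneg[OF g_meas gr this _ \<open>0 \<le> b\<close>, of v]
    have g0: "0 \<le> g z" for z by (simp add: g_def)
    have gi: "integrable std_gaussian g" "integrable std_gaussian (\<lambda>z. g z * (z \<bullet> v))"
      by (rule integrable_std_gaussian_linear_growth[OF g_meas gr])+
    have grs: "\<bar>g (z + v)\<bar> \<le> (a + b * norm v + ?k) + b * norm z" for z
      using growth_shift[of z] by (auto simp: g_def max_def)
    have gms[measurable]: "(\<lambda>z. g (z + v)) \<in> borel_measurable borel" by measurable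
    have gis: "integrable std_gaussian (\<lambda>z. g (z + v))"
      by (rule integrable_std_gaussian_linear_growth(1)[OF gms grs])
    have i1: "integrable std_gaussian (\<lambda>z. z \<bullet> v)"
      using integrable_std_gaussian_linear_growth(2)[of "\<lambda>_. 1" 1 0 v] by simp
    have "(\<integral>z. max (h z) (- ?k) * (z \<bullet> v) \<partial>std_gaussian) = (\<integral>z. g z * (z \<bullet> v) - ?k * (z \<bullet> v) \<partial>std_gaussian)"
      by (simp add: g_def algebra_simps)
    also have "\<dots> = (\<integral>z. g z * (z \<bullet> v) \<partial>std_gaussian)"
      using gi i1 by (simp add: std_gaussian_inner_mean)
    finally have e1: "(\<integral>z. max (h z) (- ?k) * (z \<bullet> v) \<partial>std_gaussian) = (\<integral>z. g z * (z \<bullet> v) \<partial>std_gaussian)" .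
    have "(\<integral>z. max (h (z + v)) (- ?k) * 1 \<partial>std_gaussian) = (\<integral>z. g (z + v) - ?k \<partial>std_gaussian)"
      by (simp add: g_def)
    also have "\<dots> = (\<integral>z. g (z + v) \<partial>std_gaussian) - ?k" using gis by (simp add: prob_space)
    finally have e2: "(\<integral>z. max (h (z + v)) (- ?k) * 1 \<partial>std_gaussian) = (\<integral>z. g (z + v) \<partial>std_gaussian) - ?k" .
    have "(\<integral>z. max (h z) (- ?k) * 1 \<partial>std_gaussian) = (\<integral>z. g z - ?k \<partial>std_gaussian)"
      by (simp add: g_def)
    also have "\<dots> = (\<integral>z. g z \<partial>std_gaussian) - ?k" using gi by (simp add: prob_space)
    finally show ?thesis using main g0 e1 e2 by simp
  qed
  have "(\<lambda>K::nat. \<integral>z. max (h z) (- real K) * (z \<bullet> v) \<partial>std_gaussian) \<longlonglongrightarrow> (\<integral>z. h z * (z \<bullet> v) \<partial>std_gaussian)"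
    using int by (intro tendsto_integral_truncation) auto
  moreover have "(\<lambda>K::nat. (\<integral>z. max (h (z + v)) (- real K) * 1 \<partial>std_gaussian) - (\<integral>z. max (h z) (- real K) * 1 \<partial>std_gaussian))
     \<longlonglongrightarrow> (\<integral>z. h (z + v) * 1 \<partial>std_gaussian) - (\<integral>z. h z * 1 \<partial>std_gaussian)"
    using int int_shift by (intro tendsto_diff tendsto_integral_truncation) auto
  ultimately have "(\<integral>z. h z * (z \<bullet> v) \<partial>std_gaussian) \<le> (\<integral>z. h (z + v) * 1 \<partial>std_gaussian) - (\<integral>z. h z * 1 \<partial>std_gaussian)"
    by (rule LIMSEQ_le) (use trunc in blast)
  then show ?thesis by simp
qed

text \<open>Integrate the inequality of arithmetic and geometric means, \<open>r \<le> r\<^sup>2 / (2 m) + m / 2\<close>, with \<open>m = sqrt n\<close>.\<close>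

lemma expectation_norm_le: "(\<integral>z. norm (z :: real^'n) \<partial>std_gaussian) \<le> sqrt (real CARD('n))"
proof -
  interpret prob_space "std_gaussian :: (real^'n) measure" by (rule prob_space_std_gaussian)
  let ?n = "sqrt (real CARD('n))"
  have n: "0 < ?n" by simp
  have sq: "integrable std_gaussian (\<lambda>z::real^'n. (norm z)\<^sup>2)" "(\<integral>z. (norm (z :: real^'n))\<^sup>2 \<partial>std_gaussian) = real CARD('n)"
    using has_bochner_integral_norm_sq[where ?'n = 'n] by (auto simp: has_bochner_integral_iff)
  have "(\<integral>z. norm (z :: real^'n) \<partial>std_gaussian) \<le> (\<integral>z. (norm (z :: real^'n))\<^sup>2 / (2 * ?n) + ?n / 2 \<partial>std_gaussian)"
  proof (rule integral_mono)
    show "integrable std_gaussian (\<lambda>z::real^'n. norm z)"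
      by (rule integrable_std_gaussian_linear_growth(1)[where a = 0 and b = 1]) auto
    show "integrable std_gaussian (\<lambda>z::real^'n. (norm z)\<^sup>2 / (2 * ?n) + ?n / 2)" using sq by auto
    fix z :: "real^'n"
    have "0 \<le> (norm z - ?n)\<^sup>2 / (2 * ?n)" using n by (intro divide_nonneg_pos) auto
    also have "\<dots> = (norm z)\<^sup>2 / (2 * ?n) + ?n / 2 - norm z"
      using n by (simp add: power2_eq_square field_simps)
    finally show "norm z \<le> (norm z)\<^sup>2 / (2 * ?n) + ?n / 2" by simp
  qed
  also have "\<dots> = real CARD('n) / (2 * ?n) + ?n / 2" using sq by (simp add: prob_space)
  also have "\<dots> = ?n" using n by (simp add: field_simps)
  finally show ?thesis .
qed

lemma gf_oracle_norm_le:
  assumes lip: "L-lipschitz_on UNIV f" and "0 < \<mu>"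
  shows "norm (gf_oracle f \<mu> y z) \<le> L * (norm z)\<^sup>2"
proof -
  have "\<bar>f (y + \<mu> *\<^sub>R z) - f y\<bar> \<le> L * (\<mu> * norm z)"
    using lipschitz_onD[OF lip, of "y + \<mu> *\<^sub>R z" y] \<open>0 < \<mu>\<close> by (simp add: dist_norm)
  then have "\<bar>f (y + \<mu> *\<^sub>R z) - f y\<bar> / \<mu> \<le> L * norm z"
    using \<open>0 < \<mu>\<close> by (simp add: divide_le_eq algebra_simps)
  then have "\<bar>f (y + \<mu> *\<^sub>R z) - f y\<bar> / \<mu> * norm z \<le> L * norm z * norm z" by (intro mult_right_mono) auto
  then show ?thesis using \<open>0 < \<mu>\<close> by (simp add: gf_oracle_def power2_eq_square)
qed

text \<open>The smoothing of \<open>f\<close> lies above \<open>f\<close>, since the Gaussian is symmetric and \<open>f\<close> convex, and exceeds it by at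
  most \<open>\<mu> * L\<close> times the mean norm. In between, \<open>gaussian_gradient_ineq\<close> is the subgradient inequality of
  the smoothing; the term \<open>- f y\<close> in the difference quotient does not change the mean.\<close>

lemma gf_oracle_expectation:
  fixes f :: "real^'n \<Rightarrow> real"
  assumes conv: "convex_on UNIV f" and lip: "L-lipschitz_on UNIV f" and \<mu>: "0 < \<mu>"
  shows "f y - f u - \<mu> * L * sqrt (real CARD('n)) \<le> (\<integral>z. gf_oracle f \<mu> y z \<bullet> (y - u) \<partial>std_gaussian)"
proof -
  interpret prob_space "std_gaussian :: (real^'n) measure" by (rule prob_space_std_gaussian)
  have L0: "0 \<le> L" using lip by (rule lipschitz_on_nonneg)
  have f_meas[measurable]: "f \<in> borel_measurable borel"
    using lipschitz_on_continuous_on[OF lip] by (rule borel_measurable_continuous_onI)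
  define sm where "sm x z = f (x + \<mu> *\<^sub>R z)" for x z
  have sm_meas[measurable]: "sm x \<in> borel_measurable borel" for x unfolding sm_def[abs_def] by measurable
  have dev: "\<bar>sm x z - f x\<bar> \<le> L * \<mu> * norm z" for x z
    using lipschitz_onD[OF lip, of "x + \<mu> *\<^sub>R z" x] \<mu> by (simp add: dist_norm sm_def)
  have growth: "\<bar>sm x z\<bar> \<le> \<bar>f x\<bar> + L * \<mu> * norm z" for x z using dev[of x z] by linarith
  have int: "integrable std_gaussian (sm x)" "integrable std_gaussian (\<lambda>z. sm x z * (z \<bullet> v))" for x v
    by (rule integrable_std_gaussian_linear_growth[OF sm_meas growth])+
  have i1: "integrable std_gaussian (\<lambda>z::real^'n. z \<bullet> v)" for v
    using integrable_std_gaussian_linear_growth(2)[of "\<lambda>_. 1" 1 0 v] by simp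
  have lower: "f x \<le> (\<integral>z. sm x z \<partial>std_gaussian)" for x
  proof -
    have r: "(\<integral>z. sm x (- z) \<partial>std_gaussian) = (\<integral>z. sm x z \<partial>std_gaussian)"
      by (rule std_gaussian_reflect[OF sm_meas])
    have ir: "integrable std_gaussian (\<lambda>z. sm x (- z))"
      by (rule integrable_std_gaussian_linear_growth(1)[where a = "\<bar>f x\<bar>" and b = "L * \<mu>"])
         (use growth[of x "- _"] in auto)
    have "f x = (\<integral>z. f x \<partial>(std_gaussian :: (real^'n) measure))" by (simp add: prob_space)
    also have "\<dots> \<le> (\<integral>z. 1 / 2 * sm x z + 1 / 2 * sm x (- z) \<partial>std_gaussian)"
    proof (rule integral_mono)
      fix z
      have "(1 / 2) *\<^sub>R (x + \<mu> *\<^sub>R z) + (1 / 2) *\<^sub>R (x + \<mu> *\<^sub>R (- z)) = x"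
        by (simp add: scaleR_add_right[symmetric] scaleR_2[symmetric])
      then show "f x \<le> 1 / 2 * sm x z + 1 / 2 * sm x (- z)"
        using convex_onD[OF conv, of "1 / 2" "x + \<mu> *\<^sub>R z" "x + \<mu> *\<^sub>R (- z)"] by (simp add: sm_def)
    qed (use int ir in auto)
    also have "\<dots> = (\<integral>z. sm x z \<partial>std_gaussian)" using int ir r by simp
    finally show ?thesis .
  qed
  have upper: "(\<integral>z. sm x z \<partial>std_gaussian) \<le> f x + \<mu> * L * sqrt (real CARD('n))" for x
  proof -
    have ni: "integrable std_gaussian (\<lambda>z::real^'n. norm z)"
      by (rule integrable_std_gaussian_linear_growth(1)[where a = 0 and b = 1]) auto
    have "(\<integral>z. sm x z \<partial>std_gaussian) \<le> (\<integral>z. f x + L * \<mu> * norm (z :: real^'n) \<partial>std_gaussian)"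
    proof (rule integral_mono[where f = "sm x"])
      fix z show "sm x z \<le> f x + L * \<mu> * norm z" using dev[of x z] by linarith
    qed (use int ni in auto)
    also have "\<dots> = f x + L * \<mu> * (\<integral>z. norm (z :: real^'n) \<partial>std_gaussian)" using ni by (simp add: prob_space)
    also have "\<dots> \<le> f x + L * \<mu> * sqrt (real CARD('n))"
      using L0 \<mu> by (intro add_left_mono mult_left_mono expectation_norm_le) auto
    finally show ?thesis by (simp add: mult.commute)
  qed
  \<comment> \<open>In the scale of the noise, moving by \<open>v\<close> means moving from \<open>y\<close> to \<open>u\<close>.\<close>
  define v where "v = (1 / \<mu>) *\<^sub>R (u - y)"
  have smv: "sm y (z + v) = sm u z" for z
    using \<mu> by (simp add: sm_def v_def algebra_simps)
  have sm_conv: "convex_on UNIV (sm y)"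
  proof (rule convex_onI)
    fix t :: real and z w assume t: "0 < t" "t < 1"
    have "y + \<mu> *\<^sub>R ((1 - t) *\<^sub>R z + t *\<^sub>R w) = (1 - t) *\<^sub>R (y + \<mu> *\<^sub>R z) + t *\<^sub>R (y + \<mu> *\<^sub>R w)"
      by (simp add: algebra_simps)
    then show "sm y ((1 - t) *\<^sub>R z + t *\<^sub>R w) \<le> (1 - t) * sm y z + t * sm y w"
      using convex_onD[OF conv, of t "y + \<mu> *\<^sub>R z" "y + \<mu> *\<^sub>R w"] t by (simp add: sm_def)
  qed simp
  have "(\<integral>z. sm y z * (z \<bullet> v) \<partial>std_gaussian) \<le> (\<integral>z. sm u z \<partial>std_gaussian) - (\<integral>z. sm y z \<partial>std_gaussian)"
    using gaussian_gradient_ineq[OF sm_meas growth sm_conv, of v] L0 \<mu> by (simp add: smv)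
  moreover have "gf_oracle f \<mu> y z \<bullet> (y - u) = f y * (z \<bullet> v) - sm y z * (z \<bullet> v)" for z
    using \<mu> by (simp add: gf_oracle_def sm_def v_def inner_diff_right field_simps)
  then have "(\<integral>z. gf_oracle f \<mu> y z \<bullet> (y - u) \<partial>std_gaussian) = - (\<integral>z. sm y z * (z \<bullet> v) \<partial>std_gaussian)"
    using int i1 by (simp add: std_gaussian_inner_mean)
  ultimately show ?thesis using lower[of y] upper[of u] by linarith
qed

section \<open>Accumulated disagreement\<close>

text \<open>Unrolls the recursion: the displacement at time \<open>s\<close> is mixed in all the later rounds.\<close>

lemma mixing_run_expansion:
  fixes x :: "nat \<Rightarrow> 'v::finite \<Rightarrow> 'a::real_vector"
  assumes "\<And>i. x 0 i = 0" "\<And>t i. x (Suc t) i = (\<Sum>j\<in>UNIV. P t $ i $ j *\<^sub>R x t j) + e t i"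
  shows "x t i = (\<Sum>s<t. mixing_run (\<lambda>k. P (Suc s + k)) (t - Suc s) (e s) i)"
proof (induction t arbitrary: i)
  case 0 then show ?case using assms by simp
next
  case (Suc t)
  have step: "mixing_run (\<lambda>k. P (Suc s + k)) (Suc t - Suc s) (e s) i
      = (\<Sum>j\<in>UNIV. P t $ i $ j *\<^sub>R mixing_run (\<lambda>k. P (Suc s + k)) (t - Suc s) (e s) j)" if "s < t" for s
  proof -
    have "Suc t - Suc s = Suc (t - Suc s)" using that by simp
    moreover have "Suc s + (t - Suc s) = t" using that by simp
    ultimately show ?thesis by simp
  qed
  have "x (Suc t) i = (\<Sum>j\<in>UNIV. P t $ i $ j *\<^sub>R (\<Sum>s<t. mixing_run (\<lambda>k. P (Suc s + k)) (t - Suc s) (e s) j)) + e t i"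
    by (simp add: assms(2) Suc.IH)
  also have "\<dots> = (\<Sum>s<t. \<Sum>j\<in>UNIV. P t $ i $ j *\<^sub>R mixing_run (\<lambda>k. P (Suc s + k)) (t - Suc s) (e s) j) + e t i"
    unfolding scaleR_sum_right by (subst sum.swap) simp
  also have "\<dots> = (\<Sum>s<Suc t. mixing_run (\<lambda>k. P (Suc s + k)) (Suc t - Suc s) (e s) i)"
    using step by simp
  finally show ?case .
qed

lemma disagreement_nonneg: "0 \<le> disagreement x"
  by (simp add: disagreement_def sq_disagreement_def sum_nonneg)

lemma disagreement_add:
  "disagreement (\<lambda>i. x i + y i) \<le> disagreement x + disagreement y"
proof -
  have "agent_mean (\<lambda>i. x i + y i) = agent_mean x + agent_mean y"
    by (simp add: agent_mean_def sum.distrib scaleR_add_right)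
  then have "disagreement (\<lambda>i. x i + y i)
      = L2_set (\<lambda>i. norm ((x i - agent_mean x) + (y i - agent_mean y))) UNIV"
    by (simp add: disagreement_conv_L2_set add_diff_add)
  also have "\<dots> \<le> L2_set (\<lambda>i. norm (x i - agent_mean x) + norm (y i - agent_mean y)) UNIV"
    by (intro L2_set_mono norm_triangle_ineq) auto
  also have "\<dots> \<le> disagreement x + disagreement y"
    unfolding disagreement_conv_L2_set by (rule L2_set_triangle_ineq)
  finally show ?thesis .
qed

lemma disagreement_sum:
  "disagreement (\<lambda>i. \<Sum>s<(n::nat). x s i) \<le> (\<Sum>s<n. disagreement (x s))"
proof (induction n)
  case 0 then show ?case by (simp add: disagreement_def sq_disagreement_def agent_mean_def)
next
  case (Suc n)
  have "disagreement (\<lambda>i. \<Sum>s<Suc n. x s i) \<le> disagreement (\<lambda>i. \<Sum>s<n. x s i) + disagreement (x n)"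
    using disagreement_add[of "\<lambda>i. \<Sum>s<n. x s i" "x n"] by simp
  then show ?case using Suc by simp
qed

lemma disagreement_le_sum_norm:
  fixes e :: "'v::finite \<Rightarrow> real^'n"
  shows "disagreement e \<le> (\<Sum>j\<in>UNIV. norm (e j))"
proof -
  have "sq_disagreement e \<le> (\<Sum>q\<in>UNIV. \<Sum>j\<in>UNIV. (e j $ q)\<^sup>2)"
    unfolding sq_disagreement_coords
  proof (intro sum_mono)
    fix q show "sq_disagreement (\<lambda>i. e i $ q) \<le> (\<Sum>j\<in>UNIV. (e j $ q)\<^sup>2)"
      using sq_disagreement_shift[of "\<lambda>i. e i $ q" 0] by simp
  qed
  also have "\<dots> = (\<Sum>j\<in>UNIV. (norm (e j))\<^sup>2)" by (subst sum.swap) (simp add: norm_sq_vec)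
  finally have "disagreement e \<le> L2_set (\<lambda>j. norm (e j)) UNIV"
    unfolding disagreement_def L2_set_def by (rule real_sqrt_le_mono)
  also have "\<dots> \<le> (\<Sum>j\<in>UNIV. norm (e j))" by (rule L2_set_le_sum) simp
  finally show ?thesis .
qed

text \<open>Each power of \<open>q\<close> occurs \<open>B\<close> times, since the contraction is guaranteed once per block only.\<close>

lemma sum_geometric_blocks_le:
  fixes q :: real
  assumes q: "0 \<le> q" "q < 1" and "0 < B"
  shows "(\<Sum>k<n. q ^ (k div B)) \<le> real B / (1 - q)"
proof -
  have "(\<Sum>k<n. q ^ (k div B)) \<le> (\<Sum>k<n * B. q ^ (k div B))"
    using assms by (intro sum_mono2) auto
  also have "\<dots> = (\<Sum>m<n. \<Sum>k=m * B..<m * B + B. q ^ (k div B))"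
    by (rule sum.nat_group[symmetric])
  also have "\<dots> = (\<Sum>m<n. real B * q ^ m)"
  proof (rule sum.cong[OF refl])
    fix m
    have "(\<Sum>k=m * B..<m * B + B. q ^ (k div B)) = (\<Sum>k=m * B..<m * B + B. q ^ m)"
    proof (rule sum.cong[OF refl])
      fix k assume "k \<in> {m * B..<m * B + B}"
      then have "k div B = m" by (intro div_nat_eqI) (auto simp: mult.commute add.commute)
      then show "q ^ (k div B) = q ^ m" by simp
    qed
    then show "(\<Sum>k=m * B..<m * B + B. q ^ (k div B)) = real B * q ^ m" by simp
  qed
  also have "\<dots> = real B * ((1 - q ^ n) / (1 - q))"
    using q by (simp add: sum_distrib_left[symmetric] sum_gp_strict)
  also have "\<dots> \<le> real B * (1 / (1 - q))"
    using q by (intro mult_left_mono divide_right_mono) auto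
  finally show ?thesis by simp
qed

text \<open>Every displacement enters all later disagreements with geometrically decreasing weights. Summed over
  time it counts at most \<open>B / (1 - q)\<close> times, where \<open>q = 1 - \<zeta> / (16 N\<^sup>2)\<close>.\<close>

lemma sum_disagreement_le:
  fixes x :: "nat \<Rightarrow> 'v::finite \<Rightarrow> real^'n"
  assumes net: "network E P B \<zeta>"
    and "\<And>i. x 0 i = 0" "\<And>t i. x (Suc t) i = (\<Sum>j\<in>UNIV. P t $ i $ j *\<^sub>R x t j) + e t i"
  shows "(\<Sum>t=1..T. disagreement (x t))
    \<le> 16 * real B * (real CARD('v))\<^sup>2 / \<zeta> * (\<Sum>s<T. \<Sum>j\<in>UNIV. norm (e s j))"
proof -
  let ?r = "\<lambda>t s. mixing_run (\<lambda>k. P (Suc s + k)) (t - Suc s) (e s)"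
  let ?N = "real CARD('v)"
  define q where "q = 1 - \<zeta> / (16 * ?N\<^sup>2)"
  define d where "d s = (\<Sum>j\<in>UNIV. norm (e s j))" for s
  have \<zeta>: "0 < \<zeta>" "\<zeta> < 1" and B: "0 < B" using net by (auto simp: network_def)
  have N1: "1 \<le> ?N\<^sup>2" by (simp add: Suc_leI)
  have "\<zeta> \<le> 16 * ?N\<^sup>2" using \<zeta> N1 by linarith
  then have q: "0 \<le> q" "q < 1" using \<zeta> by (auto simp: q_def divide_le_eq)
  have bound: "disagreement (x t) \<le> (\<Sum>s<t. q ^ ((t - Suc s) div B) * d s)" for t
  proof -
    have "x t = (\<lambda>i. \<Sum>s<t. ?r t s i)"
      using mixing_run_expansion[where x = x and P = P and e = e and t = t] assms(2,3) by blast
    then have "disagreement (x t) \<le> (\<Sum>s<t. disagreement (?r t s))"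
      using disagreement_sum[where n = t and x = "\<lambda>s. ?r t s"] by simp
    also have "\<dots> \<le> (\<Sum>s<t. q ^ ((t - Suc s) div B) * disagreement (e s))"
      unfolding q_def by (intro sum_mono disagreement_run[OF net])
    also have "\<dots> \<le> (\<Sum>s<t. q ^ ((t - Suc s) div B) * d s)"
      using q unfolding d_def by (intro sum_mono mult_left_mono disagreement_le_sum_norm) auto
    finally show ?thesis .
  qed
  have "(\<Sum>t=1..T. disagreement (x t)) \<le> (\<Sum>t=1..T. \<Sum>s<t. q ^ ((t - Suc s) div B) * d s)"
    by (intro sum_mono bound)
  also have "\<dots> = (\<Sum>s<T. \<Sum>t=Suc s..T. q ^ ((t - Suc s) div B) * d s)"
    unfolding sum.Sigma[OF finite_atLeastAtMost ballI[OF finite_lessThan]] sum.Sigma[OF finite_lessThan ballI[OF finite_atLeastAtMost]]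
    by (rule sum.reindex_bij_witness[where i = "\<lambda>(s, t). (t, s)" and j = "\<lambda>(t, s). (s, t)"]) auto
  also have "\<dots> \<le> (\<Sum>s<T. real B / (1 - q) * d s)"
  proof (intro sum_mono)
    fix s assume "s \<in> {..<T}"
    have "(\<Sum>t=Suc s..T. q ^ ((t - Suc s) div B) * d s) = (\<Sum>k<T - s. q ^ (k div B)) * d s"
      unfolding sum_distrib_right
      by (rule sum.reindex_bij_witness[where i = "\<lambda>k. k + Suc s" and j = "\<lambda>t. t - Suc s"])
         (use \<open>s \<in> {..<T}\<close> in auto)
    also have "\<dots> \<le> real B / (1 - q) * d s"
      using sum_geometric_blocks_le[OF q B] by (intro mult_right_mono) (auto simp: d_def sum_nonneg)
    finally show "(\<Sum>t=Suc s..T. q ^ ((t - Suc s) div B) * d s) \<le> real B / (1 - q) * d s" .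
  qed
  also have "\<dots> = 16 * real B * ?N\<^sup>2 / \<zeta> * (\<Sum>s<T. d s)"
  proof -
    have "real B / (1 - q) = 16 * real B * ?N\<^sup>2 / \<zeta>" by (simp add: q_def)
    then show ?thesis by (simp only: sum_distrib_left)
  qed
  finally show ?thesis by (simp add: d_def)
qed

lemma norm_diff_consensus_le:
  fixes x :: "'v::finite \<Rightarrow> real^'n"
  assumes A: "doubly_stochastic A"
  shows "norm (x l - consensus A x i) \<le> 2 * disagreement x"
proof -
  have mean: "agent_mean (consensus A x) = agent_mean x"
    using sum_doubly_stochastic[OF A, of x] by (simp add: agent_mean_def consensus_def)
  have member: "norm (z k - agent_mean z) \<le> disagreement z" for z :: "'v \<Rightarrow> real^'n" and k
    unfolding disagreement_conv_L2_set by (rule member_le_L2_set) auto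
  have "norm (x l - consensus A x i) \<le> norm (x l - agent_mean x) + norm (consensus A x i - agent_mean (consensus A x))"
    unfolding mean using norm_triangle_ineq4[of "x l - agent_mean x" "consensus A x i - agent_mean x"] by simp
  also have "\<dots> \<le> disagreement x + disagreement (consensus A x)" by (intro add_mono member)
  also have "disagreement (consensus A x) \<le> disagreement x"
    using disagreement_step_le[OF A, of x] by (simp add: consensus_def[abs_def])
  finally show ?thesis by simp
qed

section \<open>Constants and step sizes\<close>

text \<open>With \<open>q = 1 - \<zeta> / (4 N\<^sup>2)\<close>, the bounds \<open>exp x \<ge> 1 + x\<close> and \<open>ln q \<ge> 1 - 1 / q\<close> give
  \<open>1 - q powr (1 / B) \<le> (1 - q) / (q B)\<close>, which removes the root from the constant.\<close>

lemma mix_const_ratio_ge: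
  assumes "0 < \<zeta>" "\<zeta> < 1" "0 < N" "0 < B"
  shows "4 * real B * (real N)\<^sup>2 / \<zeta> \<le> mix_const N \<zeta> / (1 - mix_rate N \<zeta> B)" and "mix_rate N \<zeta> B < 1"
proof -
  define q where "q = 1 - \<zeta> / (4 * real N ^ 2)"
  have "1 \<le> (real N)\<^sup>2" using \<open>0 < N\<close> by (simp add: Suc_leI)
  then have "\<zeta> < 4 * (real N)\<^sup>2" using assms by linarith
  then have q: "0 < q" "q < 1" using assms by (auto simp: q_def)
  have lnq: "1 - 1 / q \<le> ln q" using ln_le_minus_one[of "1 / q"] q by (simp add: ln_div)
  have "1 + ln q / real B \<le> exp (ln q / real B)" by (rule exp_ge_add_one_self)
  also have "\<dots> = mix_rate N \<zeta> B" using q by (simp add: mix_rate_def q_def[symmetric] powr_def)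
  finally have "1 - mix_rate N \<zeta> B \<le> - ln q / real B" by simp
  also have "\<dots> \<le> (1 / q - 1) / real B" using lnq by (intro divide_right_mono) auto
  also have "1 / q - 1 = (1 - q) / q" using q by (simp add: diff_divide_distrib)
  also have "(1 - q) / q / real B = (1 - q) / (q * real B)" by simp
  finally have up: "1 - mix_rate N \<zeta> B \<le> (1 - q) / (q * real B)" .
  show lt: "mix_rate N \<zeta> B < 1"
    unfolding mix_rate_def q_def[symmetric] using powr_less_mono2[of "1 / real B" q 1] q assms by simp
  have "4 * real B * (real N)\<^sup>2 / \<zeta> = real B / (1 - q)" using assms by (simp add: q_def)
  also have "\<dots> \<le> real B / (1 - q) / q"
    unfolding pos_le_divide_eq[OF q(1)] using q by (intro mult_left_le) auto
  also have "\<dots> = 1 / q\<^sup>2 / ((1 - q) / (q * real B))" using q by (simp add: power2_eq_square)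
  also have "\<dots> \<le> 1 / q\<^sup>2 / (1 - mix_rate N \<zeta> B)" using up lt q \<open>0 < B\<close>
    by (intro divide_left_mono mult_pos_pos divide_pos_pos) auto
  also have "1 / q\<^sup>2 = mix_const N \<zeta>"
    unfolding mix_const_def q_def[symmetric] using q by (simp add: powr_neg_numeral)
  finally show "4 * real B * (real N)\<^sup>2 / \<zeta> \<le> mix_const N \<zeta> / (1 - mix_rate N \<zeta> B)" .
qed

text \<open>The left-hand side is the bound on the disagreement that the contraction yields, apart from the sum
  of the step sizes; the elementary \<open>4 n \<le> (n + 4)\<^sup>2\<close> makes up for the weaker contraction rate.\<close>

lemma C_tilde_ge:
  assumes "0 < \<zeta>" "\<zeta> < 1" "0 < N" "0 < B" "0 < \<sigma>"
  shows "2 * (16 * real B * (real N)\<^sup>2 / \<zeta>) * (real N * (real n * Lh\<^sup>2 / \<sigma>)) \<le> C_tilde N n Lh \<sigma> \<zeta> B"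
proof -
  let ?k = "4 * real B * (real N)\<^sup>2 / \<zeta>" and ?r = "mix_const N \<zeta> / (1 - mix_rate N \<zeta> B)"
  have k0: "0 \<le> ?k" using assms by simp
  have "0 \<le> (real n - 4)\<^sup>2" by simp
  then have n: "4 * real n \<le> (real n + 4)\<^sup>2" by (simp add: power2_eq_square algebra_simps)
  have "2 * (16 * real B * (real N)\<^sup>2 / \<zeta>) * (real N * (real n * Lh\<^sup>2 / \<sigma>))
      = 2 * real N * (4 * real n) * ?k * Lh\<^sup>2 / \<sigma>" by (simp add: field_simps)
  also have "\<dots> \<le> 2 * real N * (real n + 4)\<^sup>2 * ?r * Lh\<^sup>2 / \<sigma>"
    using n mix_const_ratio_ge(1)[OF assms(1-4)] k0 assms(5)
    by (intro divide_right_mono mult_right_mono mult_mono) auto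
  also have "\<dots> = C_tilde N n Lh \<sigma> \<zeta> B - 4 * (real n + 4)^2 * Lh^2 / \<sigma>"
    by (simp add: C_tilde_def)
  also have "\<dots> \<le> C_tilde N n Lh \<sigma> \<zeta> B" using assms by simp
  finally show ?thesis .
qed

lemma powr_diff_le:
  fixes a b \<delta> :: real
  assumes "0 < a" "a < b"
  shows "0 \<le> \<delta> \<Longrightarrow> b powr (1 + \<delta>) - a powr (1 + \<delta>) \<le> (1 + \<delta>) * b powr \<delta> * (b - a)"
    and "\<delta> \<le> 0 \<Longrightarrow> -1 \<le> \<delta> \<Longrightarrow> (1 + \<delta>) * b powr \<delta> * (b - a) \<le> b powr (1 + \<delta>) - a powr (1 + \<delta>)"
proof -
  have "\<exists>z. a < z \<and> z < b \<and> b powr (1 + \<delta>) - a powr (1 + \<delta>) = (b - a) * ((1 + \<delta>) * z powr \<delta>)"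
    using assms by (intro MVT2) (auto intro!: derivative_eq_intros)
  then obtain z where z: "a < z" "z < b"
    and eq: "b powr (1 + \<delta>) - a powr (1 + \<delta>) = (b - a) * ((1 + \<delta>) * z powr \<delta>)" by blast
  show "b powr (1 + \<delta>) - a powr (1 + \<delta>) \<le> (1 + \<delta>) * b powr \<delta> * (b - a)" if "0 \<le> \<delta>"
  proof -
    have "z powr \<delta> \<le> b powr \<delta>" using z assms that by (intro powr_mono2) auto
    then show ?thesis unfolding eq using that assms by (simp add: mult.commute mult_left_mono)
  qed
  show "(1 + \<delta>) * b powr \<delta> * (b - a) \<le> b powr (1 + \<delta>) - a powr (1 + \<delta>)" if "\<delta> \<le> 0" "-1 \<le> \<delta>"
  proof -
    have "b powr \<delta> \<le> z powr \<delta>" using z assms that by (intro powr_mono2') auto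
    then show ?thesis unfolding eq using that assms by (simp add: mult.commute mult_left_mono)
  qed
qed

text \<open>Up to the factor \<open>1 / \<rho>\<close>, the sum dominates the integral of \<open>s powr \<delta>\<close> from \<open>1\<close> to \<open>T + 1\<close>. The condition on \<open>p\<close> says that, for
  \<open>T \<ge> 1\<close>, cutting off the part below \<open>1\<close> leaves at least a fraction \<open>p\<close> of the integral from \<open>0\<close>.\<close>

lemma sum_inverse_stepsize_ge:
  assumes \<delta>: "0 < \<delta>" and "0 < \<rho>" and p: "0 < p" "p \<le> 1 - 1 / 2 powr (1 + \<delta>)" and "1 \<le> T"
  shows "p * (real T + 1) powr (1 + \<delta>) / (\<rho> * (1 + \<delta>)) \<le> (\<Sum>t=1..T. 1 / stepsize \<rho> \<delta> t)"
proof -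
  have int: "((real T + 1) powr (1 + \<delta>) - 1) / (1 + \<delta>) \<le> (\<Sum>t=1..T. (real t + 1) powr \<delta>)" for T
  proof (induction T)
    case (Suc T)
    have "(real (Suc T) + 1) powr (1 + \<delta>) - (real T + 1) powr (1 + \<delta>) \<le> (1 + \<delta>) * (real (Suc T) + 1) powr \<delta>"
      using powr_diff_le(1)[of "real T + 1" "real (Suc T) + 1" \<delta>] \<delta> by simp
    then have "((real (Suc T) + 1) powr (1 + \<delta>) - (real T + 1) powr (1 + \<delta>)) / (1 + \<delta>) \<le> (real (Suc T) + 1) powr \<delta>"
      using \<delta> by (simp add: divide_le_eq mult.commute)
    then show ?case using Suc by (simp add: diff_divide_distrib)
  qed simp
  have "2 powr (1 + \<delta>) \<le> (real T + 1) powr (1 + \<delta>)" using \<delta> \<open>1 \<le> T\<close> by (intro powr_mono2) auto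
  then have "1 \<le> 1 / 2 powr (1 + \<delta>) * (real T + 1) powr (1 + \<delta>)" by (simp add: le_divide_eq)
  also have "\<dots> \<le> (1 - p) * (real T + 1) powr (1 + \<delta>)" using p by (intro mult_right_mono) auto
  finally have "p * (real T + 1) powr (1 + \<delta>) \<le> (real T + 1) powr (1 + \<delta>) - 1" by (simp add: algebra_simps)
  then have "p * (real T + 1) powr (1 + \<delta>) / (1 + \<delta>) \<le> ((real T + 1) powr (1 + \<delta>) - 1) / (1 + \<delta>)"
    using \<delta> by (intro divide_right_mono) auto
  also note int[of T]
  finally have "p * (real T + 1) powr (1 + \<delta>) / (1 + \<delta>) / \<rho> \<le> (\<Sum>t=1..T. (real t + 1) powr \<delta>) / \<rho>"
    using \<open>0 < \<rho>\<close> by (intro divide_right_mono) auto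
  also have "\<dots> = (\<Sum>t=1..T. 1 / stepsize \<rho> \<delta> t)"
    unfolding sum_divide_distrib by (intro sum.cong) (auto simp: stepsize_def)
  finally show ?thesis by (simp add: mult.commute)
qed

lemma sum_stepsize_le:
  assumes \<delta>: "0 < \<delta>" "\<delta> < 1" and "0 < \<rho>" and "1 \<le> T"
  shows "(\<Sum>s<T. stepsize \<rho> \<delta> s) \<le> 1 + \<rho> / (1 - \<delta>) * real T powr (1 - \<delta>)"
  using \<open>1 \<le> T\<close>
proof (induction T rule: dec_induct)
  case base
  then show ?case using assms by (simp add: stepsize_def)
next
  case (step T)
  have "(1 - \<delta>) * (real T + 1) powr (- \<delta>) \<le> (real T + 1) powr (1 - \<delta>) - real T powr (1 - \<delta>)"
    using powr_diff_le(2)[of "real T" "real T + 1" "- \<delta>"] \<delta> step(1) by simp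
  then have "\<rho> / (1 - \<delta>) * ((1 - \<delta>) * (real T + 1) powr (- \<delta>))
      \<le> \<rho> / (1 - \<delta>) * ((real T + 1) powr (1 - \<delta>) - real T powr (1 - \<delta>))"
    using assms by (intro mult_left_mono) auto
  moreover have "stepsize \<rho> \<delta> T = \<rho> / (1 - \<delta>) * ((1 - \<delta>) * (real T + 1) powr (- \<delta>))"
    using step(1) \<delta> by (simp add: stepsize_def powr_minus divide_inverse)
  ultimately show ?case using step.IH by (simp add: right_diff_distrib add.commute)
qed

text \<open>Summation by parts with nondecreasing weights, in a form suited to induction on \<open>T\<close>.\<close>

lemma abel_sum_le:
  fixes b D :: "nat \<Rightarrow> real"
  assumes mono: "\<And>t. 1 \<le> t \<Longrightarrow> b t \<le> b (Suc t)" and b0: "\<And>t. 1 \<le> t \<Longrightarrow> 0 \<le> b t"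
    and D: "\<And>t. 0 \<le> D t" "\<And>t. D t \<le> K" and "1 \<le> T"
  shows "(\<Sum>t=1..T. b t * (D t - D (Suc t))) \<le> b T * K"
proof -
  have "(\<Sum>t=1..T. b t * (D t - D (Suc t))) \<le> b T * (K - D (Suc T))"
    using \<open>1 \<le> T\<close>
  proof (induction T rule: dec_induct)
    case base
    show ?case using b0[of 1] D(2)[of 1] by (simp add: mult_left_mono)
  next
    case (step T)
    have "b T * (K - D (Suc T)) \<le> b (Suc T) * (K - D (Suc T))"
      using mono[of T] step(1) D(2)[of "Suc T"] by (intro mult_right_mono) auto
    then show ?case using step.IH by (simp add: algebra_simps)
  qed
  also have "\<dots> \<le> b T * K" using b0[OF \<open>1 \<le> T\<close>] D(1)[of "Suc T"] by (intro mult_left_mono) auto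
  finally show ?thesis .
qed

text \<open>Divides the weighted bound by the sum of the weights. The two halves of \<open>C\<close> are exactly the factors
  that arise in front of \<open>(T + 1) powr (\<delta> - 1)\<close> and \<open>(T + 1) powr (- \<delta>)\<close>.\<close>

lemma rate_from_weighted_bound:
  fixes N n T :: nat and gap R \<delta> \<rho> p d Lh \<sigma> \<zeta> A :: real and B :: nat
  defines "C \<equiv> C_delta N n Lh \<sigma> \<zeta> B d \<delta> \<rho> p"
    and "W \<equiv> (\<Sum>t=1..T. 1 / stepsize \<rho> \<delta> t)"
  assumes \<delta>: "0 < \<delta>" "\<delta> < 1" and \<rho>: "0 < \<rho>" and p: "0 < p" "p \<le> 1 - 1 / 2 powr (1 + \<delta>)" and T: "1 \<le> T"
    and \<sigma>: "0 < \<sigma>" and Ct: "0 \<le> C_tilde N n Lh \<sigma> \<zeta> B"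
    and main: "gap * W \<le> R * W + d\<^sup>2 / (stepsize \<rho> \<delta> T)\<^sup>2 + real T * ((real n + 4)\<^sup>2 * Lh\<^sup>2 / (2 * \<sigma>))
      + C_tilde N n Lh \<sigma> \<zeta> B * (\<Sum>s<T. stepsize \<rho> \<delta> s) / stepsize \<rho> \<delta> T"
  shows "gap \<le> R + C * real T powr (\<delta> - 1) + C * real T powr (- \<delta>)" and "0 \<le> C"
proof -
  let ?C1 = "C_delta1 d \<delta> \<rho> p"
  let ?C2 = "C_delta2 N n Lh \<sigma> \<zeta> B \<delta> \<rho> p"
  let ?a = "stepsize \<rho> \<delta>"
  let ?S = "real T + 1"
  let ?Ct = "C_tilde N n Lh \<sigma> \<zeta> B"
  let ?A = "(real n + 4)\<^sup>2 * Lh\<^sup>2 / (2 * \<sigma>)"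
  let ?w = "p * ?S powr (1 + \<delta>) / (\<rho> * (1 + \<delta>))"
  define Q where "Q = ?A + ?Ct * (\<rho> + 1 - \<delta>) / (\<rho> * (1 - \<delta>))"
  have S1: "1 \<le> ?S" by simp
  have w0: "0 < ?w" using p \<rho> \<delta> by simp
  have W: "?w \<le> W" unfolding W_def by (rule sum_inverse_stepsize_ge) (use assms in auto)
  have W0: "0 < W" using w0 W by linarith
  have step: "?a T = \<rho> / ?S powr \<delta>" using T by (simp add: stepsize_def)
  have Q0: "0 \<le> Q" unfolding Q_def using \<delta> \<rho> \<sigma> Ct by (intro add_nonneg_nonneg divide_nonneg_pos mult_nonneg_nonneg) auto
  have C1: "?C1 = (\<delta> + 1) * d\<^sup>2 / (p * \<rho>)" by (simp add: C_delta1_def)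
  have C1_0: "0 \<le> ?C1" using \<delta> \<rho> p by (simp add: C_delta1_def)
  have C2: "?C2 = Q * (\<rho> * (\<delta> + 1) / p)" by (simp add: C_delta2_def Q_def)
  have C2_0: "0 \<le> ?C2" unfolding C2 using Q0 \<delta> \<rho> p by simp
  have C: "?C1 \<le> C" "?C2 \<le> C" by (auto simp: C_def C_delta_def)
  show "0 \<le> C" using C C1_0 by linarith
  have b1: "d\<^sup>2 / (?a T)\<^sup>2 = ?C1 * ?S powr (\<delta> - 1) * ?w"
  proof -
    have "?S powr (\<delta> - 1) * ?S powr (1 + \<delta>) = (?S powr \<delta>)\<^sup>2"
      by (simp add: powr_add[symmetric] power2_eq_square)
    then have "?C1 * ?S powr (\<delta> - 1) * ?w
        = (1 + \<delta>) * d\<^sup>2 / (p * \<rho>) * p / (\<rho> * (1 + \<delta>)) * (?S powr \<delta>)\<^sup>2"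
      unfolding C1 by (simp add: mult.assoc mult.left_commute add.commute)
    also have "(1 + \<delta>) * d\<^sup>2 / (p * \<rho>) * p / (\<rho> * (1 + \<delta>)) = d\<^sup>2 / \<rho>\<^sup>2"
      using p \<rho> \<delta> by (simp add: power2_eq_square)
    finally show ?thesis unfolding step by (simp add: power_divide)
  qed
  have b2: "real T * ?A + ?Ct * (\<Sum>s<T. ?a s) / ?a T
      \<le> ?C2 * ?S powr (- \<delta>) * ?w"
  proof -
    have "(\<Sum>s<T. ?a s) \<le> 1 + \<rho> / (1 - \<delta>) * real T powr (1 - \<delta>)"
      by (rule sum_stepsize_le) (use assms in auto)
    also have "\<dots> \<le> ?S powr (1 - \<delta>) + \<rho> / (1 - \<delta>) * ?S powr (1 - \<delta>)"
      using \<delta> \<rho> S1 by (intro add_mono mult_left_mono powr_mono2 ge_one_powr_ge_zero) auto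
    also have "\<dots> = (\<rho> + 1 - \<delta>) / (1 - \<delta>) * ?S powr (1 - \<delta>)"
      using \<delta> by (simp add: field_simps)
    finally have "(\<Sum>s<T. ?a s) / ?a T
        \<le> ((\<rho> + 1 - \<delta>) / (1 - \<delta>) * ?S powr (1 - \<delta>)) / ?a T"
      unfolding step using \<rho> by (intro divide_right_mono) auto
    also have "\<dots> = (\<rho> + 1 - \<delta>) / (\<rho> * (1 - \<delta>)) * (?S powr (1 - \<delta>) * ?S powr \<delta>)"
      unfolding step using \<rho> \<delta> by (simp add: mult_ac)
    also have "?S powr (1 - \<delta>) * ?S powr \<delta> = ?S" by (simp add: powr_add[symmetric])
    finally have "?Ct * ((\<Sum>s<T. ?a s) / ?a T)
        \<le> ?Ct * ((\<rho> + 1 - \<delta>) / (\<rho> * (1 - \<delta>)) * ?S)"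
      using Ct by (intro mult_left_mono)
    moreover have "real T * ?A \<le> ?S * ?A" using \<sigma> by (intro mult_right_mono) auto
    ultimately have "real T * ?A + ?Ct * (\<Sum>s<T. ?a s) / ?a T \<le> Q * ?S"
      by (simp add: Q_def algebra_simps)
    also have "Q * ?S = ?C2 * ?S powr (- \<delta>) * ?w"
    proof -
      have "?S powr (- \<delta>) * ?S powr (1 + \<delta>) = ?S" by (simp add: powr_add[symmetric])
      then have "?C2 * ?S powr (- \<delta>) * ?w
          = Q * (\<rho> * (\<delta> + 1) / p) * (p * ?S / (\<rho> * (1 + \<delta>)))"
        unfolding C2 by (simp add: mult.assoc mult.left_commute)
      also have "\<dots> = Q * ?S"
      proof -
        have "1 + \<delta> \<noteq> 0" using \<delta> by simp
        then show ?thesis using \<rho> p by (simp add: add.commute[of \<delta> 1])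
      qed
      finally show ?thesis by simp
    qed
    finally show ?thesis .
  qed
  define K where "K = ?C1 * ?S powr (\<delta> - 1) + ?C2 * ?S powr (- \<delta>)"
  have K0: "0 \<le> K" unfolding K_def using C1_0 C2_0 by simp
  have "gap * W \<le> R * W + K * ?w" 
    unfolding K_def distrib_right b1[symmetric] using main b2 by (simp only: add.assoc add_left_mono)
  also have "\<dots> \<le> R * W + K * W" using W K0 by (intro add_left_mono mult_left_mono)
  finally have "gap * W \<le> (R + K) * W" by (simp add: distrib_right)
  then have "gap \<le> R + K" using W0 by simp
  also have "K \<le> C * real T powr (\<delta> - 1) + C * real T powr (- \<delta>)"
    unfolding K_def using C C1_0 C2_0 \<delta> T by (intro add_mono mult_mono powr_mono2') auto
  finally show "gap \<le> R + C * real T powr (\<delta> - 1) + C * real T powr (- \<delta>)" by simp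
qed

section \<open>The random iteration\<close>

locale gradient_free_mirror_descent =
  bregman_domain X U \<sigma> \<phi> + prob_space M
  for X U :: "(real^'n) set" and \<sigma> \<phi> and M :: "'w measure" +
  fixes E :: "nat \<Rightarrow> ('v::finite \<times> 'v) set" and P :: "nat \<Rightarrow> real^'v^'v" and B :: nat and \<zeta> :: real
    and f :: "'v \<Rightarrow> real^'n \<Rightarrow> real" and Lh :: real and \<mu> :: "'v \<Rightarrow> real"
    and \<alpha> :: "nat \<Rightarrow> real" and \<xi> :: "nat \<Rightarrow> 'v \<Rightarrow> 'w \<Rightarrow> real^'n"
  assumes net: "network E P B \<zeta>"
    and zero_in_X: "0 \<in> X"
    and f_convex: "\<And>i. convex_on UNIV (f i)"
    and f_lipschitz: "\<And>i. Lh-lipschitz_on UNIV (f i)"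
    and \<mu>_pos: "\<And>i. 0 < \<mu> i"
    and \<alpha>_pos: "\<And>t. 0 < \<alpha> t"
    and noise_distr: "\<And>t i. distributed M lborel (\<xi> t i) (\<lambda>z. ennreal (std_gaussian_density z))"
    and noise_indep: "indep_vars (\<lambda>_. borel) (\<lambda>(t, i). \<xi> t i) (UNIV :: (nat \<times> 'v) set)"
begin

text \<open>The iteration as a deterministic function of the whole noise sequence, so that its dependence on the past
  noise only is a statement about functions (\<open>trajectory_cong\<close>) and independence can be read off.\<close>

primrec trajectory :: "nat \<Rightarrow> (nat \<times> 'v \<Rightarrow> real^'n) \<Rightarrow> 'v \<Rightarrow> real^'n" where
  "trajectory 0 z = (\<lambda>i. 0)"
| "trajectory (Suc t) z = (\<lambda>i. let y = consensus (P t) (trajectory t z) i in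
     prox (\<alpha> t *\<^sub>R gf_oracle (f i) (\<mu> i) y (z (t, i)) - gradient \<phi> y))"

definition noise :: "'w \<Rightarrow> nat \<times> 'v \<Rightarrow> real^'n" where
  "noise \<omega> = (\<lambda>(t, i). \<xi> t i \<omega>)"

definition iterate :: "nat \<Rightarrow> 'v \<Rightarrow> 'w \<Rightarrow> real^'n" where
  "iterate t i \<omega> = trajectory t (noise \<omega>) i"

definition mixed :: "nat \<Rightarrow> 'v \<Rightarrow> 'w \<Rightarrow> real^'n" where
  "mixed t i \<omega> = consensus (P t) (trajectory t (noise \<omega>)) i"

definition grad :: "nat \<Rightarrow> 'v \<Rightarrow> 'w \<Rightarrow> real^'n" where
  "grad t i \<omega> = gf_oracle (f i) (\<mu> i) (mixed t i \<omega>) (\<xi> t i \<omega>)"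

lemma P_stochastic: "doubly_stochastic (P t)" and \<zeta>: "0 < \<zeta>" "\<zeta> < 1" and B_pos: "0 < B"
  using net by (auto simp: network_def)

lemma P_row: "0 \<le> P t $ i $ j" "(\<Sum>j\<in>UNIV. P t $ i $ j) = 1"
  using P_stochastic[of t] by (auto simp: doubly_stochastic_def)

lemma Lh_nonneg: "0 \<le> Lh"
  using f_lipschitz[of undefined] by (rule lipschitz_on_nonneg)

lemma consensus_in_X: "(\<And>j. u j \<in> X) \<Longrightarrow> consensus (P t) u i \<in> X"
  unfolding consensus_def using P_row by (intro convex_sum convex_X) auto

lemma trajectory_in_X: "trajectory t z i \<in> X"
  by (cases t) (simp_all add: Let_def zero_in_X prox_in_X)

lemma iterate_in_X: "iterate t i \<omega> \<in> X" by (simp add: iterate_def trajectory_in_X)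

lemma mixed_in_X: "mixed t i \<omega> \<in> X" by (simp add: mixed_def consensus_in_X trajectory_in_X)

lemma iterate_0: "iterate 0 i \<omega> = 0" by (simp add: iterate_def)

lemma iterate_Suc: "iterate (Suc t) i \<omega> = prox (\<alpha> t *\<^sub>R grad t i \<omega> - gradient \<phi> (mixed t i \<omega>))"
  by (simp add: iterate_def mixed_def grad_def noise_def Let_def)

lemma mixed_conv_iterate: "mixed t i \<omega> = consensus (P t) (\<lambda>j. iterate t j \<omega>) i"
  by (simp add: mixed_def iterate_def)

text \<open>The minimizer in each round is unique, so any sample path of the algorithm is the constructed one.\<close>

lemma drgfmd_eq_iterate:
  assumes "drgfmd X \<phi> f P \<mu> \<alpha> (\<lambda>t i. \<xi> t i \<omega>) u"
  shows "u t i = iterate t i \<omega>"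
proof (induction t arbitrary: i)
  case 0 then show ?case using assms by (simp add: drgfmd_def iterate_0)
next
  case (Suc t)
  then have u: "u t = (\<lambda>j. iterate t j \<omega>)" by auto
  have "is_arg_min (\<lambda>w. \<alpha> t * (grad t i \<omega> \<bullet> w) + bregman \<phi> w (mixed t i \<omega>)) (\<lambda>w. w \<in> X) (u (Suc t) i)"
    using assms unfolding drgfmd_def Let_def grad_def mixed_conv_iterate u[symmetric] by blast
  then show ?case unfolding mirror_step_iff iterate_Suc .
qed

lemma trajectory_cong:
  "(\<And>s j. s < t \<Longrightarrow> z (s, j) = z' (s, j)) \<Longrightarrow> trajectory t z = trajectory t z'"
proof (induction t)
  case (Suc t)
  then have "trajectory t z = trajectory t z'" by auto
  then show ?case using Suc.prems by (simp add: Let_def)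
qed simp

lemma f_measurable [measurable]: "f i \<in> borel_measurable borel"
  using lipschitz_on_continuous_on[OF f_lipschitz] by (rule borel_measurable_continuous_onI)

lemma prox_measurable [measurable]: "prox \<in> borel_measurable borel"
  using continuous_on_prox by (rule borel_measurable_continuous_onI)

lemma X_borel [measurable]: "X \<in> sets borel" using compact_X by (rule borel_compact)

lemma measurable_comp_X:
  fixes h :: "real^'n \<Rightarrow> 'b::{second_countable_topology, real_normed_vector}"
  assumes [measurable]: "u \<in> borel_measurable N" and "\<And>\<omega>. u \<omega> \<in> X" and "continuous_on X h"
  shows "(\<lambda>\<omega>. h (u \<omega>)) \<in> borel_measurable N"
proof -
  have [measurable]: "(\<lambda>v. indicator X v *\<^sub>R h v) \<in> borel_measurable borel"
    using assms(3) by (intro borel_measurable_continuous_on_indicator) auto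
  have "(\<lambda>\<omega>. indicator X (u \<omega>) *\<^sub>R h (u \<omega>)) \<in> borel_measurable N" by measurable
  then show ?thesis using assms(2) by simp
qed

lemma gradient_continuous_on_X: "continuous_on X (gradient \<phi>)"
  by (rule continuous_on_subset[OF continuous_on_gradient XU])

lemma gf_oracle_measurable [measurable]:
  assumes [measurable]: "u \<in> borel_measurable N" "z \<in> borel_measurable N"
  shows "(\<lambda>\<omega>. gf_oracle (f i) (\<mu> i) (u \<omega>) (z \<omega>)) \<in> borel_measurable N"
  unfolding gf_oracle_def by measurable

lemma trajectory_measurable:
  "{(s, j). s < t} \<subseteq> A \<Longrightarrow> (\<lambda>z. trajectory t z i) \<in> borel_measurable (PiM A (\<lambda>_. borel))"
proof (induction t arbitrary: i)
  case (Suc t)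
  then have "{(s, j). s < t} \<subseteq> A" by auto
  note [measurable] = Suc.IH[OF this]
  have "(t, i) \<in> A" using Suc.prems by auto
  then have [measurable]: "(\<lambda>z. z (t, i)) \<in> borel_measurable (PiM A (\<lambda>_. borel))"
    by (rule measurable_component_singleton)
  have mixed[measurable]: "(\<lambda>z. consensus (P t) (trajectory t z) i) \<in> borel_measurable (PiM A (\<lambda>_. borel))"
    unfolding consensus_def by measurable
  have [measurable]: "(\<lambda>z. gradient \<phi> (consensus (P t) (trajectory t z) i)) \<in> borel_measurable (PiM A (\<lambda>_. borel))"
    by (rule measurable_comp_X[OF mixed _ gradient_continuous_on_X]) (intro consensus_in_X trajectory_in_X)
  show ?case unfolding trajectory.simps Let_def by measurable
qed simp

lemma noise_measurable [measurable]: "\<xi> t i \<in> borel_measurable M"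
  using noise_distr[of t i] by (auto simp: distributed_def)

lemma noise_measurable_PiM: "noise \<in> M \<rightarrow>\<^sub>M PiM UNIV (\<lambda>_. borel)"
  unfolding noise_def by (rule measurable_PiM_single') (auto simp: space_PiM)

lemma iterate_measurable [measurable]: "iterate t i \<in> borel_measurable M"
  unfolding iterate_def[abs_def] using measurable_compose[OF noise_measurable_PiM trajectory_measurable[of t UNIV i]] by simp

lemma mixed_measurable [measurable]: "mixed t i \<in> borel_measurable M"
  unfolding mixed_conv_iterate[abs_def] consensus_def by measurable

lemma grad_measurable [measurable]: "grad t i \<in> borel_measurable M"
  unfolding grad_def[abs_def] by measurable

lemma distr_noise: "distr M borel (\<xi> t i) = std_gaussian"
proof -
  have "distr M borel (\<xi> t i) = distr M lborel (\<xi> t i)" by (rule distr_cong) auto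
  then show ?thesis using noise_distr[of t i] by (simp add: distributed_def std_gaussian_def)
qed

text \<open>The averaged point of round \<open>t\<close> depends on the noise of earlier rounds only.\<close>

lemma mixed_indep_noise: "indep_var borel (mixed t i) borel (\<xi> t i)"
proof -
  let ?A = "{(s, j). s < t}" and ?B = "{(t, i)}"
  let ?r = "\<lambda>C \<omega>. restrict (\<lambda>k. (case k of (s, j) \<Rightarrow> \<xi> s j) \<omega>) C"
  have "indep_var (PiM ?A (\<lambda>_. borel)) (?r ?A)
      (PiM ?B (\<lambda>_. borel)) (?r ?B)"
    by (rule indep_var_restrict[OF noise_indep]) auto
  moreover have "(\<lambda>z. consensus (P t) (trajectory t z) i) \<in> PiM ?A (\<lambda>_. borel) \<rightarrow>\<^sub>M borel"
    unfolding consensus_def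
    by (intro borel_measurable_sum borel_measurable_scaleR borel_measurable_const trajectory_measurable) auto
  moreover have "(\<lambda>z. z (t, i)) \<in> PiM ?B (\<lambda>_. borel) \<rightarrow>\<^sub>M (borel :: (real^'n) measure)"
    by (rule measurable_component_singleton) simp
  ultimately have "indep_var borel ((\<lambda>z. consensus (P t) (trajectory t z) i) \<circ> (?r ?A))
      borel ((\<lambda>z. z (t, i)) \<circ> (?r ?B))"
    by (rule indep_var_compose)
  moreover have "(\<lambda>z. consensus (P t) (trajectory t z) i) \<circ> (?r ?A) = mixed t i"
  proof
    fix \<omega>
    have "trajectory t (?r ?A \<omega>) = trajectory t (noise \<omega>)"
      by (rule trajectory_cong) (simp add: noise_def)
    then show "((\<lambda>z. consensus (P t) (trajectory t z) i) \<circ> (?r ?A)) \<omega> = mixed t i \<omega>"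
      by (simp add: mixed_def)
  qed
  moreover have "(\<lambda>z. z (t, i)) \<circ> (?r ?B) = \<xi> t i"
    by (simp add: fun_eq_iff)
  ultimately show ?thesis by simp
qed

lemma noise_moments:
  "integrable M (\<lambda>\<omega>. (norm (\<xi> t i \<omega>))\<^sup>2)" "expectation (\<lambda>\<omega>. (norm (\<xi> t i \<omega>))\<^sup>2) = real CARD('n)"
  "integrable M (\<lambda>\<omega>. norm (\<xi> t i \<omega>) ^ 4)"
  "expectation (\<lambda>\<omega>. norm (\<xi> t i \<omega>) ^ 4) = real CARD('n) * (real CARD('n) + 2)"
proof -
  have d: "integrable M (\<lambda>\<omega>. h (\<xi> t i \<omega>)) \<longleftrightarrow> integrable std_gaussian h"
    "expectation (\<lambda>\<omega>. h (\<xi> t i \<omega>)) = integral\<^sup>L std_gaussian h"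
    if [measurable]: "h \<in> borel_measurable borel" for h :: "real^'n \<Rightarrow> real"
    unfolding distr_noise[of t i, symmetric] by (simp_all add: integrable_distr_eq integral_distr)
  note m2 = has_bochner_integral_norm_sq[where ?'n = 'n] and m4 = has_bochner_integral_norm_4[where ?'n = 'n]
  show "integrable M (\<lambda>\<omega>. (norm (\<xi> t i \<omega>))\<^sup>2)" "expectation (\<lambda>\<omega>. (norm (\<xi> t i \<omega>))\<^sup>2) = real CARD('n)"
    using d[of "\<lambda>z. (norm z)\<^sup>2"] m2 by (auto simp: has_bochner_integral_iff)
  show "integrable M (\<lambda>\<omega>. norm (\<xi> t i \<omega>) ^ 4)"
    "expectation (\<lambda>\<omega>. norm (\<xi> t i \<omega>) ^ 4) = real CARD('n) * (real CARD('n) + 2)"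
    using d[of "\<lambda>z. norm z ^ 4"] m4 by (auto simp: has_bochner_integral_iff)
qed

lemma grad_norm_le: "norm (grad t i \<omega>) \<le> Lh * (norm (\<xi> t i \<omega>))\<^sup>2"
  unfolding grad_def by (rule gf_oracle_norm_le[OF f_lipschitz \<mu>_pos])

lemma grad_norm_sq_integrable: "integrable M (\<lambda>\<omega>. (norm (grad t i \<omega>))\<^sup>2)"
  and grad_norm_sq_expectation: "expectation (\<lambda>\<omega>. (norm (grad t i \<omega>))\<^sup>2) \<le> (real CARD('n) + 4)\<^sup>2 * Lh\<^sup>2"
proof -
  have le: "(norm (grad t i \<omega>))\<^sup>2 \<le> Lh\<^sup>2 * norm (\<xi> t i \<omega>) ^ 4" for \<omega>
  proof -
    have "(norm (grad t i \<omega>))\<^sup>2 \<le> (Lh * (norm (\<xi> t i \<omega>))\<^sup>2)\<^sup>2" using grad_norm_le by (intro power_mono) auto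
    then show ?thesis by (simp add: power_mult_distrib)
  qed
  have i4: "integrable M (\<lambda>\<omega>. Lh\<^sup>2 * norm (\<xi> t i \<omega>) ^ 4)" using noise_moments(3) by (rule integrable_mult_right)
  show int: "integrable M (\<lambda>\<omega>. (norm (grad t i \<omega>))\<^sup>2)"
    by (rule Bochner_Integration.integrable_bound[OF i4]) (use le in auto)
  have "expectation (\<lambda>\<omega>. (norm (grad t i \<omega>))\<^sup>2) \<le> expectation (\<lambda>\<omega>. Lh\<^sup>2 * norm (\<xi> t i \<omega>) ^ 4)"
    by (intro integral_mono int i4 le)
  also have "\<dots> = Lh\<^sup>2 * (real CARD('n) * (real CARD('n) + 2))" by (simp add: noise_moments)
  also have "\<dots> \<le> Lh\<^sup>2 * (real CARD('n) + 4)\<^sup>2"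
    by (intro mult_left_mono) (auto simp: power2_eq_square algebra_simps)
  finally show "expectation (\<lambda>\<omega>. (norm (grad t i \<omega>))\<^sup>2) \<le> (real CARD('n) + 4)\<^sup>2 * Lh\<^sup>2" by (simp add: mult.commute)
qed

lemma integrable_comp_X:
  fixes h :: "real^'n \<Rightarrow> real"
  assumes [measurable]: "u \<in> borel_measurable M" and u: "\<And>\<omega>. u \<omega> \<in> X" and h: "continuous_on X h"
  shows "integrable M (\<lambda>\<omega>. h (u \<omega>))"
proof -
  have "bounded (h ` X)" by (intro compact_imp_bounded compact_continuous_image h compact_X)
  then obtain K where "\<And>v. v \<in> X \<Longrightarrow> norm (h v) \<le> K" by (auto simp: bounded_iff)
  then show ?thesis using u measurable_comp_X[OF assms]
    by (intro integrable_const_bound[where B = K]) auto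
qed

lemma f_continuous: "continuous_on S (f i)"
  using lipschitz_on_continuous_on[OF f_lipschitz] continuous_on_subset by blast

lemma f_iterate_integrable: "integrable M (\<lambda>\<omega>. f i (iterate t l \<omega>))"
  by (rule integrable_comp_X[OF iterate_measurable iterate_in_X f_continuous])

lemma f_mixed_integrable: "integrable M (\<lambda>\<omega>. f i (mixed t l \<omega>))"
  by (rule integrable_comp_X[OF mixed_measurable mixed_in_X f_continuous])

lemma bregman_continuous: "continuous_on X (bregman \<phi> u)"
  unfolding bregman_def
  by (intro continuous_intros gradient_continuous_on_X continuous_on_subset[OF continuous_on_phi XU])

lemma diff_bounded:
  obtains D where "\<And>u v. u \<in> X \<Longrightarrow> v \<in> X \<Longrightarrow> norm (u - v) \<le> D"
proof -
  obtain D where "\<And>u v. u \<in> X \<Longrightarrow> v \<in> X \<Longrightarrow> dist u v \<le> D"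
    using compact_imp_bounded[OF compact_X] by (metis bounded_two_points)
  then show ?thesis using that by (auto simp: dist_norm)
qed

lemma grad_inner_integrable:
  assumes u: "u \<in> X"
  shows "integrable M (\<lambda>\<omega>. grad t i \<omega> \<bullet> (mixed t i \<omega> - u))"
proof -
  obtain D where D: "\<And>u v. u \<in> X \<Longrightarrow> v \<in> X \<Longrightarrow> norm (u - v) \<le> D" using diff_bounded by blast
  show ?thesis
  proof (rule Bochner_Integration.integrable_bound)
    show "integrable M (\<lambda>\<omega>. Lh * D * (norm (\<xi> t i \<omega>))\<^sup>2)"
      using noise_moments(1) by (rule integrable_mult_right)
    show "AE \<omega> in M. norm (grad t i \<omega> \<bullet> (mixed t i \<omega> - u)) \<le> norm (Lh * D * (norm (\<xi> t i \<omega>))\<^sup>2)"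
    proof (intro AE_I2)
      fix \<omega>
      have "norm (grad t i \<omega> \<bullet> (mixed t i \<omega> - u)) \<le> norm (grad t i \<omega>) * norm (mixed t i \<omega> - u)"
        by (simp add: Cauchy_Schwarz_ineq2)
      also have "\<dots> \<le> Lh * (norm (\<xi> t i \<omega>))\<^sup>2 * D"
        using Lh_nonneg by (intro mult_mono grad_norm_le D mixed_in_X u) auto
      finally show "norm (grad t i \<omega> \<bullet> (mixed t i \<omega> - u)) \<le> norm (Lh * D * (norm (\<xi> t i \<omega>))\<^sup>2)"
        by (simp add: mult_ac)
    qed
  qed measurable
qed

text \<open>By independence the expectation is a double integral, and \<open>gf_oracle_expectation\<close> applies to the inner
  one, for each fixed value of the averaged point.\<close>

lemma grad_descent:
  assumes u: "u \<in> X"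
  shows "expectation (\<lambda>\<omega>. f i (mixed t i \<omega>)) - f i u - \<mu> i * Lh * sqrt (real CARD('n))
    \<le> expectation (\<lambda>\<omega>. grad t i \<omega> \<bullet> (mixed t i \<omega> - u))"
proof -
  let ?Y = "distr M borel (mixed t i)" and ?G = "std_gaussian :: (real^'n) measure"
  let ?k = "\<lambda>v z. gf_oracle (f i) (\<mu> i) v z \<bullet> (v - u)" and ?h = "\<lambda>(v, z). gf_oracle (f i) (\<mu> i) v z \<bullet> (v - u)"
  let ?c = "\<mu> i * Lh * sqrt (real CARD('n))"
  interpret Y: prob_space ?Y by (rule prob_space_distr) measurable
  interpret G: prob_space ?G by (rule prob_space_std_gaussian)
  interpret YG: pair_sigma_finite ?Y ?G ..
  have joint: "distr M (borel \<Otimes>\<^sub>M borel) (\<lambda>\<omega>. (mixed t i \<omega>, \<xi> t i \<omega>)) = ?Y \<Otimes>\<^sub>M ?G"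
    using mixed_indep_noise[of t i] unfolding indep_var_distribution_eq distr_noise by simp
  have hm[measurable]: "?h \<in> borel_measurable (borel \<Otimes>\<^sub>M borel)" unfolding split_beta by measurable
  have int: "integrable (?Y \<Otimes>\<^sub>M ?G) ?h"
    unfolding joint[symmetric] using grad_inner_integrable[OF u, of t i]
    by (subst integrable_distr_eq) (auto simp: grad_def)
  have fY: "integrable ?Y (f i)"
    using f_mixed_integrable[of i t i] by (subst integrable_distr_eq) auto
  have "expectation (\<lambda>\<omega>. f i (mixed t i \<omega>)) - f i u - ?c = (\<integral>v. f i v - f i u - ?c \<partial>?Y)"
    using fY Y.prob_space by (simp add: integral_distr)
  also have "\<dots> \<le> (\<integral>v. (\<integral>z. ?k v z \<partial>?G) \<partial>?Y)"
  proof (rule integral_mono)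
    show "integrable ?Y (\<lambda>v. f i v - f i u - ?c)" using fY by simp
    show "integrable ?Y (\<lambda>v. \<integral>z. ?k v z \<partial>?G)"
      using YG.integrable_fst[of ?k] int by simp
    fix v show "f i v - f i u - ?c \<le> (\<integral>z. ?k v z \<partial>?G)"
      by (rule gf_oracle_expectation[OF f_convex f_lipschitz \<mu>_pos])
  qed
  also have "\<dots> = integral\<^sup>L (?Y \<Otimes>\<^sub>M ?G) ?h"
    using YG.integral_fst[of ?k] int by simp
  also have "\<dots> = expectation (\<lambda>\<omega>. grad t i \<omega> \<bullet> (mixed t i \<omega> - u))"
    unfolding joint[symmetric] by (subst integral_distr) (auto simp: grad_def)
  finally show ?thesis .
qed

definition potential :: "real^'n \<Rightarrow> nat \<Rightarrow> real" where
  "potential u t = (\<Sum>i\<in>UNIV. expectation (\<lambda>\<omega>. bregman \<phi> u (iterate t i \<omega>)))"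

lemma bregman_iterate_integrable: "integrable M (\<lambda>\<omega>. bregman \<phi> u (iterate t i \<omega>))"
  by (rule integrable_comp_X[OF iterate_measurable iterate_in_X bregman_continuous])

lemma bregman_mixed_integrable: "integrable M (\<lambda>\<omega>. bregman \<phi> u (mixed t i \<omega>))"
  by (rule integrable_comp_X[OF mixed_measurable mixed_in_X bregman_continuous])

lemma bregman_consensus_le:
  assumes u: "u \<in> X"
  shows "(\<Sum>i\<in>UNIV. bregman \<phi> u (mixed t i \<omega>)) \<le> (\<Sum>i\<in>UNIV. bregman \<phi> u (iterate t i \<omega>))"
proof -
  have "bregman \<phi> u (mixed t i \<omega>) \<le> (\<Sum>j\<in>UNIV. P t $ i $ j *\<^sub>R bregman \<phi> u (iterate t j \<omega>))" for i
    using convex_on_sum[OF _ _ convex_on_bregman_second[OF u], of UNIV "\<lambda>j. P t $ i $ j" "\<lambda>j. iterate t j \<omega>"] P_row iterate_in_X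
    by (simp add: mixed_conv_iterate consensus_def)
  then have "(\<Sum>i\<in>UNIV. bregman \<phi> u (mixed t i \<omega>)) \<le> (\<Sum>i\<in>UNIV. \<Sum>j\<in>UNIV. P t $ i $ j *\<^sub>R bregman \<phi> u (iterate t j \<omega>))"
    by (rule sum_mono)
  also have "\<dots> = (\<Sum>i\<in>UNIV. bregman \<phi> u (iterate t i \<omega>))"
    by (rule sum_doubly_stochastic[OF P_stochastic])
  finally show ?thesis .
qed

lemma potential_bounds:
  assumes u: "u \<in> X" and d: "\<And>v. v \<in> X \<Longrightarrow> bregman \<phi> u v \<le> d\<^sup>2"
  shows "0 \<le> potential u t" "potential u t \<le> real CARD('v) * d\<^sup>2"
proof -
  show "0 \<le> potential u t" unfolding potential_def
    by (intro sum_nonneg integral_nonneg_AE AE_I2 bregman_nonneg u iterate_in_X)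
  have "expectation (\<lambda>\<omega>. bregman \<phi> u (iterate t i \<omega>)) \<le> expectation (\<lambda>\<omega>. d\<^sup>2)" for i
    using bregman_iterate_integrable d iterate_in_X by (intro integral_mono) auto
  then have "potential u t \<le> (\<Sum>i\<in>(UNIV::'v set). d\<^sup>2)" unfolding potential_def
    by (intro sum_mono) (simp add: prob_space)
  then show "potential u t \<le> real CARD('v) * d\<^sup>2" by simp
qed

text \<open>Expected form of \<open>mirror_step_progress\<close>, summed over the agents; the potential at the averaged points
  is at most the one at the iterates.\<close>

lemma expected_progress:
  assumes u: "u \<in> X"
  shows "\<alpha> t * (\<Sum>i\<in>UNIV. expectation (\<lambda>\<omega>. f i (mixed t i \<omega>)) - f i u - \<mu> i * Lh * sqrt (real CARD('n)))
    \<le> potential u t - potential u (Suc t) + real CARD('v) * ((\<alpha> t)\<^sup>2 * ((real CARD('n) + 4)\<^sup>2 * Lh\<^sup>2) / (2 * \<sigma>))"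
proof -
  let ?Dx = "\<lambda>i. expectation (\<lambda>\<omega>. bregman \<phi> u (iterate (Suc t) i \<omega>))"
    and ?Dy = "\<lambda>i. expectation (\<lambda>\<omega>. bregman \<phi> u (mixed t i \<omega>))"
    and ?f = "\<lambda>i. expectation (\<lambda>\<omega>. f i (mixed t i \<omega>)) - f i u - \<mu> i * Lh * sqrt (real CARD('n))"
  let ?G = "(real CARD('n) + 4)\<^sup>2 * Lh\<^sup>2"
  have "\<alpha> t * ?f i
      \<le> ?Dy i - ?Dx i
        + (\<alpha> t)\<^sup>2 * ?G / (2 * \<sigma>)" for i
  proof -
    have "\<alpha> t * ?f i
        \<le> \<alpha> t * expectation (\<lambda>\<omega>. grad t i \<omega> \<bullet> (mixed t i \<omega> - u))"
      using less_imp_le[OF \<alpha>_pos] by (intro mult_left_mono grad_descent u)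
    also have "\<dots> = expectation (\<lambda>\<omega>. \<alpha> t * (grad t i \<omega> \<bullet> (mixed t i \<omega> - u)))" by simp
    also have "\<dots> \<le> expectation (\<lambda>\<omega>. bregman \<phi> u (mixed t i \<omega>) - bregman \<phi> u (iterate (Suc t) i \<omega>)
        + (\<alpha> t)\<^sup>2 * (norm (grad t i \<omega>))\<^sup>2 / (2 * \<sigma>))"
    proof (rule integral_mono)
      show "integrable M (\<lambda>\<omega>. \<alpha> t * (grad t i \<omega> \<bullet> (mixed t i \<omega> - u)))"
        using grad_inner_integrable[OF u] by (rule integrable_mult_right)
      show "integrable M (\<lambda>\<omega>. bregman \<phi> u (mixed t i \<omega>) - bregman \<phi> u (iterate (Suc t) i \<omega>)
        + (\<alpha> t)\<^sup>2 * (norm (grad t i \<omega>))\<^sup>2 / (2 * \<sigma>))"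
        by (intro Bochner_Integration.integrable_add Bochner_Integration.integrable_diff
            bregman_iterate_integrable bregman_mixed_integrable integrable_divide integrable_mult_right grad_norm_sq_integrable)
      fix \<omega>
      show "\<alpha> t * (grad t i \<omega> \<bullet> (mixed t i \<omega> - u)) \<le> bregman \<phi> u (mixed t i \<omega>) - bregman \<phi> u (iterate (Suc t) i \<omega>)
        + (\<alpha> t)\<^sup>2 * (norm (grad t i \<omega>))\<^sup>2 / (2 * \<sigma>)"
        unfolding iterate_Suc by (rule mirror_step_progress[OF mixed_in_X u])
    qed
    also have "\<dots> = ?Dy i - ?Dx i
        + (\<alpha> t)\<^sup>2 * expectation (\<lambda>\<omega>. (norm (grad t i \<omega>))\<^sup>2) / (2 * \<sigma>)"
      using bregman_iterate_integrable bregman_mixed_integrable grad_norm_sq_integrable by simp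
    also have "\<dots> \<le> ?Dy i - ?Dx i
        + (\<alpha> t)\<^sup>2 * ?G / (2 * \<sigma>)"
      using \<sigma>_pos by (intro add_left_mono divide_right_mono mult_left_mono grad_norm_sq_expectation) auto
    finally show ?thesis .
  qed
  then have "\<alpha> t * (\<Sum>i\<in>UNIV. ?f i)
      \<le> (\<Sum>i\<in>UNIV. ?Dy i - ?Dx i
        + (\<alpha> t)\<^sup>2 * ?G / (2 * \<sigma>))"
    unfolding sum_distrib_left by (intro sum_mono)
  also have "\<dots> = (\<Sum>i\<in>UNIV. ?Dy i) - potential u (Suc t)
      + real CARD('v) * ((\<alpha> t)\<^sup>2 * ?G / (2 * \<sigma>))"
    by (simp add: sum.distrib sum_subtractf potential_def)
  also have "(\<Sum>i\<in>UNIV. ?Dy i) \<le> potential u t"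
  proof -
    have "(\<Sum>i\<in>UNIV. ?Dy i) = expectation (\<lambda>\<omega>. \<Sum>i\<in>UNIV. bregman \<phi> u (mixed t i \<omega>))"
      by (rule Bochner_Integration.integral_sum[symmetric]) (rule bregman_mixed_integrable)
    also have "\<dots> \<le> expectation (\<lambda>\<omega>. \<Sum>i\<in>UNIV. bregman \<phi> u (iterate t i \<omega>))"
      by (intro integral_mono Bochner_Integration.integrable_sum bregman_iterate_integrable bregman_mixed_integrable
          bregman_consensus_le u)
    also have "\<dots> = potential u t"
      unfolding potential_def by (rule Bochner_Integration.integral_sum) (rule bregman_iterate_integrable)
    finally show ?thesis .
  qed
  finally show ?thesis by simp
qed

abbreviation spread :: "nat \<Rightarrow> 'w \<Rightarrow> real" where
  "spread t \<omega> \<equiv> disagreement (\<lambda>j. iterate t j \<omega>)"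

lemma disagreement_integrable: "integrable M (spread t)"
proof -
  obtain D where D: "\<And>u v. u \<in> X \<Longrightarrow> v \<in> X \<Longrightarrow> norm (u - v) \<le> D" using diff_bounded by blast
  have m: "(spread t) \<in> borel_measurable M"
    unfolding disagreement_def sq_disagreement_def agent_mean_def by measurable
  have "spread t \<omega> \<le> real CARD('v) * D" for \<omega>
  proof -
    have "spread t \<omega> \<le> (\<Sum>j\<in>UNIV. norm (iterate t j \<omega>))" by (rule disagreement_le_sum_norm)
    also have "\<dots> \<le> (\<Sum>j\<in>(UNIV::'v set). D)" using D[OF iterate_in_X zero_in_X] by (intro sum_mono) simp
    finally show ?thesis by simp
  qed
  then show ?thesis using m
    by (intro integrable_const_bound[where B = "real CARD('v) * D"] AE_I2)
       (auto simp: abs_of_nonneg[OF disagreement_nonneg])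
qed

text \<open>Combines \<open>sum_disagreement_le\<close> on each sample path with the mean size of a displacement, which is
  controlled by the second moment \<open>n\<close> of the noise.\<close>

lemma expected_disagreement_sum:
  "(\<Sum>t=1..T. expectation (spread t))
    \<le> 16 * real B * (real CARD('v))\<^sup>2 / \<zeta> * (real CARD('v) * (real CARD('n) * Lh / \<sigma>)) * (\<Sum>s<T. \<alpha> s)"
proof -
  let ?S = "\<lambda>\<omega>. \<Sum>s<T. \<Sum>j\<in>UNIV. \<alpha> s * Lh / \<sigma> * (norm (\<xi> s j \<omega>))\<^sup>2"
  let ?K = "16 * real B * (real CARD('v))\<^sup>2 / \<zeta>"
  have step: "norm (iterate (Suc s) j \<omega> - mixed s j \<omega>) \<le> \<alpha> s * Lh / \<sigma> * (norm (\<xi> s j \<omega>))\<^sup>2" for s j \<omega>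
  proof -
    have "norm (iterate (Suc s) j \<omega> - mixed s j \<omega>) \<le> \<alpha> s * norm (grad s j \<omega>) / \<sigma>"
      unfolding iterate_Suc using less_imp_le[OF \<alpha>_pos] by (intro mirror_step_displacement mixed_in_X)
    also have "\<dots> \<le> \<alpha> s * (Lh * (norm (\<xi> s j \<omega>))\<^sup>2) / \<sigma>"
      using \<sigma>_pos less_imp_le[OF \<alpha>_pos] by (intro divide_right_mono mult_left_mono grad_norm_le) auto
    finally show ?thesis by simp
  qed
  have trajectory: "(\<Sum>t=1..T. spread t \<omega>)
      \<le> ?K * ?S \<omega>" for \<omega>
  proof -
    have "(\<Sum>t=1..T. spread t \<omega>) \<le> ?K * (\<Sum>s<T. \<Sum>j\<in>UNIV. norm (iterate (Suc s) j \<omega> - mixed s j \<omega>))"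
      by (rule sum_disagreement_le[OF net]) (simp_all add: iterate_0 mixed_conv_iterate consensus_def)
    also have "\<dots> \<le> ?K * ?S \<omega>"
      using \<zeta> by (intro mult_left_mono sum_mono step) auto
    finally show ?thesis .
  qed
  have int: "integrable M (\<lambda>\<omega>. ?K * ?S \<omega>)"
    by (intro integrable_mult_right Bochner_Integration.integrable_sum noise_moments)
  have "(\<Sum>t=1..T. expectation (spread t))
      = expectation (\<lambda>\<omega>. \<Sum>t=1..T. spread t \<omega>)"
    by (rule Bochner_Integration.integral_sum[symmetric]) (rule disagreement_integrable)
  also have "\<dots> \<le> expectation (\<lambda>\<omega>. ?K * ?S \<omega>)"
    by (intro integral_mono Bochner_Integration.integrable_sum disagreement_integrable int trajectory)
  also have "\<dots> = ?K * (\<Sum>s<T. \<Sum>j\<in>(UNIV::'v set). \<alpha> s * Lh / \<sigma> * real CARD('n))"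
    by (simp only: Bochner_Integration.integral_sum Bochner_Integration.integrable_sum
        integrable_mult_right noise_moments integral_mult_right_zero)
  also have "\<dots> = ?K * (real CARD('v) * (real CARD('n) * Lh / \<sigma>)) * (\<Sum>s<T. \<alpha> s)"
  proof -
    have "(\<Sum>s<T. \<Sum>j\<in>(UNIV::'v set). \<alpha> s * Lh / \<sigma> * real CARD('n))
        = real CARD('v) * (real CARD('n) * Lh / \<sigma>) * (\<Sum>s<T. \<alpha> s)"
      unfolding sum_distrib_left by (intro sum.cong) (simp_all add: mult_ac)
    then show ?thesis by (simp only: mult.assoc)
  qed
  finally show ?thesis .
qed

text \<open>Moves the evaluation from the averaged points of all agents to the iterate of agent \<open>l\<close>, at the price of
  the disagreement, and divides by the number of agents and by the step size.\<close>

lemma expected_gap: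
  assumes u: "u \<in> X"
  shows "expectation (\<lambda>\<omega>. mean_objective f (iterate t l \<omega>)) - mean_objective f u
    \<le> sqrt (real CARD('n)) * Lh * (1 / real CARD('v) * (\<Sum>i\<in>UNIV. \<mu> i))
      + (potential u t - potential u (Suc t)) / (real CARD('v) * \<alpha> t)
      + \<alpha> t * ((real CARD('n) + 4)\<^sup>2 * Lh\<^sup>2 / (2 * \<sigma>))
      + 2 * Lh * expectation (spread t)"
proof -
  let ?e = "expectation (\<lambda>\<omega>. mean_objective f (iterate t l \<omega>))"
  let ?N = "real CARD('v)" and ?G = "(real CARD('n) + 4)\<^sup>2 * Lh\<^sup>2"
  let ?d = "expectation (spread t)"
  let ?s = "sqrt (real CARD('n))"
  have each: "expectation (\<lambda>\<omega>. f i (iterate t l \<omega>)) \<le> expectation (\<lambda>\<omega>. f i (mixed t i \<omega>)) + 2 * Lh * ?d" for i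
  proof -
    have "expectation (\<lambda>\<omega>. f i (iterate t l \<omega>)) \<le> expectation (\<lambda>\<omega>. f i (mixed t i \<omega>) + 2 * Lh * spread t \<omega>)"
    proof (rule integral_mono)
      fix \<omega>
      have "f i (iterate t l \<omega>) - f i (mixed t i \<omega>) \<le> Lh * norm (iterate t l \<omega> - mixed t i \<omega>)"
        using lipschitz_onD[OF f_lipschitz, of "iterate t l \<omega>" "mixed t i \<omega>" i] by (simp add: dist_norm)
      also have "\<dots> \<le> Lh * (2 * spread t \<omega>)"
        unfolding mixed_conv_iterate using Lh_nonneg
        by (intro mult_left_mono norm_diff_consensus_le[OF P_stochastic, of "\<lambda>j. iterate t j \<omega>"])
      finally show "f i (iterate t l \<omega>) \<le> f i (mixed t i \<omega>) + 2 * Lh * spread t \<omega>" by simp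
    qed (use f_iterate_integrable f_mixed_integrable disagreement_integrable in auto)
    then show ?thesis using f_mixed_integrable disagreement_integrable by simp
  qed
  have obj: "?e = 1 / ?N * (\<Sum>i\<in>UNIV. expectation (\<lambda>\<omega>. f i (iterate t l \<omega>)))"
  proof -
    have "expectation (\<lambda>\<omega>. \<Sum>i\<in>UNIV. f i (iterate t l \<omega>)) = (\<Sum>i\<in>UNIV. expectation (\<lambda>\<omega>. f i (iterate t l \<omega>)))"
      by (rule Bochner_Integration.integral_sum) (rule f_iterate_integrable)
    then show ?thesis
      unfolding mean_objective_def by (simp only: integral_mult_right_zero)
  qed
  have "?N * (?e - mean_objective f u)
      = (\<Sum>i\<in>UNIV. expectation (\<lambda>\<omega>. f i (iterate t l \<omega>)) - f i u)"
    unfolding obj unfolding mean_objective_def by (simp add: right_diff_distrib sum_subtractf)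
  also have "\<dots> \<le> (\<Sum>i\<in>UNIV. (expectation (\<lambda>\<omega>. f i (mixed t i \<omega>)) - f i u - \<mu> i * Lh * ?s) + \<mu> i * (Lh * ?s) + 2 * Lh * ?d)"
    by (intro sum_mono) (use each in \<open>simp add: algebra_simps\<close>)
  also have "\<dots> = (\<Sum>i\<in>UNIV. expectation (\<lambda>\<omega>. f i (mixed t i \<omega>)) - f i u - \<mu> i * Lh * ?s)
      + (\<Sum>i\<in>UNIV. \<mu> i) * (Lh * ?s) + ?N * (2 * Lh * ?d)"
    by (simp only: sum.distrib sum_distrib_right sum_constant of_nat_mult)
  also have "(\<Sum>i\<in>UNIV. expectation (\<lambda>\<omega>. f i (mixed t i \<omega>)) - f i u - \<mu> i * Lh * ?s)
      \<le> (potential u t - potential u (Suc t) + ?N * ((\<alpha> t)\<^sup>2 * ?G / (2 * \<sigma>))) / \<alpha> t"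
    using expected_progress[OF u, of t] \<alpha>_pos[of t] by (simp add: le_divide_eq mult.commute)
  also have "\<dots> = ?N * ((potential u t - potential u (Suc t)) / (?N * \<alpha> t) + \<alpha> t * (?G / (2 * \<sigma>)))"
    using \<alpha>_pos[of t] \<sigma>_pos by (simp add: add_divide_distrib power2_eq_square distrib_left)
  finally have "?N * (?e - mean_objective f u)
      \<le> ?N * ((potential u t - potential u (Suc t)) / (?N * \<alpha> t) + \<alpha> t * (?G / (2 * \<sigma>)))
        + (\<Sum>i\<in>UNIV. \<mu> i) * (Lh * ?s) + ?N * (2 * Lh * ?d)" by simp
  also have "\<dots> = ?N * (?s * Lh * (1 / ?N * (\<Sum>i\<in>UNIV. \<mu> i))
      + (potential u t - potential u (Suc t)) / (?N * \<alpha> t) + \<alpha> t * (?G / (2 * \<sigma>)) + 2 * Lh * ?d)"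
    by (simp add: distrib_left mult_ac)
  finally show ?thesis by (simp only: mult_le_cancel_left_pos[OF of_nat_0_less_iff[THEN iffD2, OF zero_less_card_finite]])
qed

lemma mean_objective_convex: "convex_on UNIV (mean_objective f)"
proof (rule convex_onI)
  fix t :: real and v w assume t: "0 < t" "t < 1"
  have "(\<Sum>i\<in>UNIV. f i ((1 - t) *\<^sub>R v + t *\<^sub>R w)) \<le> (\<Sum>i\<in>UNIV. (1 - t) * f i v + t * f i w)"
    using t by (intro sum_mono convex_onD[OF f_convex]) auto
  also have "\<dots> = (1 - t) * (\<Sum>i\<in>UNIV. f i v) + t * (\<Sum>i\<in>UNIV. f i w)"
    by (simp add: sum.distrib sum_distrib_left)
  finally have "1 / real CARD('v) * (\<Sum>i\<in>UNIV. f i ((1 - t) *\<^sub>R v + t *\<^sub>R w))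
      \<le> 1 / real CARD('v) * ((1 - t) * (\<Sum>i\<in>UNIV. f i v) + t * (\<Sum>i\<in>UNIV. f i w))"
    by (intro mult_left_mono) auto
  then show "mean_objective f ((1 - t) *\<^sub>R v + t *\<^sub>R w) \<le> (1 - t) * mean_objective f v + t * mean_objective f w"
    by (simp add: mean_objective_def distrib_left mult_ac)
qed simp

lemma mean_objective_continuous: "continuous_on S (mean_objective f)"
  unfolding mean_objective_def by (intro continuous_intros f_continuous)

lemma weighted_avg_convex_combination:
  assumes "1 \<le> T"
  shows "weighted_avg \<alpha> u T = (\<Sum>t=1..T. (1 / \<alpha> t / (\<Sum>t=1..T. 1 / \<alpha> t)) *\<^sub>R u t)"
    and "(\<Sum>t=1..T. 1 / \<alpha> t / (\<Sum>t=1..T. 1 / \<alpha> t)) = 1" and "0 < (\<Sum>t=1..T. 1 / \<alpha> t)"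
proof -
  show pos: "0 < (\<Sum>t=1..T. 1 / \<alpha> t)" using assms \<alpha>_pos by (intro sum_pos) auto
  show "weighted_avg \<alpha> u T = (\<Sum>t=1..T. (1 / \<alpha> t / (\<Sum>t=1..T. 1 / \<alpha> t)) *\<^sub>R u t)"
    by (simp add: weighted_avg_def scaleR_sum_right mult.commute)
  show "(\<Sum>t=1..T. 1 / \<alpha> t / (\<Sum>t=1..T. 1 / \<alpha> t)) = 1"
    unfolding sum_divide_distrib[symmetric] using pos by simp
qed

text \<open>Jensen's inequality for the weighted average of the iterates.\<close>

lemma averaged_gap_le:
  assumes "1 \<le> T"
  shows "(expectation (\<lambda>\<omega>. mean_objective f (weighted_avg \<alpha> (\<lambda>t. iterate t l \<omega>) T)) - c) * (\<Sum>t=1..T. 1 / \<alpha> t)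
    \<le> (\<Sum>t=1..T. 1 / \<alpha> t * (expectation (\<lambda>\<omega>. mean_objective f (iterate t l \<omega>)) - c))"
proof -
  let ?e = "\<lambda>t. expectation (\<lambda>\<omega>. mean_objective f (iterate t l \<omega>))"
  let ?ew = "expectation (\<lambda>\<omega>. mean_objective f (weighted_avg \<alpha> (\<lambda>t. iterate t l \<omega>) T))"
  let ?W = "\<Sum>t=1..T. 1 / \<alpha> t"
  note wa = weighted_avg_convex_combination[OF assms]
  have w0: "0 \<le> 1 / \<alpha> t / ?W" for t using wa(3) \<alpha>_pos[of t] by simp
  have int: "integrable M (\<lambda>\<omega>. mean_objective f (iterate t l \<omega>))" for t
    by (rule integrable_comp_X[OF iterate_measurable iterate_in_X mean_objective_continuous])
  have "?ew
      \<le> expectation (\<lambda>\<omega>. \<Sum>t=1..T. 1 / \<alpha> t / ?W * mean_objective f (iterate t l \<omega>))"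
  proof (rule integral_mono)
    have m: "(\<lambda>\<omega>. weighted_avg \<alpha> (\<lambda>t. iterate t l \<omega>) T) \<in> borel_measurable M"
      unfolding weighted_avg_def by measurable
    show "integrable M (\<lambda>\<omega>. mean_objective f (weighted_avg \<alpha> (\<lambda>t. iterate t l \<omega>) T))"
    proof (rule integrable_comp_X[OF m _ mean_objective_continuous])
      fix \<omega> show "weighted_avg \<alpha> (\<lambda>t. iterate t l \<omega>) T \<in> X"
        unfolding wa(1) using wa(2) w0 iterate_in_X by (intro convex_sum convex_X) auto
    qed
    show "integrable M (\<lambda>\<omega>. \<Sum>t=1..T. 1 / \<alpha> t / ?W * mean_objective f (iterate t l \<omega>))"
      by (intro Bochner_Integration.integrable_sum integrable_mult_right int)
    fix \<omega>
    show "mean_objective f (weighted_avg \<alpha> (\<lambda>t. iterate t l \<omega>) T) \<le> (\<Sum>t=1..T. 1 / \<alpha> t / ?W * mean_objective f (iterate t l \<omega>))"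
      unfolding wa(1) using wa(2) w0 assms
      by (intro convex_on_sum[OF _ _ mean_objective_convex]) auto
  qed
  also have "\<dots> = (\<Sum>t=1..T. 1 / \<alpha> t / ?W * ?e t)"
    using int by (subst Bochner_Integration.integral_sum) auto
  also have "\<dots> = (\<Sum>t=1..T. 1 / \<alpha> t * ?e t) / ?W"
    by (simp add: sum_divide_distrib)
  finally have "?ew * ?W
      \<le> (\<Sum>t=1..T. 1 / \<alpha> t * ?e t)"
    using wa(3) by (simp add: pos_le_divide_eq)
  moreover have "(\<Sum>t=1..T. 1 / \<alpha> t * (?e t - c))
      = (\<Sum>t=1..T. 1 / \<alpha> t * ?e t) - c * ?W"
    by (simp only: right_diff_distrib sum_subtractf sum_distrib_left mult.commute)
  ultimately show ?thesis by (simp only: left_diff_distrib)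
qed

text \<open>Sums \<open>expected_gap\<close> with the weights \<open>1 / \<alpha> t\<close>, which increase with \<open>t\<close>: this is what summation by parts
  and the bound \<open>1 / \<alpha> t \<le> 1 / \<alpha> T\<close> for the disagreements need.\<close>

lemma weighted_gap_bound:
  assumes u: "u \<in> X" and d: "\<And>v. v \<in> X \<Longrightarrow> bregman \<phi> u v \<le> d\<^sup>2" and T: "1 \<le> T"
    and mono: "\<And>s t. 1 \<le> s \<Longrightarrow> s \<le> t \<Longrightarrow> \<alpha> t \<le> \<alpha> s"
  shows "(expectation (\<lambda>\<omega>. mean_objective f (weighted_avg \<alpha> (\<lambda>t. iterate t l \<omega>) T)) - mean_objective f u) * (\<Sum>t=1..T. 1 / \<alpha> t)
    \<le> sqrt (real CARD('n)) * Lh * (1 / real CARD('v) * (\<Sum>i\<in>UNIV. \<mu> i)) * (\<Sum>t=1..T. 1 / \<alpha> t)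
      + d\<^sup>2 / (\<alpha> T)\<^sup>2 + real T * ((real CARD('n) + 4)\<^sup>2 * Lh\<^sup>2 / (2 * \<sigma>))
      + C_tilde CARD('v) CARD('n) Lh \<sigma> \<zeta> B * (\<Sum>s<T. \<alpha> s) / \<alpha> T"
proof -
  let ?N = "real CARD('v)"
  let ?R = "sqrt (real CARD('n)) * Lh * (1 / ?N * (\<Sum>i\<in>UNIV. \<mu> i))"
  let ?A = "(real CARD('n) + 4)\<^sup>2 * Lh\<^sup>2 / (2 * \<sigma>)"
  let ?dis = "\<lambda>t. expectation (spread t)"
  let ?gap = "\<lambda>t. expectation (\<lambda>\<omega>. mean_objective f (iterate t l \<omega>)) - mean_objective f u"
  define D where "D t = potential u t / ?N" for t
  have D: "0 \<le> D t" "D t \<le> d\<^sup>2" for t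
    using potential_bounds[OF u d, of t] by (auto simp: D_def divide_le_eq mult.commute)
  have dis0: "0 \<le> ?dis t" for t by (intro integral_nonneg_AE AE_I2 disagreement_nonneg)
  have each: "1 / \<alpha> t * ?gap t \<le> ?R * (1 / \<alpha> t) + 1 / (\<alpha> t)\<^sup>2 * (D t - D (Suc t)) + ?A + 1 / \<alpha> T * (2 * Lh * ?dis t)"
    if t: "t \<in> {1..T}" for t
  proof -
    have "1 / \<alpha> t * ?gap t \<le> 1 / \<alpha> t * (?R + (potential u t - potential u (Suc t)) / (?N * \<alpha> t) + \<alpha> t * ?A + 2 * Lh * ?dis t)"
      using \<alpha>_pos[of t] by (intro mult_left_mono expected_gap u) auto
    also have "\<dots> = ?R * (1 / \<alpha> t) + 1 / (\<alpha> t)\<^sup>2 * (D t - D (Suc t)) + ?A + 1 / \<alpha> t * (2 * Lh * ?dis t)"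
    proof -
      have "(potential u t - potential u (Suc t)) / (?N * \<alpha> t) = (D t - D (Suc t)) / \<alpha> t"
        by (simp add: D_def diff_divide_distrib)
      moreover have "1 / \<alpha> t * (R + q / \<alpha> t + \<alpha> t * a + e) = R * (1 / \<alpha> t) + 1 / (\<alpha> t)\<^sup>2 * q + a + 1 / \<alpha> t * e" for R q a e
        using \<alpha>_pos[of t] by (simp add: power2_eq_square distrib_left)
      ultimately show ?thesis by (simp only:)
    qed
    also have "1 / \<alpha> t * (2 * Lh * ?dis t) \<le> 1 / \<alpha> T * (2 * Lh * ?dis t)"
      using mono[of t T] t \<alpha>_pos Lh_nonneg dis0[of t] by (intro mult_right_mono divide_left_mono) auto
    finally show ?thesis by simp
  qed
  have "(\<Sum>t=1..T. 1 / \<alpha> t * ?gap t)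
      \<le> (\<Sum>t=1..T. ?R * (1 / \<alpha> t) + 1 / (\<alpha> t)\<^sup>2 * (D t - D (Suc t)) + ?A + 1 / \<alpha> T * (2 * Lh * ?dis t))"
    by (intro sum_mono each)
  also have "\<dots> = ?R * (\<Sum>t=1..T. 1 / \<alpha> t) + (\<Sum>t=1..T. 1 / (\<alpha> t)\<^sup>2 * (D t - D (Suc t))) + real T * ?A
      + 1 / \<alpha> T * (2 * Lh * (\<Sum>t=1..T. ?dis t))"
    by (simp only: sum.distrib sum_distrib_left sum_constant card_atLeastAtMost diff_Suc_1 add_diff_cancel_right' Suc_eq_plus1)
  also have "(\<Sum>t=1..T. 1 / (\<alpha> t)\<^sup>2 * (D t - D (Suc t))) \<le> 1 / (\<alpha> T)\<^sup>2 * d\<^sup>2"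
  proof (rule abel_sum_le[OF _ _ D T])
    fix t :: nat assume "1 \<le> t"
    then have "\<alpha> (Suc t) \<le> \<alpha> t" by (intro mono) auto
    then show "1 / (\<alpha> t)\<^sup>2 \<le> 1 / (\<alpha> (Suc t))\<^sup>2"
      using \<alpha>_pos[of t] \<alpha>_pos[of "Suc t"] by (intro divide_left_mono power_mono) auto
  qed simp
  also have "2 * Lh * (\<Sum>t=1..T. ?dis t) \<le> C_tilde CARD('v) CARD('n) Lh \<sigma> \<zeta> B * (\<Sum>s<T. \<alpha> s)"
  proof -
    have "2 * Lh * (\<Sum>t=1..T. ?dis t)
        \<le> 2 * Lh * (16 * real B * ?N\<^sup>2 / \<zeta> * (?N * (real CARD('n) * Lh / \<sigma>)) * (\<Sum>s<T. \<alpha> s))"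
      using Lh_nonneg by (intro mult_left_mono expected_disagreement_sum) auto
    also have "\<dots> = 2 * (16 * real B * ?N\<^sup>2 / \<zeta>) * (?N * (real CARD('n) * Lh\<^sup>2 / \<sigma>)) * (\<Sum>s<T. \<alpha> s)"
      by (simp add: power2_eq_square mult_ac)
    also have "\<dots> \<le> C_tilde CARD('v) CARD('n) Lh \<sigma> \<zeta> B * (\<Sum>s<T. \<alpha> s)"
      using \<alpha>_pos B_pos \<sigma>_pos \<zeta>
      by (intro mult_right_mono C_tilde_ge sum_nonneg) (auto intro: less_imp_le)
    finally show ?thesis .
  qed
  then have "1 / \<alpha> T * (2 * Lh * (\<Sum>t=1..T. ?dis t)) \<le> 1 / \<alpha> T * (C_tilde CARD('v) CARD('n) Lh \<sigma> \<zeta> B * (\<Sum>s<T. \<alpha> s))"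
    using \<alpha>_pos[of T] by (intro mult_left_mono) auto
  finally show ?thesis
    using averaged_gap_le[OF T, of l "mean_objective f u"] by simp
qed

end

lemma stepsize_pos: "0 < \<rho> \<Longrightarrow> 0 < stepsize \<rho> \<delta> t"
  by (simp add: stepsize_def)

lemma stepsize_antimono:
  assumes "0 < \<rho>" "0 < \<delta>" "1 \<le> s" "s \<le> t"
  shows "stepsize \<rho> \<delta> t \<le> stepsize \<rho> \<delta> s"
proof -
  have "(real s + 1) powr \<delta> \<le> (real t + 1) powr \<delta>" using assms by (intro powr_mono2) auto
  then show ?thesis using assms by (auto simp: stepsize_def intro!: divide_left_mono)
qed

theorem corollary2:
  fixes E :: "nat \<Rightarrow> ('v::finite \<times> 'v) set"
    and P :: "nat \<Rightarrow> real^'v^'v"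
    and B :: nat and \<zeta> :: real
    and X U :: "(real^'n::finite) set"
    and f :: "'v \<Rightarrow> real^'n \<Rightarrow> real"
    and L :: "'v \<Rightarrow> real" and Lh :: real
    and \<phi> :: "real^'n \<Rightarrow> real"
    and \<sigma> d :: real
    and \<mu> :: "'v \<Rightarrow> real"
    and \<delta> \<rho> p C :: real
    and M :: "'w measure"
    and \<xi> :: "nat \<Rightarrow> 'v \<Rightarrow> 'w \<Rightarrow> real^'n"
    and x :: "nat \<Rightarrow> 'v \<Rightarrow> 'w \<Rightarrow> real^'n"
    and xstar :: "real^'n" and l :: 'v and T :: nat
  assumes "network E P B \<zeta>"
    and "compact X" and "convex X" and "0 \<in> X"
    and "\<And>i. convex_on UNIV (f i)"
    and "\<And>i. (L i)-lipschitz_on UNIV (f i)"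
    and "Lh = Max (range L)"
    and "bregman_generator X U \<sigma> \<phi>"
    and "\<And>u v. u \<in> X \<Longrightarrow> v \<in> X \<Longrightarrow> bregman \<phi> u v \<le> d^2"
    and "\<And>i. 0 < \<mu> i"
    and "0 < \<delta>" and "\<delta> < 1" and "0 < \<rho>"
    and "0 < p" and "p \<le> 1 - 1 / 2 powr (1 + \<delta>)"
    and "prob_space M"
    and "\<And>t i. distributed M lborel (\<xi> t i) (\<lambda>z. ennreal (std_gaussian_density z))"
    and "prob_space.indep_vars M (\<lambda>_. borel) (\<lambda>(t, i). \<xi> t i) (UNIV :: (nat \<times> 'v) set)"
    and "\<And>\<omega>. \<omega> \<in> space M \<Longrightarrow>
           drgfmd X \<phi> f P \<mu> (stepsize \<rho> \<delta>) (\<lambda>t i. \<xi> t i \<omega>) (\<lambda>t i. x t i \<omega>)"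
    and "is_arg_min (mean_objective f) (\<lambda>u. u \<in> X) xstar"
    and "1 \<le> T"
    and "C = C_delta CARD('v) CARD('n) Lh \<sigma> \<zeta> B d \<delta> \<rho> p"
  shows
    "(\<delta> < 1/2 \<longrightarrow>
        prob_space.expectation M (\<lambda>\<omega>. mean_objective f (weighted_avg (stepsize \<rho> \<delta>) (\<lambda>t. x t l \<omega>) T))
            - mean_objective f xstar
          \<le> sqrt (real CARD('n)) * Lh * (1 / real CARD('v) * (\<Sum>i\<in>UNIV. \<mu> i))
            + 2 * C / real T powr \<delta>) \<and>
     (\<delta> = 1/2 \<longrightarrow>
        prob_space.expectation M (\<lambda>\<omega>. mean_objective f (weighted_avg (stepsize \<rho> \<delta>) (\<lambda>t. x t l \<omega>) T))
            - mean_objective f xstar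
          \<le> sqrt (real CARD('n)) * Lh * (1 / real CARD('v) * (\<Sum>i\<in>UNIV. \<mu> i))
            + 2 * C / sqrt (real T)) \<and>
     (1/2 < \<delta> \<longrightarrow>
        prob_space.expectation M (\<lambda>\<omega>. mean_objective f (weighted_avg (stepsize \<rho> \<delta>) (\<lambda>t. x t l \<omega>) T))
            - mean_objective f xstar
          \<le> sqrt (real CARD('n)) * Lh * (1 / real CARD('v) * (\<Sum>i\<in>UNIV. \<mu> i))
            + 2 * C / real T powr (1 - \<delta>))"
proof -
  note net = assms(1) and lip = assms(6) and Lh = assms(7)
  interpret prob_space M by (rule assms(16))
  have lip': "Lh-lipschitz_on UNIV (f i)" for i
    by (rule lipschitz_on_le[OF lip]) (simp add: Lh)
  interpret G: gradient_free_mirror_descent X U \<sigma> \<phi> M E P B \<zeta> f Lh \<mu> "stepsize \<rho> \<delta>" \<xi>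
  proof
    show "X \<noteq> {}" using assms(4) by auto
    show "0 < stepsize \<rho> \<delta> t" for t using assms(13) by (rule stepsize_pos)
  qed (use assms lip' in auto)
  have u: "xstar \<in> X" using assms(20) by (simp add: is_arg_min_def)
  define gap where "gap = expectation (\<lambda>\<omega>. mean_objective f (weighted_avg (stepsize \<rho> \<delta>) (\<lambda>t. x t l \<omega>) T))
            - mean_objective f xstar"
  define R where "R = sqrt (real CARD('n)) * Lh * (1 / real CARD('v) * (\<Sum>i\<in>UNIV. \<mu> i))"
  have "expectation (\<lambda>\<omega>. mean_objective f (weighted_avg (stepsize \<rho> \<delta>) (\<lambda>t. x t l \<omega>) T))
      = expectation (\<lambda>\<omega>. mean_objective f (weighted_avg (stepsize \<rho> \<delta>) (\<lambda>t. G.iterate t l \<omega>) T))"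
    by (rule Bochner_Integration.integral_cong) (use G.drgfmd_eq_iterate[OF assms(19)] in auto)
  then have main: "gap * (\<Sum>t=1..T. 1 / stepsize \<rho> \<delta> t)
    \<le> R * (\<Sum>t=1..T. 1 / stepsize \<rho> \<delta> t)
      + d\<^sup>2 / (stepsize \<rho> \<delta> T)\<^sup>2 + real T * ((real CARD('n) + 4)\<^sup>2 * Lh\<^sup>2 / (2 * \<sigma>))
      + C_tilde CARD('v) CARD('n) Lh \<sigma> \<zeta> B * (\<Sum>s<T. stepsize \<rho> \<delta> s) / stepsize \<rho> \<delta> T"
    unfolding gap_def R_def
    using G.weighted_gap_bound[OF u assms(9)[OF u] assms(21) stepsize_antimono[OF assms(13) assms(11)], of l] by simp
  have "0 \<le> 2 * (16 * real B * (real CARD('v))\<^sup>2 / \<zeta>) * (real CARD('v) * (real CARD('n) * Lh\<^sup>2 / \<sigma>))"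
    using G.\<zeta> G.\<sigma>_pos by simp
  also have "\<dots> \<le> C_tilde CARD('v) CARD('n) Lh \<sigma> \<zeta> B"
    using G.\<zeta> G.\<sigma>_pos G.B_pos by (intro C_tilde_ge) auto
  finally have Ct: "0 \<le> C_tilde CARD('v) CARD('n) Lh \<sigma> \<zeta> B" .
  note rate = rate_from_weighted_bound[OF assms(11-15) assms(21) G.\<sigma>_pos Ct main, folded assms(22)]
  have T: "1 \<le> real T" using assms(21) by simp
  have C0: "0 \<le> C" by (rule rate(2))
  have inv: "C * real T powr (- a) = C / real T powr a" for a
    by (simp add: powr_minus_divide)
  have small: "gap \<le> R + 2 * C / real T powr \<delta>" if "\<delta> \<le> 1/2"
  proof -
    have "C * real T powr (\<delta> - 1) \<le> C * real T powr (- \<delta>)"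
      using that T C0 by (intro mult_left_mono powr_mono) auto
    then show ?thesis using rate(1) inv[of \<delta>] by simp
  qed
  have large: "gap \<le> R + 2 * C / real T powr (1 - \<delta>)" if "1/2 < \<delta>"
  proof -
    have "C * real T powr (- \<delta>) \<le> C * real T powr (\<delta> - 1)"
      using that T C0 by (intro mult_left_mono powr_mono) auto
    then show ?thesis using rate(1) inv[of "1 - \<delta>"] by simp
  qed
  have half: "gap \<le> R + 2 * C / sqrt (real T)" if "\<delta> = 1/2"
  proof -
    have "real T powr \<delta> = sqrt (real T)" unfolding that by (rule powr_half_sqrt) simp
    then show ?thesis using small that by simp
  qed
  show ?thesis
    unfolding gap_def[symmetric] R_def[symmetric]
    using small half large by auto
qed

end
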